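(* Let $\mathcal S=(M,\Delta,\langle\cdot,\cdot\rangle)$ be a sub-Riemannian surface, not assumed to be contact, whose singular set $\Sigma$ is a 2-dimensional submanifold of $M$ such that $\Delta$ is transversal to $\Sigma$. Let $$d\eta^a=C^a_{23}\,\eta^2\wedge\eta^3+C^a_{31}\,\eta^3\wedge\eta^1+C^a_{12}\,\eta^1\wedge\eta^2,\qquad a=1,2,3,$$ be the structure equations of the adapted frame (with dual coframe $\{\eta^a\}$) of the sub-Riemannian surface in a neighborhood of a point of $\Sigma$. Then the functions $Q^1_{12}=C^1_{12}|_\Sigma$ and $Q^2_{12}=C^2_{12}|_\Sigma$ do not depend on the choice of adapted frame, and so these functions are invariants of the sub-Riemannian surface.
   Context: A sub-Riemannian surface $(M,\Delta,\langle\cdot,\cdot\rangle)$ is an oriented 3-manifold $M$ with an oriented rank-2 distribution $\Delta$ carrying a metric tensor. The singular set is $\Sigma=\{p:(\omega\wedge d\omega)_p=0\}$, where $\omega$ is a nonvanishing 1-form with kernel $\Delta$ ($\Sigma$ does not depend on $\omega$). $Ann(\Delta)\subset T^*M$ is the line bundle of covectors vanishing on $\Delta$. For a nonvanishing section $\omega$ of $Ann(\Delta)$ the nonholonomity function is $\lambda_\omega=\omega([E_1,E_2])$ for any local positively oriented orthonormal frame $E_1,E_2$ of $\Delta$ (it does not depend on the frame). A nonvanishing section $\omega$ of $Ann(\Delta)$ on a neighborhood of $p$ is called special at $p$ if there is a vector field $V$ on that neighborhood with $L_V\omega=0$ and $\omega(V)=1$; this $V$ is unique and is called the characteristic vector field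 of $\omega$. Adapted frame determined by a special form $\omega$ near a point $p\in\Sigma$: on a neighborhood $U$ of $p$ foliated by the level surfaces $\Sigma_c=\lambda_\omega^{-1}(c)\cap U$, which are transversal to $\Delta$ (with $\Sigma_0=\Sigma\cap U$), $E_1$ is the unit vector field of the line distribution $\Delta\cap T\Sigma_c$ (there are two such vector fields, opposite to each other; one of them is taken); $E_2$ is the section of $\Delta$ such that $(E_1,E_2)$ is a positively oriented orthonormal frame field of $\Delta$; $E_3$ is the characteristic vector field of $\omega$. The adapted coframe $\{\eta^1,\eta^2,\eta^3\}$ is dual to $\{E_1,E_2,E_3\}$ (so $\eta^3=\omega$).
   Formalization: Since either of the two opposite unit fields E_1 may be taken, independence holds only up to a common sign: at each point of Σ, Q^1_12 and Q^2_12 agree if the two frames have the same E_1 there, and both change sign if the E_1's are opposite. *)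

theory Defs
  imports "HOL-Analysis.Analysis"
begin

text \<open>
  Smoothness on open subsets of normed spaces (only ever used for open \<open>S\<close> in finite
  dimension, where it is the usual notion of class \<open>C\<^sup>\<infinity>\<close>).
\<close>

primrec Ck_on :: "nat \<Rightarrow> ('b::real_normed_vector \<Rightarrow> 'c::real_normed_vector) \<Rightarrow> 'b set \<Rightarrow> bool" where
  "Ck_on 0 f S \<longleftrightarrow> continuous_on S f"
| "Ck_on (Suc k) f S \<longleftrightarrow>
     (\<forall>x\<in>S. f differentiable (at x)) \<and> (\<forall>v. Ck_on k (\<lambda>x. frechet_derivative f (at x) v) S)"

definition smooth_on :: "('b::real_normed_vector \<Rightarrow> 'c::real_normed_vector) \<Rightarrow> 'b set \<Rightarrow> bool" where
  "smooth_on f S \<longleftrightarrow> (\<forall>k. Ck_on k f S)"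


section \<open>Oriented 3-manifolds\<close>

text \<open>
  A chart is a pair of a domain and a coordinate map.  A manifold is given by an atlas; its
  underlying set is the union of the chart domains.
\<close>

type_synonym 'a chart = "'a set \<times> ('a \<Rightarrow> real^3)"

definition chart_inv :: "'a chart \<Rightarrow> real^3 \<Rightarrow> 'a" where
  "chart_inv c = inv_into (fst c) (snd c)"

definition transition :: "'a chart \<Rightarrow> 'a chart \<Rightarrow> real^3 \<Rightarrow> real^3" where
  "transition c c' = snd c' \<circ> chart_inv c"

definition oriented_atlas :: "'a::{t2_space,second_countable_topology} chart set \<Rightarrow> bool" where
  "oriented_atlas A \<longleftrightarrow>
     (\<forall>c\<in>A. open (fst c) \<and> open (snd c ` fst c) \<and>
            homeomorphism (fst c) (snd c ` fst c) (snd c) (chart_inv c)) \<and>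
     (\<forall>c\<in>A. \<forall>c'\<in>A.
        smooth_on (transition c c') (snd c ` (fst c \<inter> fst c')) \<and>
        (\<forall>x\<in>snd c ` (fst c \<inter> fst c'). det (matrix (frechet_derivative (transition c c') (at x))) > 0))"

definition mfd :: "'a chart set \<Rightarrow> 'a set" where
  "mfd A = (\<Union>c\<in>A. fst c)"

text \<open>Charts of the maximal oriented atlas containing \<open>A\<close>.\<close>

definition compatible_chart :: "'a::{t2_space,second_countable_topology} chart set \<Rightarrow> 'a chart \<Rightarrow> bool" where
  "compatible_chart A c \<longleftrightarrow> oriented_atlas (insert c A) \<and> fst c \<subseteq> mfd A"

text \<open>
  Every point \<open>p\<close> carries a preferred chart of the atlas, and the tangent space at \<open>p\<close> is
  identified with \<open>\<real>\<^sup>3\<close> through the coordinates of this chart.  Hence a vector field is a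
  function \<open>'a \<Rightarrow> real^3\<close>, a 1-form a function \<open>'a \<Rightarrow> real^3 \<Rightarrow> real\<close> (linear in the vector), and
  so on.  The preferred chart need not vary continuously with \<open>p\<close>, so smoothness and
  derivatives are always expressed through the components in one fixed chart; these are
  obtained from the tangent vectors with the differential of the change of coordinates.
\<close>

definition chart_at :: "'a chart set \<Rightarrow> 'a \<Rightarrow> 'a chart" where
  "chart_at A p = (SOME c. c \<in> A \<and> p \<in> fst c)"

definition coord_at :: "'a chart set \<Rightarrow> 'a \<Rightarrow> real^3" where
  "coord_at A p = snd (chart_at A p) p"

text \<open>Components, in the chart \<open>c\<close>, of a vector field and of a 1-form.\<close>

definition vf_rep :: "'a chart set \<Rightarrow> 'a chart \<Rightarrow> ('a \<Rightarrow> real^3) \<Rightarrow> real^3 \<Rightarrow> real^3" where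
  "vf_rep A c X x = (let q = chart_inv c x in
     frechet_derivative (transition (chart_at A q) c) (at (coord_at A q)) (X q))"

definition form_rep :: "'a chart set \<Rightarrow> 'a chart \<Rightarrow> ('a \<Rightarrow> real^3 \<Rightarrow> real) \<Rightarrow> real^3 \<Rightarrow> real^3 \<Rightarrow> real" where
  "form_rep A c \<alpha> x v = (let q = chart_inv c x in
     \<alpha> q (frechet_derivative (transition c (chart_at A q)) (at x) v))"

definition smooth_fun :: "'a chart set \<Rightarrow> 'a set \<Rightarrow> ('a \<Rightarrow> real) \<Rightarrow> bool" where
  "smooth_fun A U f \<longleftrightarrow> (\<forall>c\<in>A. smooth_on (f \<circ> chart_inv c) (snd c ` (U \<inter> fst c)))"

definition smooth_vf :: "'a chart set \<Rightarrow> 'a set \<Rightarrow> ('a \<Rightarrow> real^3) \<Rightarrow> bool" where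
  "smooth_vf A U X \<longleftrightarrow> (\<forall>c\<in>A. smooth_on (vf_rep A c X) (snd c ` (U \<inter> fst c)))"

definition smooth_form :: "'a chart set \<Rightarrow> 'a set \<Rightarrow> ('a \<Rightarrow> real^3 \<Rightarrow> real) \<Rightarrow> bool" where
  "smooth_form A U \<alpha> \<longleftrightarrow> (\<forall>p\<in>U. linear (\<alpha> p)) \<and>
     (\<forall>c\<in>A. \<forall>v. smooth_on (\<lambda>x. form_rep A c \<alpha> x v) (snd c ` (U \<inter> fst c)))"


section \<open>Differential calculus\<close>

text \<open>
  The value at \<open>p\<close> of each operator is given by the usual coordinate formula in the preferred
  chart at \<open>p\<close>.
\<close>

definition lie_bracket :: "'a chart set \<Rightarrow> ('a \<Rightarrow> real^3) \<Rightarrow> ('a \<Rightarrow> real^3) \<Rightarrow> 'a \<Rightarrow> real^3" where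
  "lie_bracket A X Y p =
     frechet_derivative (vf_rep A (chart_at A p) Y) (at (coord_at A p)) (X p) -
     frechet_derivative (vf_rep A (chart_at A p) X) (at (coord_at A p)) (Y p)"

definition ext_deriv :: "'a chart set \<Rightarrow> ('a \<Rightarrow> real^3 \<Rightarrow> real) \<Rightarrow> 'a \<Rightarrow> real^3 \<Rightarrow> real^3 \<Rightarrow> real" where
  "ext_deriv A \<alpha> p u v =
     frechet_derivative (\<lambda>x. form_rep A (chart_at A p) \<alpha> x v) (at (coord_at A p)) u -
     frechet_derivative (\<lambda>x. form_rep A (chart_at A p) \<alpha> x u) (at (coord_at A p)) v"

text \<open>\<open>(L\<^sub>V \<alpha>)\<^sub>j = V\<^sup>i \<partial>\<^sub>i\<alpha>\<^sub>j + \<alpha>\<^sub>i \<partial>\<^sub>jV\<^sup>i\<close>\<close>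

definition lie_deriv :: "'a chart set \<Rightarrow> ('a \<Rightarrow> real^3) \<Rightarrow> ('a \<Rightarrow> real^3 \<Rightarrow> real) \<Rightarrow> 'a \<Rightarrow> real^3 \<Rightarrow> real" where
  "lie_deriv A V \<alpha> p u =
     frechet_derivative (\<lambda>x. form_rep A (chart_at A p) \<alpha> x u) (at (coord_at A p)) (V p) +
     \<alpha> p (frechet_derivative (vf_rep A (chart_at A p) V) (at (coord_at A p)) u)"

definition wedge11 :: "(real^3 \<Rightarrow> real) \<Rightarrow> (real^3 \<Rightarrow> real) \<Rightarrow> real^3 \<Rightarrow> real^3 \<Rightarrow> real" where
  "wedge11 \<alpha> \<beta> u v = \<alpha> u * \<beta> v - \<alpha> v * \<beta> u"

definition wedge12 ::
  "(real^3 \<Rightarrow> real) \<Rightarrow> (real^3 \<Rightarrow> real^3 \<Rightarrow> real) \<Rightarrow> real^3 \<Rightarrow> real^3 \<Rightarrow> real^3 \<Rightarrow> real" where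
  "wedge12 \<alpha> \<beta> u v w = \<alpha> u * \<beta> v w + \<alpha> v * \<beta> w u + \<alpha> w * \<beta> u v"


section \<open>Surfaces in a 3-manifold\<close>

text \<open>Embedded 2-dimensional submanifolds, by slice charts.\<close>

definition surface :: "'a::{t2_space,second_countable_topology} chart set \<Rightarrow> 'a set \<Rightarrow> bool" where
  "surface A S \<longleftrightarrow> S \<subseteq> mfd A \<and>
     (\<forall>p\<in>S. \<exists>c. compatible_chart A c \<and> p \<in> fst c \<and>
        snd c ` (S \<inter> fst c) = {x \<in> snd c ` fst c. x $ 3 = 0})"

text \<open>Velocities at \<open>p\<close> of smooth curves lying in \<open>S\<close>.\<close>

definition tangent_space :: "'a chart set \<Rightarrow> 'a set \<Rightarrow> 'a \<Rightarrow> (real^3) set" where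
  "tangent_space A S p = {v. \<exists>(\<gamma>::real \<Rightarrow> 'a) e. e > 0 \<and> \<gamma> 0 = p \<and>
     (\<forall>t\<in>{-e<..<e}. \<gamma> t \<in> S \<inter> fst (chart_at A p)) \<and>
     smooth_on (\<lambda>t. snd (chart_at A p) (\<gamma> t)) {-e<..<e} \<and>
     ((\<lambda>t. snd (chart_at A p) (\<gamma> t)) has_vector_derivative v) (at 0)}"

definition transversal :: "'a chart set \<Rightarrow> ('a \<Rightarrow> (real^3) set) \<Rightarrow> 'a set \<Rightarrow> bool" where
  "transversal A \<Delta> S \<longleftrightarrow> (\<forall>p\<in>S. {u + v |u v. u \<in> \<Delta> p \<and> v \<in> tangent_space A S p} = UNIV)"

text \<open>
  The level sets of \<open>f\<close> in \<open>U\<close> are surfaces and form a foliation of \<open>U\<close>: around every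
  point there is a chart in which each level set is a union of slices \<open>x\<^sub>3 = const\<close>.
  No regularity of the values of \<open>f\<close> is required.
\<close>

definition foliated_by_levels ::
  "'a::{t2_space,second_countable_topology} chart set \<Rightarrow> 'a set \<Rightarrow> ('a \<Rightarrow> real) \<Rightarrow> bool" where
  "foliated_by_levels A U f \<longleftrightarrow>
     (\<forall>r. surface A {q\<in>U. f q = r}) \<and>
     (\<forall>p\<in>U. \<exists>c. compatible_chart A c \<and> p \<in> fst c \<and> fst c \<subseteq> U \<and>
        (\<forall>x\<in>fst c. \<forall>y\<in>fst c. snd c x $ 3 = snd c y $ 3 \<longrightarrow> f x = f y))"


section \<open>Sub-Riemannian surfaces\<close>

text \<open>
  \<open>P\<close> is one of the two orientations of the plane \<open>W\<close>, given as the set of its positive bases.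
\<close>

definition plane_orientation :: "(real^3) set \<Rightarrow> (real^3 \<Rightarrow> real^3 \<Rightarrow> bool) \<Rightarrow> bool" where
  "plane_orientation W P \<longleftrightarrow> (\<exists>u v. W = span {u, v} \<and>
     (\<forall>x y. P x y \<longleftrightarrow> (\<exists>a b c d. x = a *\<^sub>R u + b *\<^sub>R v \<and> y = c *\<^sub>R u + d *\<^sub>R v \<and> a * d - b * c > 0)))"

definition oriented_distribution ::
  "'a::topological_space chart set \<Rightarrow> ('a \<Rightarrow> (real^3) set) \<Rightarrow> ('a \<Rightarrow> real^3 \<Rightarrow> real^3 \<Rightarrow> bool) \<Rightarrow> bool" where
  "oriented_distribution A \<Delta> ori \<longleftrightarrow>
     (\<forall>p\<in>mfd A. subspace (\<Delta> p) \<and> dim (\<Delta> p) = 2 \<and> plane_orientation (\<Delta> p) (ori p)) \<and>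
     (\<forall>p\<in>mfd A. \<exists>U X Y. open U \<and> p \<in> U \<and> U \<subseteq> mfd A \<and> smooth_vf A U X \<and> smooth_vf A U Y \<and>
        (\<forall>q\<in>U. \<Delta> q = span {X q, Y q} \<and> ori q (X q) (Y q)))"

text \<open>Only the values of \<open>g p\<close> on \<open>\<Delta> p\<close> matter.\<close>

definition metric_on ::
  "'a::topological_space chart set \<Rightarrow> ('a \<Rightarrow> (real^3) set) \<Rightarrow> ('a \<Rightarrow> real^3 \<Rightarrow> real^3 \<Rightarrow> real) \<Rightarrow> bool" where
  "metric_on A \<Delta> g \<longleftrightarrow>
     (\<forall>p\<in>mfd A. \<forall>u\<in>\<Delta> p. \<forall>v\<in>\<Delta> p. \<forall>w\<in>\<Delta> p. \<forall>a b.
        g p u v = g p v u \<and>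
        g p (a *\<^sub>R u + b *\<^sub>R v) w = a * g p u w + b * g p v w \<and>
        (u \<noteq> 0 \<longrightarrow> g p u u > 0)) \<and>
     (\<forall>U X Y. open U \<and> U \<subseteq> mfd A \<and> smooth_vf A U X \<and> smooth_vf A U Y \<and>
        (\<forall>q\<in>U. X q \<in> \<Delta> q \<and> Y q \<in> \<Delta> q) \<longrightarrow> smooth_fun A U (\<lambda>q. g q (X q) (Y q)))"

definition sub_riemannian_surface ::
  "'a::{t2_space,second_countable_topology} chart set \<Rightarrow> ('a \<Rightarrow> (real^3) set) \<Rightarrow>
   ('a \<Rightarrow> real^3 \<Rightarrow> real^3 \<Rightarrow> bool) \<Rightarrow> ('a \<Rightarrow> real^3 \<Rightarrow> real^3 \<Rightarrow> real) \<Rightarrow> bool" where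
  "sub_riemannian_surface A \<Delta> ori g \<longleftrightarrow>
     oriented_atlas A \<and> oriented_distribution A \<Delta> ori \<and> metric_on A \<Delta> g"

text \<open>Nonvanishing sections of \<open>Ann(\<Delta>)\<close> over \<open>U\<close>; since \<open>\<Delta>\<close> has rank 2, their kernel is \<open>\<Delta>\<close>.\<close>

definition ann_section ::
  "'a chart set \<Rightarrow> ('a \<Rightarrow> (real^3) set) \<Rightarrow> 'a set \<Rightarrow> ('a \<Rightarrow> real^3 \<Rightarrow> real) \<Rightarrow> bool" where
  "ann_section A \<Delta> U \<omega> \<longleftrightarrow> smooth_form A U \<omega> \<and>
     (\<forall>p\<in>U. (\<forall>v\<in>\<Delta> p. \<omega> p v = 0) \<and> (\<exists>v. \<omega> p v \<noteq> 0))"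

text \<open>The condition \<open>(\<omega> \<and> d\<omega>)\<^sub>p = 0\<close> does not depend on \<open>\<omega>\<close>, so a local \<open>\<omega>\<close> is enough.\<close>

definition singular_set :: "'a::topological_space chart set \<Rightarrow> ('a \<Rightarrow> (real^3) set) \<Rightarrow> 'a set" where
  "singular_set A \<Delta> = {p \<in> mfd A. \<exists>U \<omega>. open U \<and> p \<in> U \<and> U \<subseteq> mfd A \<and> ann_section A \<Delta> U \<omega> \<and>
     (\<forall>u v w. wedge12 (\<omega> p) (ext_deriv A \<omega> p) u v w = 0)}"

definition oriented_orthonormal_frame ::
  "'a chart set \<Rightarrow> ('a \<Rightarrow> (real^3) set) \<Rightarrow> ('a \<Rightarrow> real^3 \<Rightarrow> real^3 \<Rightarrow> bool) \<Rightarrow>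
   ('a \<Rightarrow> real^3 \<Rightarrow> real^3 \<Rightarrow> real) \<Rightarrow> 'a set \<Rightarrow> ('a \<Rightarrow> real^3) \<Rightarrow> ('a \<Rightarrow> real^3) \<Rightarrow> bool" where
  "oriented_orthonormal_frame A \<Delta> ori g U X Y \<longleftrightarrow>
     smooth_vf A U X \<and> smooth_vf A U Y \<and>
     (\<forall>q\<in>U. X q \<in> \<Delta> q \<and> Y q \<in> \<Delta> q \<and> ori q (X q) (Y q) \<and>
        g q (X q) (X q) = 1 \<and> g q (Y q) (Y q) = 1 \<and> g q (X q) (Y q) = 0)"

text \<open>
  The nonholonomity function \<open>\<lambda>\<^sub>\<omega>\<close>; the value \<open>l\<close> is the same for all admissible frames
  \<open>(X, Y)\<close> near \<open>p\<close>.
\<close>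

definition nonholonomity ::
  "'a::topological_space chart set \<Rightarrow> ('a \<Rightarrow> (real^3) set) \<Rightarrow> ('a \<Rightarrow> real^3 \<Rightarrow> real^3 \<Rightarrow> bool) \<Rightarrow>
   ('a \<Rightarrow> real^3 \<Rightarrow> real^3 \<Rightarrow> real) \<Rightarrow> ('a \<Rightarrow> real^3 \<Rightarrow> real) \<Rightarrow> 'a \<Rightarrow> real" where
  "nonholonomity A \<Delta> ori g \<omega> p = (THE l. \<exists>U X Y. open U \<and> p \<in> U \<and> U \<subseteq> mfd A \<and>
     oriented_orthonormal_frame A \<Delta> ori g U X Y \<and> l = \<omega> p (lie_bracket A X Y p))"

text \<open>The form \<open>\<omega>\<close> is special iff it has a characteristic vector field.\<close>

definition characteristic_field ::
  "'a chart set \<Rightarrow> 'a set \<Rightarrow> ('a \<Rightarrow> real^3 \<Rightarrow> real) \<Rightarrow> ('a \<Rightarrow> real^3) \<Rightarrow> bool" where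
  "characteristic_field A U \<omega> V \<longleftrightarrow> smooth_vf A U V \<and>
     (\<forall>p\<in>U. (\<forall>u. lie_deriv A V \<omega> p u = 0) \<and> \<omega> p (V p) = 1)"

text \<open>
  Frames are indexed by the type \<open>3\<close>.  The unit field \<open>E 1\<close> may be either of the two possible ones.
\<close>

definition adapted_frame ::
  "'a::{t2_space,second_countable_topology} chart set \<Rightarrow> ('a \<Rightarrow> (real^3) set) \<Rightarrow>
   ('a \<Rightarrow> real^3 \<Rightarrow> real^3 \<Rightarrow> bool) \<Rightarrow> ('a \<Rightarrow> real^3 \<Rightarrow> real^3 \<Rightarrow> real) \<Rightarrow> 'a set \<Rightarrow>
   ('a \<Rightarrow> real^3 \<Rightarrow> real) \<Rightarrow> (3 \<Rightarrow> 'a \<Rightarrow> real^3) \<Rightarrow> bool" where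
  "adapted_frame A \<Delta> ori g U \<omega> E \<longleftrightarrow>
     open U \<and> U \<subseteq> mfd A \<and> ann_section A \<Delta> U \<omega> \<and> characteristic_field A U \<omega> (E 3) \<and>
     (let lam = nonholonomity A \<Delta> ori g \<omega>; level = (\<lambda>r. {q\<in>U. lam q = r}) in
        foliated_by_levels A U lam \<and>
        (\<forall>r. transversal A \<Delta> (level r)) \<and>
        (\<forall>q\<in>U. E 1 q \<in> tangent_space A (level (lam q)) q)) \<and>
     oriented_orthonormal_frame A \<Delta> ori g U (E 1) (E 2)"

definition dual_coframe ::
  "'a set \<Rightarrow> (3 \<Rightarrow> 'a \<Rightarrow> real^3) \<Rightarrow> (3 \<Rightarrow> 'a \<Rightarrow> real^3 \<Rightarrow> real) \<Rightarrow> bool" where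
  "dual_coframe U E \<eta> \<longleftrightarrow>
     (\<forall>q\<in>U. \<forall>a. linear (\<eta> a q) \<and> (\<forall>b. \<eta> a q (E b q) = (if a = b then 1 else 0)))"

text \<open>\<open>C a b c\<close> is the function \<open>C\<^sup>a\<^sub>b\<^sub>c\<close>.\<close>

definition structure_equations ::
  "'a chart set \<Rightarrow> 'a set \<Rightarrow> (3 \<Rightarrow> 'a \<Rightarrow> real^3 \<Rightarrow> real) \<Rightarrow> (3 \<Rightarrow> 3 \<Rightarrow> 3 \<Rightarrow> 'a \<Rightarrow> real) \<Rightarrow> bool" where
  "structure_equations A U \<eta> C \<longleftrightarrow> (\<forall>q\<in>U. \<forall>a u v.
     ext_deriv A (\<eta> a) q u v =
       C a 2 3 q * wedge11 (\<eta> 2 q) (\<eta> 3 q) u v +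
       C a 3 1 q * wedge11 (\<eta> 3 q) (\<eta> 1 q) u v +
       C a 1 2 q * wedge11 (\<eta> 1 q) (\<eta> 2 q) u v)"

end

theory Submission
  imports Defs
begin

text \<open>
  Pairing the structure equations with \<open>E\<^sub>1, E\<^sub>2\<close> shows that \<open>C\<^sup>a\<^sub>1\<^sub>2 = - \<eta>\<^sup>a([E\<^sub>1, E\<^sub>2])\<close>
  (\<open>structure_coefficient_eq_bracket\<close>), and at a singular point \<open>q\<close> the bracket lies in \<open>\<Delta>\<close>.
  So the brackets of two adapted frames have to be compared at \<open>q\<close>.  The frames are related by
  a rotation, \<open>E\<^sub>1' = c E\<^sub>1 + s E\<^sub>2\<close> and \<open>E\<^sub>2' = - s E\<^sub>1 + c E\<^sub>2\<close>.  On the singular set both \<open>E\<^sub>1\<close> and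
  \<open>E\<^sub>1'\<close> span the line \<open>\<Delta> \<inter> T\<Sigma>\<close>, hence \<open>s = 0\<close> and \<open>c = \<plusminus>1\<close> there
  (\<open>rotation_zero_on_singular_level\<close>).  If moreover \<open>ds = 0\<close> at \<open>q\<close>, then \<open>dc = 0\<close> by
  \<open>c\<^sup>2 + s\<^sup>2 = 1\<close>, the two brackets agree at \<open>q\<close> (\<open>adapted_frames_same_bracket\<close>), and the sign \<open>c\<close>
  reaches the coefficients only through the dual coframe.

  The heart of the matter is therefore \<open>ds = 0\<close> at \<open>q\<close> (\<open>rotation_derivative_zero\<close>).  In the
  directions of \<open>\<Sigma>\<close> it holds because \<open>s\<close> vanishes on \<open>\<Sigma>\<close>, which leaves one transversal direction.  Write \<open>\<omega>' = f \<omega>\<close>; then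
  \<open>\<lambda>' = f \<lambda>\<close>, because both sides come from the same bracket.  Since \<open>E\<^sub>1 \<lambda> = 0\<close> and \<open>E\<^sub>1' \<lambda>' = 0\<close>,
  expanding \<open>E\<^sub>1' (f \<lambda>) = 0\<close> gives
  \<open>s (f E\<^sub>2 \<lambda> + \<lambda> E\<^sub>2 f) = - c \<lambda> E\<^sub>1 f\<close> (\<open>frame_change_identity\<close>).
  A special form satisfies \<open>d\<omega>(E\<^sub>3, \<cdot>) = 0\<close>, so \<open>d\<omega> = - \<lambda> \<eta>\<^sup>1 \<and> \<eta>\<^sup>2\<close>, and \<open>d\<omega>' = df \<and> \<omega> + f d\<omega>\<close> yields
  \<open>E\<^sub>1 f = d\<omega>'(E\<^sub>1, E\<^sub>3)\<close>.  This vanishes at \<open>q\<close>, as \<open>d\<omega>'\<close> does, so on a line that crosses \<open>\<Sigma>\<close>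
  at \<open>q\<close> with parameter \<open>t\<close> it is \<open>O(t)\<close>.

  The function \<open>\<lambda>\<close> may vanish on \<open>\<Sigma>\<close> to a high or even infinite order, so the identity cannot
  simply be differentiated.  However, \<open>\<lambda>\<close> depends on the slice coordinate of the level foliation
  alone, and the logarithmic derivative of a function of one variable that tends to \<open>0\<close> is
  unbounded (\<open>log_derivative_unbounded\<close>).  Dividing the identity by \<open>\<lambda>\<close> along the line,
  the factor of \<open>s\<close> becomes arbitrarily large at points accumulating at \<open>q\<close> while the right-hand
  side is \<open>O(t)\<close>; hence the limit of \<open>s / t\<close>, which is the derivative of \<open>s\<close> along the line, is \<open>0\<close>.

  All this takes place in a neighborhood of \<open>q\<close>, whereas the operators are defined at every point
  by the preferred chart of that point.  The chart independence of the exterior derivative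
  (\<open>ext_deriv_to_chart\<close>), which rests on the symmetry of second derivatives, allows all
  computations with forms and vector fields to be done in the preferred chart of \<open>q\<close>.
\<close>

section \<open>Differential calculus in Euclidean space\<close>

text \<open>
  The mean value theorem in direction \<open>u\<close> turns the second difference into
  \<open>t\<close> times a difference of two values of the derivative along \<open>u\<close>,
  taken at points at distance \<open>O(t)\<close> from \<open>x\<close>; the linearization at
  \<open>x\<close> evaluates that difference up to \<open>o(t)\<close>.
\<close>

lemma second_difference_tendsto:
  fixes f :: "'a::real_normed_vector \<Rightarrow> real"
  assumes S: "open S" "x \<in> S" and f: "\<And>y. y \<in> S \<Longrightarrow> f differentiable (at y)"
    and g: "((\<lambda>y. frechet_derivative f (at y) u) has_derivative G) (at x)"
  shows "((\<lambda>t. (f (x + t *\<^sub>R u + t *\<^sub>R v) - f (x + t *\<^sub>R u) - f (x + t *\<^sub>R v) + f x) / t\<^sup>2)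
           \<longlongrightarrow> G v) (at_right 0)"
proof -
  define N where "N = norm u + norm v + 1"
  have N: "N > 0" "norm u + norm v \<le> N" "norm u \<le> N" by (auto simp: N_def add_nonneg_pos)
  define g' where "g' y = frechet_derivative f (at y) u" for y
  have G: "linear G" using g has_derivative_linear by blast
  have lin: "linear (frechet_derivative f (at y))" if "y \<in> S" for y
    using f[OF that] linear_frechet_derivative by blast
  show ?thesis
  proof (rule tendstoI)
    fix e :: real assume e: "e > 0"
    define e' where "e' = e / (4 * N)"
    have e': "e' > 0" using e N by (simp add: e'_def)
    obtain d where d: "d > 0"
      and gd: "\<And>y. norm (y - x) < d \<Longrightarrow> norm (g' y - g' x - G (y - x)) \<le> e' * norm (y - x)"
      using g e' unfolding has_derivative_at_alt g'_def by blast
    obtain r where r: "r > 0" "ball x r \<subseteq> S" using S open_contains_ball by blast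
    define t0 where "t0 = min d r / (2 * N)"
    have t0: "t0 > 0" using d r N by (simp add: t0_def)
    have "dist ((f (x + t *\<^sub>R u + t *\<^sub>R v) - f (x + t *\<^sub>R u) - f (x + t *\<^sub>R v) + f x) / t\<^sup>2) (G v) < e"
      if t: "0 < t" "t < t0" for t
    proof -
      have tN: "t * N < d" "t * N < r"
        using t N d r by (auto simp: t0_def field_simps)
      have nm: "norm (s *\<^sub>R t *\<^sub>R u + b *\<^sub>R t *\<^sub>R v) \<le> t * N" if "0 \<le> s" "s \<le> 1" "b \<in> {0,1}" for s b
      proof -
        have "norm (s *\<^sub>R t *\<^sub>R u + b *\<^sub>R t *\<^sub>R v) \<le> s * (t * norm u) + b * (t * norm v)"
          using that t by (intro norm_triangle_le) auto
        also have "\<dots> \<le> 1 * (t * norm u) + 1 * (t * norm v)"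
          using that t by (intro add_mono mult_right_mono) auto
        also have "\<dots> \<le> t * N" using t N by (simp flip: distrib_left)
        finally show ?thesis .
      qed
      have inS: "x + (s *\<^sub>R t *\<^sub>R u + b *\<^sub>R t *\<^sub>R v) \<in> S" if "0 \<le> s" "s \<le> 1" "b \<in> {0,1}" for s b
      proof (rule subsetD[OF r(2)])
        have "x + z \<in> ball x r \<longleftrightarrow> norm z < r" for z by (simp add: dist_norm)
        then show "x + (s *\<^sub>R t *\<^sub>R u + b *\<^sub>R t *\<^sub>R v) \<in> ball x r"
          using le_less_trans[OF nm[OF that] tN(2)] by blast
      qed
      define \<phi> where "\<phi> s = f (x + (s *\<^sub>R t *\<^sub>R u + 1 *\<^sub>R t *\<^sub>R v)) - f (x + (s *\<^sub>R t *\<^sub>R u + 0 *\<^sub>R t *\<^sub>R v))" for s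
      have der: "((\<lambda>s. f (x + (s *\<^sub>R t *\<^sub>R u + b *\<^sub>R t *\<^sub>R v))) has_derivative
                 (\<lambda>h. h * (t * g' (x + (s *\<^sub>R t *\<^sub>R u + b *\<^sub>R t *\<^sub>R v))))) (at s)"
        if "0 \<le> s" "s \<le> 1" "b \<in> {0,1}" for s b
      proof -
        have "((\<lambda>s. x + (s *\<^sub>R t *\<^sub>R u + b *\<^sub>R t *\<^sub>R v)) has_derivative (\<lambda>h. h *\<^sub>R t *\<^sub>R u)) (at s)"
          by (auto intro!: derivative_eq_intros)
        from has_derivative_compose[OF this f[OF inS[OF that], unfolded frechet_derivative_works]]
        show ?thesis
          using linear_cmul[OF lin[OF inS[OF that]]] by (simp add: g'_def mult.assoc)
      qed
      have "\<exists>z. 0 < z \<and> z < 1 \<and> \<phi> 1 - \<phi> 0 = (1 - 0) *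
           (t * g' (x + (z *\<^sub>R t *\<^sub>R u + 1 *\<^sub>R t *\<^sub>R v)) - t * g' (x + (z *\<^sub>R t *\<^sub>R u + 0 *\<^sub>R t *\<^sub>R v)))"
      proof (rule MVT2)
        fix s :: real assume s: "0 \<le> s" "s \<le> 1"
        show "(\<phi> has_real_derivative
          (t * g' (x + (s *\<^sub>R t *\<^sub>R u + 1 *\<^sub>R t *\<^sub>R v)) - t * g' (x + (s *\<^sub>R t *\<^sub>R u + 0 *\<^sub>R t *\<^sub>R v)))) (at s)"
          unfolding \<phi>_def has_field_derivative_def
          by (rule has_derivative_eq_rhs[OF has_derivative_diff[OF der[OF s, of 1] der[OF s, of 0]]])
             (auto simp: fun_eq_iff algebra_simps)
      qed simp
      then obtain z where z: "0 < z" "z < 1"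
        and eq: "\<phi> 1 - \<phi> 0 = t * (g' (x + (z *\<^sub>R t *\<^sub>R u + 1 *\<^sub>R t *\<^sub>R v)) - g' (x + (z *\<^sub>R t *\<^sub>R u + 0 *\<^sub>R t *\<^sub>R v)))"
        by (auto simp: right_diff_distrib)
      define a where "a = z *\<^sub>R t *\<^sub>R u + 1 *\<^sub>R t *\<^sub>R v"
      define b where "b = z *\<^sub>R t *\<^sub>R u + 0 *\<^sub>R t *\<^sub>R v"
      have na: "norm a \<le> t * N" "norm b \<le> t * N"
        using nm[of z 1] nm[of z 0] z by (auto simp: a_def b_def)
      have ab: "G a - G b = t * G v"
      proof -
        have "a - b = t *\<^sub>R v" by (simp add: a_def b_def)
        then show ?thesis by (metis G linear_diff linear_cmul real_scaleR_def)
      qed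
      have "norm (g' (x + a) - g' x - G a) \<le> e' * (t * N)" "norm (g' (x + b) - g' x - G b) \<le> e' * (t * N)"
        using gd[of "x + a"] gd[of "x + b"] na tN e'
          order_trans[OF _ mult_left_mono[OF na(1), of e']] order_trans[OF _ mult_left_mono[OF na(2), of e']]
        by auto
      then have "\<bar>g' (x + a) - g' (x + b) - t * G v\<bar> \<le> 2 * (e' * (t * N))"
        unfolding ab[symmetric] by (simp add: abs_le_iff)
      also have "\<dots> = t * (e / 2)" using N by (simp add: e'_def)
      finally have *: "\<bar>g' (x + a) - g' (x + b) - t * G v\<bar> \<le> t * (e / 2)" .
      have "f (x + t *\<^sub>R u + t *\<^sub>R v) - f (x + t *\<^sub>R u) - f (x + t *\<^sub>R v) + f x = \<phi> 1 - \<phi> 0"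
        by (simp add: \<phi>_def add.assoc)
      also have "\<dots> = t * (g' (x + a) - g' (x + b))" by (simp add: eq a_def b_def)
      finally have "(f (x + t *\<^sub>R u + t *\<^sub>R v) - f (x + t *\<^sub>R u) - f (x + t *\<^sub>R v) + f x) / t\<^sup>2 - G v
          = (g' (x + a) - g' (x + b) - t * G v) / t"
        using t by (simp add: diff_divide_distrib power2_eq_square)
      then have "dist ((f (x + t *\<^sub>R u + t *\<^sub>R v) - f (x + t *\<^sub>R u) - f (x + t *\<^sub>R v) + f x) / t\<^sup>2) (G v)
         = \<bar>g' (x + a) - g' (x + b) - t * G v\<bar> / t"
        using t by (simp add: dist_real_def abs_divide)
      also have "\<dots> \<le> e / 2" using * t by (simp add: field_simps)
      also have "\<dots> < e" using e by simp
      finally show ?thesis .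
    qed
    then show "\<forall>\<^sub>F t in at_right 0.
        dist ((f (x + t *\<^sub>R u + t *\<^sub>R v) - f (x + t *\<^sub>R u) - f (x + t *\<^sub>R v) + f x) / t\<^sup>2) (G v) < e"
      unfolding eventually_at_right_field using t0 by blast
  qed
qed

text \<open>
  The second difference is symmetric in \<open>u\<close> and \<open>v\<close>, and therefore
  so is its limit. Vector values are treated componentwise.
\<close>

lemma second_derivative_symmetric:
  fixes f :: "'a::real_normed_vector \<Rightarrow> 'b::euclidean_space"
  assumes S: "open S" "x \<in> S" and f: "\<And>y. y \<in> S \<Longrightarrow> f differentiable (at y)"
    and g: "\<And>v. (\<lambda>y. frechet_derivative f (at y) v) differentiable (at x)"
  shows "frechet_derivative (\<lambda>y. frechet_derivative f (at y) u) (at x) v =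
         frechet_derivative (\<lambda>y. frechet_derivative f (at y) v) (at x) u"
proof (rule euclidean_eqI)
  fix b :: 'b assume "b \<in> Basis"
  define fb where "fb y = f y \<bullet> b" for y
  have fbd: "(fb has_derivative (\<lambda>h. frechet_derivative f (at y) h \<bullet> b)) (at y)" if "y \<in> S" for y
    unfolding fb_def using f[OF that] unfolding frechet_derivative_works
    by (auto intro!: derivative_eq_intros)
  have fb: "fb differentiable (at y)" if "y \<in> S" for y
    using fbd[OF that] by (auto simp: differentiable_def)
  have gb: "((\<lambda>y. frechet_derivative fb (at y) w) has_derivative
       (\<lambda>h. frechet_derivative (\<lambda>y. frechet_derivative f (at y) w) (at x) h \<bullet> b)) (at x)" for w
  proof (rule has_derivative_transform_within_open[OF _ S])
    show "((\<lambda>y. frechet_derivative f (at y) w \<bullet> b) has_derivative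
       (\<lambda>h. frechet_derivative (\<lambda>y. frechet_derivative f (at y) w) (at x) h \<bullet> b)) (at x)"
      using g[of w] unfolding frechet_derivative_works by (auto intro!: derivative_eq_intros)
  qed (use frechet_derivative_at[OF fbd] in \<open>simp add: fun_eq_iff\<close>)
  have "((\<lambda>t. (fb (x + t *\<^sub>R u + t *\<^sub>R v) - fb (x + t *\<^sub>R u) - fb (x + t *\<^sub>R v) + fb x) / t\<^sup>2)
      \<longlongrightarrow> frechet_derivative (\<lambda>y. frechet_derivative f (at y) v) (at x) u \<bullet> b) (at_right 0)"
    using second_difference_tendsto[OF S fb gb, of v u] by (simp add: algebra_simps)
  with second_difference_tendsto[OF S fb gb, of u v]
  show "frechet_derivative (\<lambda>y. frechet_derivative f (at y) u) (at x) v \<bullet> b =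
        frechet_derivative (\<lambda>y. frechet_derivative f (at y) v) (at x) u \<bullet> b"
    by (intro tendsto_unique[OF trivial_limit_at_right_real])
qed

lemma differentiable_transform_open:
  assumes "f differentiable (at y)" "open S" "y \<in> S" "\<And>z. z \<in> S \<Longrightarrow> f z = g z"
  shows "g differentiable (at y)"
  unfolding differentiable_def
  by (rule exI, rule has_derivative_transform_within_open[OF assms(1)[unfolded frechet_derivative_works] assms(2-4)])

text \<open>
  The product rule for a contraction: by linearity, \<open>w z (X z)\<close> is a finite sum
  of products over a basis, so that differentiability of \<open>w\<close> for each fixed
  argument is enough.
\<close>

lemma has_derivative_pairing:
  fixes w :: "'a::real_normed_vector \<Rightarrow> 'b::euclidean_space \<Rightarrow> 'c::real_normed_vector"
  assumes S: "open S" "y \<in> S" and lin: "\<And>z. z \<in> S \<Longrightarrow> linear (w z)"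
    and w: "\<And>v. (\<lambda>z. w z v) differentiable (at y)" and X: "(X has_derivative X') (at y)"
  shows "((\<lambda>z. w z (X z)) has_derivative
          (\<lambda>h. frechet_derivative (\<lambda>z. w z (X y)) (at y) h + w y (X' h))) (at y)"
proof -
  have expand: "w z v = (\<Sum>i\<in>Basis. (v \<bullet> i) *\<^sub>R w z i)" if "z \<in> S" for z v
    using linear_sum[OF lin[OF that], of "\<lambda>i. (v \<bullet> i) *\<^sub>R i" Basis] linear_cmul[OF lin[OF that]]
    by (simp add: euclidean_representation)
  have wi: "((\<lambda>z. w z i) has_derivative frechet_derivative (\<lambda>z. w z i) (at y)) (at y)" for i
    using w frechet_derivative_works by blast
  have *: "((\<lambda>z. w z (Y z)) has_derivative
     (\<lambda>h. (\<Sum>i\<in>Basis. (Y y \<bullet> i) *\<^sub>R frechet_derivative (\<lambda>z. w z i) (at y) h) + w y (Y' h))) (at y)"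
    if Y: "(Y has_derivative Y') (at y)" for Y Y'
  proof (rule has_derivative_transform_within_open[OF _ S])
    show "((\<lambda>z. \<Sum>i\<in>Basis. (Y z \<bullet> i) *\<^sub>R w z i) has_derivative
     (\<lambda>h. (\<Sum>i\<in>Basis. (Y y \<bullet> i) *\<^sub>R frechet_derivative (\<lambda>z. w z i) (at y) h) + w y (Y' h))) (at y)"
      unfolding expand[OF S(2), of "Y' _"] sum.distrib[symmetric]
      by (intro has_derivative_sum has_derivative_scaleR wi has_derivative_inner_left Y)
  qed (rule expand[symmetric])
  have "frechet_derivative (\<lambda>z. w z (X y)) (at y) h =
      (\<Sum>i\<in>Basis. (X y \<bullet> i) *\<^sub>R frechet_derivative (\<lambda>z. w z i) (at y) h)" for h
    using frechet_derivative_at[OF *[of "\<lambda>_. X y" "\<lambda>_. 0"]] linear_0[OF lin[OF S(2)]]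
    by (auto simp: fun_eq_iff)
  with *[OF X] show ?thesis by simp
qed

corollary differentiable_pairing:
  fixes w :: "'a::real_normed_vector \<Rightarrow> 'b::euclidean_space \<Rightarrow> 'c::real_normed_vector"
  assumes "open S" "y \<in> S" "\<And>z. z \<in> S \<Longrightarrow> linear (w z)"
    and "\<And>v. (\<lambda>z. w z v) differentiable (at y)" "X differentiable (at y)"
  shows "(\<lambda>z. w z (X z)) differentiable (at y)"
  using has_derivative_pairing[OF assms(1-4)] assms(5) unfolding differentiable_def by blast

text \<open>
  The exterior derivative of a 1-form on a vector space, so that \<open>ext_deriv\<close> is
  this operator applied to the components in the preferred chart.
\<close>

definition dform :: "('a::real_normed_vector \<Rightarrow> 'a \<Rightarrow> real) \<Rightarrow> 'a \<Rightarrow> 'a \<Rightarrow> 'a \<Rightarrow> real" where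
  "dform w y u v = frechet_derivative (\<lambda>x. w x v) (at y) u - frechet_derivative (\<lambda>x. w x u) (at y) v"

lemma dform_skew: "dform w y u v = - dform w y v u"
  by (simp add: dform_def)

lemma linear_dform_left:
  assumes S: "open S" "y \<in> S" and lin: "\<And>z. z \<in> S \<Longrightarrow> linear (w z)"
    and w: "\<And>v. (\<lambda>z. w z v) differentiable (at y)"
  shows "linear (\<lambda>u. dform w y u v)"
proof -
  have wi: "((\<lambda>z. w z i) has_derivative frechet_derivative (\<lambda>z. w z i) (at y)) (at y)" for i
    using w frechet_derivative_works by blast
  have l1: "linear (frechet_derivative (\<lambda>x. w x v) (at y))"
    using w linear_frechet_derivative by blast
  have add: "frechet_derivative (\<lambda>x. w x (a + b)) (at y) v =
      frechet_derivative (\<lambda>x. w x a) (at y) v + frechet_derivative (\<lambda>x. w x b) (at y) v" for a b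
  proof -
    have "((\<lambda>x. w x (a + b)) has_derivative (\<lambda>h. frechet_derivative (\<lambda>x. w x a) (at y) h +
             frechet_derivative (\<lambda>x. w x b) (at y) h)) (at y)"
      by (rule has_derivative_transform_within_open[OF has_derivative_add[OF wi wi] S])
         (simp add: lin linear_add)
    from frechet_derivative_at[OF this] show ?thesis by (metis)
  qed
  have scl: "frechet_derivative (\<lambda>x. w x (c *\<^sub>R a)) (at y) v =
      c * frechet_derivative (\<lambda>x. w x a) (at y) v" for a c
  proof -
    have "((\<lambda>x. w x (c *\<^sub>R a)) has_derivative (\<lambda>h. c * frechet_derivative (\<lambda>x. w x a) (at y) h)) (at y)"
      by (rule has_derivative_transform_within_open[OF has_derivative_mult_right[OF wi] S])
         (simp add: lin linear_cmul)
    from frechet_derivative_at[OF this] show ?thesis by (metis)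
  qed
  show ?thesis
    by (rule linearI) (simp_all add: dform_def add scl linear_add[OF l1] linear_cmul[OF l1] algebra_simps)
qed

lemma linear_dform_right:
  assumes "open S" "y \<in> S" "\<And>z. z \<in> S \<Longrightarrow> linear (w z)"
    and "\<And>v. (\<lambda>z. w z v) differentiable (at y)"
  shows "linear (dform w y u)"
proof -
  have "linear (\<lambda>v. - dform w y v u)"
    using linear_dform_left[OF assms, of u] by (rule linear_compose_neg)
  then show ?thesis by (subst (asm) dform_skew) simp
qed

text \<open>
  Cartan's formula for \<open>dw(X, Y)\<close>, in which the terms \<open>X(w(Y))\<close> and
  \<open>Y(w(X))\<close> drop out because the pairings are constant.
\<close>

lemma dform_frame_fields:
  fixes w :: "'a::euclidean_space \<Rightarrow> 'a \<Rightarrow> real"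
  assumes S: "open S" "y \<in> S" and lin: "\<And>z. z \<in> S \<Longrightarrow> linear (w z)"
    and w: "\<And>v. (\<lambda>z. w z v) differentiable (at y)"
    and X: "X differentiable (at y)" and Y: "Y differentiable (at y)"
    and cX: "\<And>z. z \<in> S \<Longrightarrow> w z (X z) = a" and cY: "\<And>z. z \<in> S \<Longrightarrow> w z (Y z) = b"
  shows "dform w y (X y) (Y y) =
    - w y (frechet_derivative Y (at y) (X y) - frechet_derivative X (at y) (Y y))"
proof -
  have *: "frechet_derivative (\<lambda>z. w z (Z y)) (at y) h = - w y (frechet_derivative Z (at y) h)"
    if "Z differentiable (at y)" "\<And>z. z \<in> S \<Longrightarrow> w z (Z z) = c" for Z c h
  proof -
    have "((\<lambda>z. w z (Z z)) has_derivative (\<lambda>h. 0)) (at y)"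
      by (rule has_derivative_transform_within_open[OF has_derivative_const[of c] S]) (simp add: that)
    from has_derivative_unique[OF this has_derivative_pairing[OF S lin w that(1)[unfolded frechet_derivative_works]]]
    show ?thesis by (simp add: fun_eq_iff) (metis add.commute add_eq_0_iff)
  qed
  show ?thesis
    using *[OF X cX] *[OF Y cY] linear_diff[OF lin[OF S(2)]] by (simp add: dform_def)
qed

text \<open>
  Differentiating \<open>w (\<phi> z) (D\<phi>(z) v)\<close> produces one term with the second
  derivative of \<open>\<phi>\<close>, which is symmetric and cancels in the alternation. This
  is the source of the chart independence of the exterior derivative.
\<close>

lemma dform_pullback:
  fixes w :: "'a::euclidean_space \<Rightarrow> 'a \<Rightarrow> real"
  assumes S: "open S" "y \<in> S" and \<phi>: "\<And>z. z \<in> S \<Longrightarrow> \<phi> differentiable (at z)"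
    and D\<phi>: "\<And>v. (\<lambda>z. frechet_derivative \<phi> (at z) v) differentiable (at y)"
    and T: "open T" "\<phi> y \<in> T" and lin: "\<And>z. z \<in> T \<Longrightarrow> linear (w z)"
    and w: "\<And>v. (\<lambda>z. w z v) differentiable (at (\<phi> y))"
    and w0: "\<And>z v. z \<in> S \<Longrightarrow> w0 z v = w (\<phi> z) (frechet_derivative \<phi> (at z) v)"
  shows "dform w0 y u v = dform w (\<phi> y) (frechet_derivative \<phi> (at y) u) (frechet_derivative \<phi> (at y) v)"
proof -
  define J where "J z = frechet_derivative \<phi> (at z)" for z
  have \<phi>y: "(\<phi> has_derivative J y) (at y)" using \<phi>[OF S(2)] by (simp add: J_def frechet_derivative_works)
  have "\<exists>R. open R \<and> y \<in> R \<and> (\<forall>z\<in>R. \<phi> z \<in> T)"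
    using has_derivative_continuous[OF \<phi>y] T unfolding continuous_at_open by simp
  then obtain R where R: "open R" "y \<in> R" "\<And>z. z \<in> R \<Longrightarrow> \<phi> z \<in> T"
    by auto
  have *: "frechet_derivative (\<lambda>z. w0 z v) (at y) u =
      frechet_derivative (\<lambda>z. w z (J y v)) (at (\<phi> y)) (J y u)
      + w (\<phi> y) (frechet_derivative (\<lambda>z. J z v) (at y) u)" for u v
  proof -
    have wp: "((\<lambda>z. w (\<phi> z) v) has_derivative (\<lambda>h. frechet_derivative (\<lambda>z. w z v) (at (\<phi> y)) (J y h))) (at y)"
      for v by (rule has_derivative_compose[OF \<phi>y w[of v, unfolded frechet_derivative_works]])
    have wd: "(\<lambda>z. w (\<phi> z) v) differentiable (at y)" for v
      using wp by (auto simp: differentiable_def)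
    have "((\<lambda>z. w (\<phi> z) (J z v)) has_derivative
       (\<lambda>h. frechet_derivative (\<lambda>z. w (\<phi> z) (J y v)) (at y) h + w (\<phi> y) (frechet_derivative (\<lambda>z. J z v) (at y) h)))
       (at y)"
    proof (rule has_derivative_pairing[OF R(1,2)])
      show "linear (w (\<phi> z))" if "z \<in> R" for z using lin R(3)[OF that] by blast
      show "((\<lambda>z. J z v) has_derivative frechet_derivative (\<lambda>z. J z v) (at y)) (at y)"
        using D\<phi>[of v] unfolding J_def frechet_derivative_works .
    qed (rule wd)
    then have "((\<lambda>z. w0 z v) has_derivative
       (\<lambda>h. frechet_derivative (\<lambda>z. w (\<phi> z) (J y v)) (at y) h + w (\<phi> y) (frechet_derivative (\<lambda>z. J z v) (at y) h)))
       (at y)"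
      by (rule has_derivative_transform_within_open[OF _ S]) (simp add: w0 J_def)
    from fun_cong[OF frechet_derivative_at[OF this], of u]
    show ?thesis by (simp flip: frechet_derivative_at[OF wp])
  qed
  have "frechet_derivative (\<lambda>z. J z v) (at y) u = frechet_derivative (\<lambda>z. J z u) (at y) v"
    unfolding J_def using second_derivative_symmetric[OF S \<phi> D\<phi>] .
  then show ?thesis by (simp add: dform_def *) (simp add: J_def)
qed

lemma dform_scale:
  fixes w w' :: "'a::euclidean_space \<Rightarrow> 'a \<Rightarrow> real"
  assumes S: "open S" "y \<in> S" and w: "\<And>v. (\<lambda>z. w z v) differentiable (at y)"
    and f: "(f has_derivative f') (at y)" and w': "\<And>z v. z \<in> S \<Longrightarrow> w' z v = f z * w z v"
  shows "dform w' y u v = f' u * w y v - f' v * w y u + f y * dform w y u v"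
proof -
  have *: "frechet_derivative (\<lambda>z. w' z v) (at y) u = f y * frechet_derivative (\<lambda>z. w z v) (at y) u + f' u * w y v"
    for u v
  proof -
    have "((\<lambda>z. w' z v) has_derivative (\<lambda>h. f y * frechet_derivative (\<lambda>z. w z v) (at y) h + f' h * w y v)) (at y)"
      by (rule has_derivative_transform_within_open[OF has_derivative_mult[OF f w[of v, unfolded frechet_derivative_works]] S])
         (simp add: w')
    from fun_cong[OF frechet_derivative_at[OF this], of u] show ?thesis by simp
  qed
  show ?thesis by (simp add: dform_def * algebra_simps)
qed

text \<open>
  The bracket of a rotated frame differs from the bracket of the frame by first derivatives of
  the angle. Where the rotation is \<open>\<plusminus>1\<close> and stationary, the two
  brackets are equal: the sign enters twice.
\<close>

lemma rotated_frame_bracket: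
  fixes X Y :: "'a::real_normed_vector \<Rightarrow> 'a"
  assumes S: "open S" "y \<in> S" and X: "X differentiable (at y)" and Y: "Y differentiable (at y)"
    and a: "(a has_derivative (\<lambda>v. 0)) (at y)" and b: "(b has_derivative (\<lambda>v. 0)) (at y)"
    and X': "\<And>z. z \<in> S \<Longrightarrow> X' z = a z *\<^sub>R X z + b z *\<^sub>R Y z"
    and Y': "\<And>z. z \<in> S \<Longrightarrow> Y' z = - b z *\<^sub>R X z + a z *\<^sub>R Y z"
    and at: "b y = 0" "(a y)\<^sup>2 = 1"
  shows "frechet_derivative Y' (at y) (X' y) - frechet_derivative X' (at y) (Y' y) =
    frechet_derivative Y (at y) (X y) - frechet_derivative X (at y) (Y y)"
proof -
  note dX = X[unfolded frechet_derivative_works] and dY = Y[unfolded frechet_derivative_works]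
  have "((\<lambda>z. a z *\<^sub>R X z + b z *\<^sub>R Y z) has_derivative (\<lambda>h. a y *\<^sub>R frechet_derivative X (at y) h)) (at y)"
    by (rule has_derivative_eq_rhs[OF has_derivative_add[OF has_derivative_scaleR[OF a dX] has_derivative_scaleR[OF b dY]]])
       (simp add: at)
  then have "(X' has_derivative (\<lambda>h. a y *\<^sub>R frechet_derivative X (at y) h)) (at y)"
    by (rule has_derivative_transform_within_open[OF _ S]) (simp add: X')
  from fun_cong[OF frechet_derivative_at[OF this]]
  have 1: "frechet_derivative X' (at y) h = a y *\<^sub>R frechet_derivative X (at y) h" for h by simp
  have "((\<lambda>z. - b z *\<^sub>R X z + a z *\<^sub>R Y z) has_derivative (\<lambda>h. a y *\<^sub>R frechet_derivative Y (at y) h)) (at y)"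
    by (rule has_derivative_eq_rhs[OF has_derivative_add[OF has_derivative_scaleR[OF has_derivative_minus[OF b] dX]
          has_derivative_scaleR[OF a dY]]]) (simp add: at)
  then have "(Y' has_derivative (\<lambda>h. a y *\<^sub>R frechet_derivative Y (at y) h)) (at y)"
    by (rule has_derivative_transform_within_open[OF _ S]) (simp add: Y')
  from fun_cong[OF frechet_derivative_at[OF this]]
  have 2: "frechet_derivative Y' (at y) h = a y *\<^sub>R frechet_derivative Y (at y) h" for h by simp
  have XY: "X' y = a y *\<^sub>R X y" "Y' y = a y *\<^sub>R Y y" using X'[OF S(2)] Y'[OF S(2)] at by simp_all
  have "a y * a y = 1" using at by (simp add: power2_eq_square)
  then show ?thesis
    unfolding 1 2 XY linear_cmul[OF linear_frechet_derivative[OF X]] linear_cmul[OF linear_frechet_derivative[OF Y]]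
    by simp
qed

text \<open>
  Cramer's rule, in the form that exhibits a dual coframe as a differentiable function of the
  frame.
\<close>

lemma dual_basis_cross3:
  fixes X Y Z :: "real^3" and \<alpha> \<beta> \<gamma> :: "real^3 \<Rightarrow> real"
  assumes "linear \<alpha>" "linear \<beta>" "linear \<gamma>"
    and "\<alpha> X = 1" "\<alpha> Y = 0" "\<alpha> Z = 0" "\<beta> X = 0" "\<beta> Y = 1" "\<beta> Z = 0" "\<gamma> X = 0" "\<gamma> Y = 0" "\<gamma> Z = (1::real)"
  shows "cross3 Y Z \<bullet> X \<noteq> 0" "\<alpha> v = (cross3 Y Z \<bullet> v) / (cross3 Y Z \<bullet> X)"
proof -
  have id: "(cross3 Y Z \<bullet> X) *\<^sub>R v =
     (cross3 Y Z \<bullet> v) *\<^sub>R X + (cross3 Z X \<bullet> v) *\<^sub>R Y + (cross3 X Y \<bullet> v) *\<^sub>R Z" for v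
    by (simp add: cross3_simps forall_3)
  have al: "(cross3 Y Z \<bullet> X) * \<alpha> v = cross3 Y Z \<bullet> v" for v
    using arg_cong[OF id[of v], of \<alpha>] assms by (simp add: linear_add linear_cmul)
  show "cross3 Y Z \<bullet> X \<noteq> 0"
  proof
    assume "cross3 Y Z \<bullet> X = 0"
    with al have "cross3 Y Z = 0" by (metis inner_eq_zero_iff mult_zero_left)
    then have "collinear {0, Y, Z}" by (simp add: cross_eq_0)
    then consider "Y = 0" | "Z = 0" | c where "Z = c *\<^sub>R Y" unfolding collinear_lemma by blast
    then show False
    proof cases
      case 1 then show False using assms(8) linear_0[OF assms(2)] by simp
    next
      case 2 then show False using assms(12) linear_0[OF assms(3)] by simp
    next
      case 3 then show False using assms(3,11,12) by (simp add: linear_cmul)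
    qed
  qed
  then show "\<alpha> v = (cross3 Y Z \<bullet> v) / (cross3 Y Z \<bullet> X)"
    using al[of v] by (simp add: field_simps)
qed

lemma differentiable_dual_coframe:
  fixes X Y Z :: "'a::real_normed_vector \<Rightarrow> real^3" and \<alpha> \<beta> \<gamma> :: "'a \<Rightarrow> real^3 \<Rightarrow> real"
  assumes S: "open S" "y \<in> S"
    and d: "X differentiable (at y)" "Y differentiable (at y)" "Z differentiable (at y)"
    and dual: "\<And>z. z \<in> S \<Longrightarrow> linear (\<alpha> z)" "\<And>z. z \<in> S \<Longrightarrow> linear (\<beta> z)" "\<And>z. z \<in> S \<Longrightarrow> linear (\<gamma> z)"
    "\<And>z. z \<in> S \<Longrightarrow> \<alpha> z (X z) = 1 \<and> \<alpha> z (Y z) = 0 \<and> \<alpha> z (Z z) = 0 \<and>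
       \<beta> z (X z) = 0 \<and> \<beta> z (Y z) = 1 \<and> \<beta> z (Z z) = 0 \<and> \<gamma> z (X z) = 0 \<and> \<gamma> z (Y z) = 0 \<and> \<gamma> z (Z z) = (1::real)"
  shows "(\<lambda>z. \<alpha> z v) differentiable (at y)"
proof -
  have bl: "bounded_bilinear cross3" using bilinear_conv_bounded_bilinear bilinear_cross by blast
  have c: "(\<lambda>z. cross3 (Y z) (Z z)) differentiable (at y)"
    using bounded_bilinear.FDERIV[OF bl d(2,3)[unfolded frechet_derivative_works]]
    unfolding differentiable_def by blast
  have "(\<lambda>z. (cross3 (Y z) (Z z) \<bullet> v) / (cross3 (Y z) (Z z) \<bullet> X z)) differentiable (at y)"
    using S dual by (intro differentiable_divide differentiable_inner c d(1) differentiable_const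
         dual_basis_cross3(1)[of "\<alpha> y" "\<beta> y" "\<gamma> y"]) auto
  then obtain D where D: "((\<lambda>z. (cross3 (Y z) (Z z) \<bullet> v) / (cross3 (Y z) (Z z) \<bullet> X z)) has_derivative D) (at y)"
    unfolding differentiable_def by blast
  have *: "(cross3 (Y z) (Z z) \<bullet> v) / (cross3 (Y z) (Z z) \<bullet> X z) = \<alpha> z v" if "z \<in> S" for z
    using dual_basis_cross3(2)[OF dual(1-3)[OF that], of "X z" "Y z" "Z z" v] dual(4)[OF that] by simp
  have "((\<lambda>z. \<alpha> z v) has_derivative D) (at y)"
    by (rule has_derivative_transform_within_open[OF D S *])
  then show ?thesis unfolding differentiable_def by blast
qed

text \<open>
  A bound on \<open>h' / h\<close> makes \<open>ln h\<^sup>2\<close> Lipschitz on \<open>(0,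
  e)\<close>, hence bounded below near \<open>0\<close>, and so keeps \<open>h\<close> away
  from \<open>0\<close>.
\<close>

lemma log_derivative_unbounded:
  fixes h :: "real \<Rightarrow> real"
  assumes e: "0 < e" and cont: "(h \<longlongrightarrow> 0) (at_right 0)"
    and h: "\<And>t. 0 < t \<Longrightarrow> t < e \<Longrightarrow> h t \<noteq> 0"
    and h': "\<And>t. 0 < t \<Longrightarrow> t < e \<Longrightarrow> (h has_field_derivative h' t) (at t)"
    and bd: "\<And>t. 0 < t \<Longrightarrow> t < e \<Longrightarrow> \<bar>h' t\<bar> \<le> B * \<bar>h t\<bar>"
  shows False
proof -
  have B: "B \<ge> 0"
  proof -
    have "0 \<le> B * \<bar>h (e/2)\<bar>" "0 < \<bar>h (e/2)\<bar>"
      using order_trans[OF abs_ge_zero bd[of "e/2"]] h[of "e/2"] e by auto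
    then show ?thesis by (simp add: zero_le_mult_iff)
  qed
  define L where "L t = ln ((h t)\<^sup>2)" for t
  have L': "(L has_field_derivative (2 * h' t / h t)) (at t)" if "0 < t" "t < e" for t
    unfolding L_def using h[OF that]
    by (auto intro!: derivative_eq_intros h'[OF that] simp: field_simps power2_eq_square zero_less_mult_iff)
  have bL: "\<bar>2 * h' t / h t\<bar> \<le> 2 * B" if "0 < t" "t < e" for t
    using bd[OF that] h[OF that] by (simp add: abs_divide field_simps)
  have lower: "L (e/2) - B * e \<le> L t" if "0 < t" "t < e/2" for t
  proof -
    have "\<exists>z. t < z \<and> z < e/2 \<and> L (e/2) - L t = (e/2 - t) * (2 * h' z / h z)"
      by (rule MVT2) (use that L' in auto)
    then obtain z where z: "t < z" "z < e/2" "L (e/2) - L t = (e/2 - t) * (2 * h' z / h z)" by blast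
    have "(e/2 - t) * (2 * h' z / h z) \<le> (e/2) * (2 * B)"
    proof -
      have "(e/2 - t) * (2 * h' z / h z) \<le> (e/2 - t) * (2 * B)"
        using abs_le_D1[OF bL[of z]] z(1,2) that e by (intro mult_left_mono) auto
      also have "\<dots> \<le> (e/2) * (2 * B)"
        using that B by (intro mult_right_mono) auto
      finally show ?thesis .
    qed
    then show ?thesis using z(3) by (simp add: field_simps)
  qed
  have "((\<lambda>t. (h t)\<^sup>2) \<longlongrightarrow> 0) (at_right 0)" using tendsto_power[OF cont, of 2] by simp
  then have "\<forall>\<^sub>F t in at_right 0. (h t)\<^sup>2 < exp (L (e/2) - B * e - 1)"
    by (rule order_tendstoD) simp
  moreover have "\<forall>\<^sub>F t in at_right 0. t \<in> {0<..<e/2}"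
    using eventually_at_right_real[of 0 "e/2"] e by simp
  ultimately have "\<forall>\<^sub>F t in at_right (0::real). False"
  proof eventually_elim
    case (elim t)
    have "(h t)\<^sup>2 > 0" using h[of t] elim e by simp
    then have "L t < L (e/2) - B * e - 1"
      using elim(1) unfolding L_def by (subst exp_less_cancel_iff[symmetric]) simp
    then show False using lower[of t] elim by simp
  qed
  then show False by (simp add: trivial_limit_at_right_real)
qed

text \<open>
  If \<open>s' \<noteq> 0\<close>, then \<open>\<bar>s t\<bar>\<close> is at least of order
  \<open>t\<close> while the right-hand side of the equation is at most of order \<open>t
  \<bar>h t\<bar>\<close>. The factor \<open>F h' + h k\<close> is then bounded by a multiple
  of \<open>\<bar>h\<bar>\<close>, and so is \<open>h'\<close>, which is impossible for a
  function \<open>h\<close> tending to \<open>0\<close>.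
\<close>

lemma quotient_derivative_zero:
  fixes s h h' F k r a :: "real \<Rightarrow> real"
  assumes s: "(s has_real_derivative s') (at 0)" "s 0 = 0"
    and r: "(r has_real_derivative r') (at 0)" "r 0 = 0"
    and h0: "(h \<longlongrightarrow> 0) (at_right 0)" and F: "(F \<longlongrightarrow> F0) (at_right 0)" "F0 \<noteq> 0" and k: "(k \<longlongrightarrow> k0) (at_right 0)"
    and e: "0 < e" and h: "\<And>t. 0 < t \<Longrightarrow> t < e \<Longrightarrow> h t \<noteq> 0"
    and h': "\<And>t. 0 < t \<Longrightarrow> t < e \<Longrightarrow> (h has_real_derivative h' t) (at t)"
    and a: "\<And>t. 0 < t \<Longrightarrow> t < e \<Longrightarrow> \<bar>a t\<bar> \<le> 1"
    and eq: "\<And>t. 0 < t \<Longrightarrow> t < e \<Longrightarrow> s t * (F t * h' t + h t * k t) = - (a t * h t * r t)"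
  shows "s' = 0"
proof (rule ccontr)
  assume ne: "s' \<noteq> 0"
  have st: "((\<lambda>t. \<bar>s t / t\<bar>) \<longlongrightarrow> \<bar>s'\<bar>) (at_right 0)"
    using s unfolding has_field_derivative_iff
    by (intro tendsto_rabs) (auto intro: tendsto_mono[OF at_le])
  have rt: "((\<lambda>t. \<bar>r t / t\<bar>) \<longlongrightarrow> \<bar>r'\<bar>) (at_right 0)"
    using r unfolding has_field_derivative_iff
    by (intro tendsto_rabs) (auto intro: tendsto_mono[OF at_le])
  have "\<forall>\<^sub>F t in at_right 0. \<bar>s'\<bar> / 2 < \<bar>s t / t\<bar>"
    by (rule order_tendstoD(1)[OF st]) (use ne in simp)
  moreover have "\<forall>\<^sub>F t in at_right 0. \<bar>r t / t\<bar> < \<bar>r'\<bar> + 1"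
    by (rule order_tendstoD(2)[OF rt]) simp
  moreover have "\<forall>\<^sub>F t in at_right 0. \<bar>F0\<bar> / 2 < \<bar>F t\<bar>"
    by (rule order_tendstoD(1)[OF tendsto_rabs[OF F(1)]]) (use F(2) in simp)
  moreover have "\<forall>\<^sub>F t in at_right 0. \<bar>k t\<bar> < \<bar>k0\<bar> + 1"
    by (rule order_tendstoD(2)[OF tendsto_rabs[OF k]]) simp
  moreover have "\<forall>\<^sub>F t in at_right 0. t \<in> {0<..<e}"
    using eventually_at_right_real e by blast
  ultimately have "\<forall>\<^sub>F t in at_right 0. t \<in> {0<..<e} \<and> \<bar>s'\<bar> / 2 < \<bar>s t / t\<bar> \<and> \<bar>r t / t\<bar> < \<bar>r'\<bar> + 1 \<and>
      \<bar>F0\<bar> / 2 < \<bar>F t\<bar> \<and> \<bar>k t\<bar> < \<bar>k0\<bar> + 1"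
    by eventually_elim simp
  then obtain d where d: "0 < d" and ev: "\<And>t. 0 < t \<Longrightarrow> t < d \<Longrightarrow> t \<in> {0<..<e} \<and> \<bar>s'\<bar> / 2 < \<bar>s t / t\<bar> \<and>
      \<bar>r t / t\<bar> < \<bar>r'\<bar> + 1 \<and> \<bar>F0\<bar> / 2 < \<bar>F t\<bar> \<and> \<bar>k t\<bar> < \<bar>k0\<bar> + 1"
    unfolding eventually_at_right_field by auto
  define B where "B = (2 * (\<bar>r'\<bar> + 1) / \<bar>s'\<bar> + (\<bar>k0\<bar> + 1)) * (2 / \<bar>F0\<bar>)"
  show False
  proof (rule log_derivative_unbounded[OF d h0])
    fix t assume t: "0 < t" "t < d"
    then have te: "0 < t" "t < e" using ev[OF t] by auto
    show "h t \<noteq> 0" by (rule h[OF te])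
    show "(h has_real_derivative h' t) (at t)" by (rule h'[OF te])
    have bs: "\<bar>s'\<bar> / 2 * t \<le> \<bar>s t\<bar>" and br: "\<bar>r t\<bar> \<le> (\<bar>r'\<bar> + 1) * t" and bF: "\<bar>F0\<bar> / 2 \<le> \<bar>F t\<bar>" and bk: "\<bar>k t\<bar> \<le> \<bar>k0\<bar> + 1"
      using ev[OF t] te by (auto simp: abs_divide field_simps)
    define P where "P = F t * h' t + h t * k t"
    have "(\<bar>s'\<bar> / 2 * t) * \<bar>P\<bar> \<le> \<bar>s t\<bar> * \<bar>P\<bar>" using bs by (intro mult_right_mono) auto
    also have "\<dots> = \<bar>a t\<bar> * \<bar>h t\<bar> * \<bar>r t\<bar>"
      using eq[OF te] unfolding P_def by (metis abs_minus_cancel abs_mult)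
    also have "\<dots> \<le> 1 * \<bar>h t\<bar> * ((\<bar>r'\<bar> + 1) * t)"
      using a[OF te] br by (intro mult_mono mult_right_mono) auto
    finally have "t * (\<bar>s'\<bar> / 2 * \<bar>P\<bar>) \<le> t * (\<bar>h t\<bar> * (\<bar>r'\<bar> + 1))" by (simp add: algebra_simps)
    then have "\<bar>s'\<bar> / 2 * \<bar>P\<bar> \<le> \<bar>h t\<bar> * (\<bar>r'\<bar> + 1)" by (rule mult_left_le_imp_le[OF _ te(1)])
    then have P1: "\<bar>P\<bar> \<le> 2 * (\<bar>r'\<bar> + 1) / \<bar>s'\<bar> * \<bar>h t\<bar>" using ne by (simp add: field_simps)
    have "\<bar>F0\<bar> / 2 * \<bar>h' t\<bar> \<le> \<bar>F t\<bar> * \<bar>h' t\<bar>" using bF by (intro mult_right_mono) auto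
    also have "\<dots> = \<bar>P - h t * k t\<bar>" by (simp add: P_def abs_mult)
    also have "\<dots> \<le> \<bar>P\<bar> + \<bar>h t\<bar> * \<bar>k t\<bar>" by (metis abs_mult abs_triangle_ineq4)
    also have "\<dots> \<le> 2 * (\<bar>r'\<bar> + 1) / \<bar>s'\<bar> * \<bar>h t\<bar> + \<bar>h t\<bar> * (\<bar>k0\<bar> + 1)"
      using P1 bk by (intro add_mono mult_left_mono) auto
    finally have *: "\<bar>F0\<bar> / 2 * \<bar>h' t\<bar> \<le> (2 * (\<bar>r'\<bar> + 1) / \<bar>s'\<bar> + (\<bar>k0\<bar> + 1)) * \<bar>h t\<bar>"
      by (simp add: algebra_simps)
    have "\<bar>h' t\<bar> = (2 / \<bar>F0\<bar>) * (\<bar>F0\<bar> / 2 * \<bar>h' t\<bar>)" using F(2) by simp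
    also have "\<dots> \<le> (2 / \<bar>F0\<bar>) * ((2 * (\<bar>r'\<bar> + 1) / \<bar>s'\<bar> + (\<bar>k0\<bar> + 1)) * \<bar>h t\<bar>)"
      using * by (intro mult_left_mono) auto
    finally show "\<bar>h' t\<bar> \<le> B * \<bar>h t\<bar>" by (simp only: B_def mult_ac)
  qed
qed

lemma derivative_along_line:
  fixes G :: "'a::real_normed_vector \<Rightarrow> real"
  assumes "(G has_derivative G') (at (x + t *\<^sub>R v))"
  shows "((\<lambda>t. G (x + t *\<^sub>R v)) has_real_derivative G' v) (at t)"
proof -
  have "((\<lambda>t. x + t *\<^sub>R v) has_derivative (\<lambda>h. h *\<^sub>R v)) (at t)"
    by (auto intro!: derivative_eq_intros)
  from has_derivative_compose[OF this assms] show ?thesis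
    using linear_cmul[OF has_derivative_linear[OF assms]]
    by (simp add: has_field_derivative_def mult_commute_abs)
qed

lemma derivative_zero_along_constant_line:
  fixes G :: "'a::real_normed_vector \<Rightarrow> real"
  assumes G: "(G has_derivative G') (at x)" and e: "e > 0" and c: "\<And>t. \<bar>t\<bar> < e \<Longrightarrow> G (x + t *\<^sub>R v) = G x"
  shows "G' v = 0"
proof -
  have "((\<lambda>t. G (x + t *\<^sub>R v)) has_real_derivative G' v) (at 0)"
    using derivative_along_line[of G G' x 0 v] G by simp
  moreover have "((\<lambda>t. G (x + t *\<^sub>R v)) has_real_derivative 0) (at 0)"
    by (rule has_field_derivative_transform_within_open[OF DERIV_const[of "G x"], of "{-e<..<e}"])
       (use e in \<open>auto simp: c abs_less_iff\<close>)
  ultimately show ?thesis by (rule DERIV_unique)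
qed


section \<open>Charts and changes of coordinates\<close>

lemma smooth_on_differentiable: "smooth_on f S \<Longrightarrow> x \<in> S \<Longrightarrow> f differentiable (at x)"
  unfolding smooth_on_def by (drule spec[of _ "Suc 0"]) simp

lemma smooth_on_frechet_derivative:
  "smooth_on f S \<Longrightarrow> smooth_on (\<lambda>x. frechet_derivative f (at x) v) S"
  unfolding smooth_on_def
proof
  fix k assume "\<forall>k. Ck_on k f S"
  then have "Ck_on (Suc k) f S" by blast
  then show "Ck_on k (\<lambda>x. frechet_derivative f (at x) v) S" by simp
qed

lemma smooth_on_subset: "smooth_on f S \<Longrightarrow> T \<subseteq> S \<Longrightarrow> smooth_on f T"
proof -
  have "Ck_on k f S \<Longrightarrow> T \<subseteq> S \<Longrightarrow> Ck_on k f T" for k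
    by (induction k arbitrary: f) (auto intro: continuous_on_subset)
  then show "smooth_on f S \<Longrightarrow> T \<subseteq> S \<Longrightarrow> smooth_on f T"
    by (auto simp: smooth_on_def)
qed

lemma chart_atlas:
  assumes "oriented_atlas A" "c \<in> A"
  shows "open (fst c)" "open (snd c ` fst c)" "homeomorphism (fst c) (snd c ` fst c) (snd c) (chart_inv c)"
  using assms unfolding oriented_atlas_def by blast+

lemma chart_inv_chart:
  assumes "oriented_atlas A" "c \<in> A" "p \<in> fst c"
  shows "chart_inv c (snd c p) = p"
  using chart_atlas(3)[OF assms(1,2)] assms(3) by (simp add: homeomorphism_def)

lemma open_chart_image:
  assumes "oriented_atlas A" "c \<in> A" "open U"
  shows "open (snd c ` (U \<inter> fst c))"
proof -
  note h = chart_atlas[OF assms(1,2)]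
  have "snd c ` (U \<inter> fst c) = (snd c ` fst c) \<inter> chart_inv c -` U"
    using chart_inv_chart[OF assms(1,2)] by (auto simp: image_iff)
  moreover have "continuous_on (snd c ` fst c) (chart_inv c)"
    using h(3) by (simp add: homeomorphism_def)
  ultimately show ?thesis
    using continuous_open_preimage[OF _ h(2) assms(3)] by metis
qed

text \<open>
  Coordinate lines through \<open>p\<close> stay in a given neighborhood of \<open>p\<close>
  for small parameters.
\<close>

lemma chart_image_ball:
  assumes "oriented_atlas A" "c \<in> A" "open N" "p \<in> N" "p \<in> fst c"
  obtains r where "r > 0" "\<And>x. norm (x - snd c p) < r \<Longrightarrow> \<exists>p'\<in>N \<inter> fst c. x = snd c p'"
proof -
  have "snd c p \<in> snd c ` (N \<inter> fst c)" using assms by blast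
  then obtain r where "r > 0" "ball (snd c p) r \<subseteq> snd c ` (N \<inter> fst c)"
    using open_chart_image[OF assms(1-3)] open_contains_ball by blast
  moreover have "x \<in> ball (snd c p) r" if "norm (x - snd c p) < r" for x
    using that by (simp add: dist_norm norm_minus_commute)
  ultimately show ?thesis using that by blast
qed

lemma transition_chart:
  assumes "oriented_atlas A" "c \<in> A" "p \<in> fst c"
  shows "transition c c' (snd c p) = snd c' p"
  by (simp add: transition_def chart_inv_chart[OF assms])

lemma transition_smooth:
  assumes "oriented_atlas A" "c \<in> A" "c' \<in> A"
  shows "smooth_on (transition c c') (snd c ` (fst c \<inter> fst c'))"
  using assms unfolding oriented_atlas_def by blast

lemma transition_has_derivative:
  assumes "oriented_atlas A" "c \<in> A" "c' \<in> A" "p \<in> fst c" "p \<in> fst c'"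
  shows "(transition c c' has_derivative frechet_derivative (transition c c') (at (snd c p))) (at (snd c p))"
  using smooth_on_differentiable[OF transition_smooth[OF assms(1-3)], of "snd c p"] assms(4,5)
  unfolding frechet_derivative_works by blast

lemma linear_transition:
  assumes "oriented_atlas A" "c \<in> A" "c' \<in> A" "p \<in> fst c" "p \<in> fst c'"
  shows "linear (frechet_derivative (transition c c') (at (snd c p)))"
  using transition_has_derivative[OF assms] has_derivative_linear by blast

text \<open>
  The chain rule for functions on the manifold. With \<open>F = snd c''\<close> it becomes the
  cocycle identity for the differentials of the transition maps.
\<close>

lemma has_derivative_change_chart:
  fixes F :: "'a::{t2_space,second_countable_topology} \<Rightarrow> 'b::real_normed_vector"
  assumes A: "oriented_atlas A" "c \<in> A" "c' \<in> A" "p \<in> fst c" "p \<in> fst c'"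
    and F: "((F \<circ> chart_inv c') has_derivative F') (at (snd c' p))"
  shows "((F \<circ> chart_inv c) has_derivative
      (\<lambda>v. F' (frechet_derivative (transition c c') (at (snd c p)) v))) (at (snd c p))"
proof -
  have "((\<lambda>x. (F \<circ> chart_inv c') (transition c c' x)) has_derivative
      (\<lambda>v. F' (frechet_derivative (transition c c') (at (snd c p)) v))) (at (snd c p))"
    using F by (intro has_derivative_compose[OF transition_has_derivative[OF A]])
      (simp only: transition_chart[OF A(1,2,4)])
  then show ?thesis
  proof (rule has_derivative_transform_within_open)
    show "open (snd c ` (fst c' \<inter> fst c))"
      using open_chart_image[OF A(1,2) chart_atlas(1)[OF A(1,3)]] .
    show "snd c p \<in> snd c ` (fst c' \<inter> fst c)" using A by blast
  qed (auto simp: transition_chart[OF A(1,2)] chart_inv_chart[OF A(1,2)] chart_inv_chart[OF A(1,3)])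
qed

lemma transition_derivative_compose:
  assumes A: "oriented_atlas A" "c \<in> A" "c' \<in> A" "c'' \<in> A" "p \<in> fst c" "p \<in> fst c'" "p \<in> fst c''"
  shows "frechet_derivative (transition c' c'') (at (snd c' p)) (frechet_derivative (transition c c') (at (snd c p)) v)
    = frechet_derivative (transition c c'') (at (snd c p)) v"
proof -
  have "(transition c c'' has_derivative (\<lambda>v. frechet_derivative (transition c' c'') (at (snd c' p))
      (frechet_derivative (transition c c') (at (snd c p)) v))) (at (snd c p))"
    using has_derivative_change_chart[OF A(1,2,3,5,6), of "snd c''"] transition_has_derivative[OF A(1,3,4,6,7)]
    by (simp only: transition_def)
  from fun_cong[OF frechet_derivative_at[OF this], of v] show ?thesis .
qed

lemma transition_derivative_self:
  assumes A: "oriented_atlas A" "c \<in> A" "p \<in> fst c"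
  shows "frechet_derivative (transition c c) (at (snd c p)) v = v"
proof -
  have "(transition c c has_derivative (\<lambda>v. v)) (at (snd c p))"
    by (rule has_derivative_transform_within_open[OF has_derivative_ident chart_atlas(2)[OF A(1,2)]])
       (use A in \<open>auto simp: transition_chart[OF A(1,2)]\<close>)
  from fun_cong[OF frechet_derivative_at[OF this], of v] show ?thesis by simp
qed

lemma transition_derivative_inverse:
  assumes A: "oriented_atlas A" "c \<in> A" "c' \<in> A" "p \<in> fst c" "p \<in> fst c'"
  shows "frechet_derivative (transition c' c) (at (snd c' p)) (frechet_derivative (transition c c') (at (snd c p)) v) = v"
  by (simp add: transition_derivative_compose[OF A(1,2,3,2,4,5,4)] transition_derivative_self[OF A(1,2,4)])

lemma chart_at_mem:
  assumes "p \<in> mfd A"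
  shows "chart_at A p \<in> A" "p \<in> fst (chart_at A p)"
proof -
  have "\<exists>c. c \<in> A \<and> p \<in> fst c" using assms by (auto simp: mfd_def)
  then have "chart_at A p \<in> A \<and> p \<in> fst (chart_at A p)" unfolding chart_at_def by (rule someI_ex)
  then show "chart_at A p \<in> A" "p \<in> fst (chart_at A p)" by auto
qed

text \<open>
  Tangent vectors at \<open>p\<close> are given in the preferred chart of \<open>p\<close>;
  this is the differential at \<open>p\<close> of the chart \<open>c\<close> in that
  identification.
\<close>

definition to_chart :: "'a chart set \<Rightarrow> 'a chart \<Rightarrow> 'a \<Rightarrow> real^3 \<Rightarrow> real^3" where
  "to_chart A c p = frechet_derivative (transition (chart_at A p) c) (at (coord_at A p))"

lemma linear_to_chart:
  assumes "oriented_atlas A" "c \<in> A" "p \<in> fst c" "p \<in> mfd A"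
  shows "linear (to_chart A c p)"
  using linear_transition[OF assms(1) chart_at_mem(1)[OF assms(4)] assms(2) chart_at_mem(2)[OF assms(4)] assms(3)]
  by (simp add: to_chart_def coord_at_def)

lemma to_chart_chart_at:
  assumes "oriented_atlas A" "p \<in> mfd A"
  shows "to_chart A (chart_at A p) p v = v"
  using transition_derivative_self[OF assms(1) chart_at_mem[OF assms(2)]]
  by (simp add: to_chart_def coord_at_def)

lemma mem_mfd: "c \<in> A \<Longrightarrow> p \<in> fst c \<Longrightarrow> p \<in> mfd A"
  by (auto simp: mfd_def)

lemma vf_rep_chart:
  assumes "oriented_atlas A" "c \<in> A" "p \<in> fst c"
  shows "vf_rep A c X (snd c p) = to_chart A c p (X p)"
  by (simp add: vf_rep_def to_chart_def Let_def chart_inv_chart[OF assms])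

lemma form_rep_chart:
  assumes "oriented_atlas A" "c \<in> A" "p \<in> fst c"
  shows "form_rep A c \<alpha> (snd c p) v = \<alpha> p (frechet_derivative (transition c (chart_at A p)) (at (snd c p)) v)"
  by (simp add: form_rep_def Let_def chart_inv_chart[OF assms])

lemma form_rep_to_chart:
  assumes A: "oriented_atlas A" "c \<in> A" "p \<in> fst c"
  shows "form_rep A c \<alpha> (snd c p) (to_chart A c p v) = \<alpha> p v"
proof -
  note m = chart_at_mem[OF mem_mfd[OF A(2,3)]]
  show ?thesis
    using transition_derivative_inverse[OF A(1) m(1) A(2) m(2) A(3), of v]
    by (simp add: form_rep_chart[OF A] to_chart_def coord_at_def)
qed

lemma linear_form_rep:
  assumes A: "oriented_atlas A" "c \<in> A" "p \<in> fst c" and "linear (\<alpha> p)"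
  shows "linear (form_rep A c \<alpha> (snd c p))"
proof -
  note m = chart_at_mem[OF mem_mfd[OF A(2,3)]]
  have "form_rep A c \<alpha> (snd c p) = \<alpha> p \<circ> frechet_derivative (transition c (chart_at A p)) (at (snd c p))"
    by (simp add: fun_eq_iff form_rep_chart[OF A])
  then show ?thesis
    using linear_compose[OF linear_transition[OF A(1,2) m(1) A(3) m(2)] assms(4)] by simp
qed

lemma form_rep_change:
  assumes A: "oriented_atlas A" "c \<in> A" "c' \<in> A" "p \<in> fst c" "p \<in> fst c'"
  shows "form_rep A c \<alpha> (snd c p) v =
    form_rep A c' \<alpha> (snd c' p) (frechet_derivative (transition c c') (at (snd c p)) v)"
proof -
  note m = chart_at_mem[OF mem_mfd[OF A(2,4)]]
  show ?thesis
    by (simp add: form_rep_chart[OF A(1,2,4)] form_rep_chart[OF A(1,3,5)]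
        transition_derivative_compose[OF A(1,2,3) m(1) A(4,5) m(2)])
qed

lemma smooth_vf_rep:
  "smooth_vf A U X \<Longrightarrow> c \<in> A \<Longrightarrow> smooth_on (vf_rep A c X) (snd c ` (U \<inter> fst c))"
  by (simp add: smooth_vf_def)

lemma smooth_form_rep:
  "smooth_form A U \<alpha> \<Longrightarrow> c \<in> A \<Longrightarrow> smooth_on (\<lambda>x. form_rep A c \<alpha> x v) (snd c ` (U \<inter> fst c))"
  by (simp add: smooth_form_def)

lemma ext_deriv_chart_at:
  "ext_deriv A \<alpha> p = dform (form_rep A (chart_at A p) \<alpha>) (coord_at A p)"
  by (simp add: fun_eq_iff ext_deriv_def dform_def)

lemma ext_deriv_to_chart:
  assumes A: "oriented_atlas A" "c \<in> A" "p \<in> fst c"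
    and U: "open U" "p \<in> U" and \<alpha>: "smooth_form A U \<alpha>"
  shows "ext_deriv A \<alpha> p u v = dform (form_rep A c \<alpha>) (snd c p) (to_chart A c p u) (to_chart A c p v)"
proof -
  define d where "d = chart_at A p"
  have d: "d \<in> A" "p \<in> fst d" using chart_at_mem[OF mem_mfd[OF A(2,3)]] by (simp_all add: d_def)
  have dp: "coord_at A p = snd d p" by (simp add: d_def coord_at_def)
  define S where "S = snd d ` ((U \<inter> fst c) \<inter> fst d)"
  define T where "T = snd c ` (U \<inter> fst c)"
  have \<phi>: "transition d c (snd d p) = snd c p" using transition_chart[OF A(1) d] .
  have "dform (form_rep A d \<alpha>) (snd d p) u v =
    dform (form_rep A c \<alpha>) (transition d c (snd d p))
      (frechet_derivative (transition d c) (at (snd d p)) u) (frechet_derivative (transition d c) (at (snd d p)) v)"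
  proof (rule dform_pullback)
    show "open S" unfolding S_def using U chart_atlas(1)[OF A(1,2)] by (intro open_chart_image[OF A(1) d(1)]) auto
    show "snd d p \<in> S" using U A d by (auto simp: S_def)
    show "transition d c differentiable at z" if "z \<in> S" for z
      using that smooth_on_differentiable[OF transition_smooth[OF A(1) d(1) A(2)], of z] by (auto simp: S_def)
    show "(\<lambda>z. frechet_derivative (transition d c) (at z) v) differentiable at (snd d p)" for v
      using smooth_on_differentiable[OF smooth_on_frechet_derivative[OF transition_smooth[OF A(1) d(1) A(2)]], of "snd d p"]
        d A by auto
    show "open T" unfolding T_def using U by (intro open_chart_image[OF A(1,2)])
    show "transition d c (snd d p) \<in> T" unfolding \<phi> T_def using U A by blast
    show "linear (form_rep A c \<alpha> z)" if "z \<in> T" for z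
      using that \<alpha> linear_form_rep[OF A(1,2)] by (auto simp: T_def smooth_form_def)
    show "(\<lambda>z. form_rep A c \<alpha> z v) differentiable at (transition d c (snd d p))" for v
      unfolding \<phi> using smooth_on_differentiable[OF smooth_form_rep[OF \<alpha> A(2)]] U A by blast
    show "form_rep A d \<alpha> z v = form_rep A c \<alpha> (transition d c z) (frechet_derivative (transition d c) (at z) v)"
      if "z \<in> S" for z v
      using that by (auto simp: S_def form_rep_change[OF A(1) d(1) A(2)] transition_chart[OF A(1) d(1)])
  qed
  then show ?thesis
    unfolding \<phi> by (simp add: ext_deriv_chart_at to_chart_def flip: d_def dp)
qed

text \<open>
  A function that is constant on \<open>S\<close> near \<open>p\<close> is constant along
  every curve that represents a vector of the tangent space.
\<close>

lemma tangent_space_derivative_zero: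
  fixes F :: "'a::{t2_space,second_countable_topology} \<Rightarrow> real"
  assumes A: "oriented_atlas A" "c \<in> A" "p \<in> fst c"
    and v: "v \<in> tangent_space A S p" and N: "open N" "p \<in> N"
    and F: "\<And>q. q \<in> S \<inter> N \<Longrightarrow> F q = k"
    and F': "((F \<circ> chart_inv c) has_derivative F') (at (snd c p))"
  shows "F' (to_chart A c p v) = 0"
proof -
  define d where "d = chart_at A p"
  have d: "d \<in> A" "p \<in> fst d" using chart_at_mem[OF mem_mfd[OF A(2,3)]] by (simp_all add: d_def)
  have "\<exists>(\<gamma>::real \<Rightarrow> 'a) e. e > 0 \<and> \<gamma> 0 = p \<and> (\<forall>t\<in>{-e<..<e}. \<gamma> t \<in> S \<inter> fst d) \<and>
      smooth_on (\<lambda>t. snd d (\<gamma> t)) {-e<..<e} \<and> ((\<lambda>t. snd d (\<gamma> t)) has_vector_derivative v) (at (0::real))"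
    using v unfolding tangent_space_def mem_Collect_eq d_def .
  then obtain \<gamma> e where curve: "e > 0 \<and> \<gamma> 0 = p \<and> (\<forall>t\<in>{-e<..<e}. \<gamma> t \<in> S \<inter> fst d) \<and>
      smooth_on (\<lambda>t. snd d (\<gamma> t)) {-e<..<e} \<and> ((\<lambda>t. snd d (\<gamma> t)) has_vector_derivative v) (at (0::real))"
    by (elim exE) (rule that)
  then have e: "e > 0" and \<gamma>0: "\<gamma> 0 = p" and \<gamma>: "\<And>t. t \<in> {-e<..<e} \<Longrightarrow> \<gamma> t \<in> S \<inter> fst d"
    and \<gamma>': "((\<lambda>t. snd d (\<gamma> t)) has_vector_derivative v) (at 0)" by auto
  have "((F \<circ> chart_inv d) has_derivative (\<lambda>u. F' (frechet_derivative (transition d c) (at (snd d p)) u))) (at (snd d p))"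
    by (rule has_derivative_change_chart[OF A(1) d(1) A(2) d(2) A(3) F'])
  then have "((\<lambda>t. (F \<circ> chart_inv d) (snd d (\<gamma> t))) has_derivative
      (\<lambda>h. F' (frechet_derivative (transition d c) (at (snd d p)) (h *\<^sub>R v)))) (at 0)"
    by (rule has_derivative_compose[OF \<gamma>'[unfolded has_vector_derivative_def], unfolded \<gamma>0])
  moreover have ev: "\<forall>\<^sub>F t in at 0. (F \<circ> chart_inv d) (snd d (\<gamma> t)) = k"
  proof -
    have "continuous (at 0) (\<lambda>t. snd d (\<gamma> t))"
      using has_vector_derivative_continuous[OF \<gamma>'] .
    then have tend: "((\<lambda>t. snd d (\<gamma> t)) \<longlongrightarrow> snd d p) (at 0)"
      by (simp add: isCont_def \<gamma>0)
    have "\<forall>\<^sub>F t in at 0. snd d (\<gamma> t) \<in> snd d ` (N \<inter> fst d)"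
      by (rule topological_tendstoD[OF tend open_chart_image[OF A(1) d(1) N(1)]]) (use N d in blast)
    moreover have "\<forall>\<^sub>F t in at 0. t \<in> {-e<..<e}"
      using e by (intro eventually_at_in_open') auto
    ultimately show ?thesis
    proof eventually_elim
      case (elim t)
      then have "\<gamma> t \<in> S \<inter> fst d" using \<gamma> by blast
      moreover have "\<gamma> t \<in> N"
        using elim(1) chart_inv_chart[OF A(1) d(1)] calculation by (metis IntD1 IntD2 imageE)
      ultimately show ?case using F[of "\<gamma> t"] by (simp add: chart_inv_chart[OF A(1) d(1)])
    qed
  qed
  have "((\<lambda>t. (F \<circ> chart_inv d) (snd d (\<gamma> t))) has_derivative (\<lambda>h. 0)) (at 0)"
  proof (rule has_derivative_transform_eventually[OF has_derivative_const[of k]])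
    show "\<forall>\<^sub>F t in at 0. k = (F \<circ> chart_inv d) (snd d (\<gamma> t))"
      using ev by (simp only: eq_commute)
    show "k = (F \<circ> chart_inv d) (snd d (\<gamma> 0))"
      using F[of p] \<gamma>[of 0] \<gamma>0 N e d by (auto simp: chart_inv_chart[OF A(1) d(1)])
  qed simp
  ultimately have "(\<lambda>h. F' (frechet_derivative (transition d c) (at (snd d p)) (h *\<^sub>R v))) = (\<lambda>h. 0)"
    by (rule has_derivative_unique)
  from fun_cong[OF this, of 1] show ?thesis by (simp add: to_chart_def coord_at_def d_def)
qed

section \<open>Frames, forms and the nonholonomity function\<close>

lemma smooth_vf_subset: "smooth_vf A U X \<Longrightarrow> V \<subseteq> U \<Longrightarrow> smooth_vf A V X"
  unfolding smooth_vf_def by (blast intro: smooth_on_subset)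

lemma smooth_form_subset: "smooth_form A U \<alpha> \<Longrightarrow> V \<subseteq> U \<Longrightarrow> smooth_form A V \<alpha>"
  unfolding smooth_form_def by (blast intro: smooth_on_subset)

lemma vf_rep_differentiable:
  assumes "smooth_vf A U X" "c \<in> A" "p \<in> U" "p \<in> fst c"
  shows "vf_rep A c X differentiable (at (snd c p))"
  using smooth_on_differentiable[OF smooth_vf_rep[OF assms(1,2)]] assms(3,4) by blast

lemma form_rep_differentiable:
  assumes "smooth_form A U \<alpha>" "c \<in> A" "p \<in> U" "p \<in> fst c"
  shows "(\<lambda>x. form_rep A c \<alpha> x v) differentiable (at (snd c p))"
  using smooth_on_differentiable[OF smooth_form_rep[OF assms(1,2)]] assms(3,4) by blast

lemma vf_rep_chart_at:
  assumes "oriented_atlas A" "p \<in> mfd A"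
  shows "vf_rep A (chart_at A p) X (coord_at A p) = X p"
  using vf_rep_chart[OF assms(1) chart_at_mem[OF assms(2)]] to_chart_chart_at[OF assms]
  by (simp add: coord_at_def)

lemma form_rep_chart_at:
  assumes "oriented_atlas A" "p \<in> mfd A"
  shows "form_rep A (chart_at A p) \<alpha> (coord_at A p) v = \<alpha> p v"
  using form_rep_to_chart[OF assms(1) chart_at_mem[OF assms(2)]] to_chart_chart_at[OF assms]
  by (simp add: coord_at_def)

lemma form_rep_vf_rep:
  assumes "oriented_atlas A" "c \<in> A" "p \<in> fst c"
  shows "form_rep A c \<alpha> (snd c p) (vf_rep A c X (snd c p)) = \<alpha> p (X p)"
  by (simp add: vf_rep_chart[OF assms] form_rep_to_chart[OF assms])

lemma ext_deriv_eq_bracket: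
  assumes A: "oriented_atlas A" "p \<in> mfd A" and U: "open U" "p \<in> U"
    and lin: "\<And>q. q \<in> U \<Longrightarrow> linear (\<alpha> q)"
    and d\<alpha>: "\<And>v. (\<lambda>x. form_rep A (chart_at A p) \<alpha> x v) differentiable (at (coord_at A p))"
    and X: "smooth_vf A U X" "\<And>q. q \<in> U \<Longrightarrow> \<alpha> q (X q) = a"
    and Y: "smooth_vf A U Y" "\<And>q. q \<in> U \<Longrightarrow> \<alpha> q (Y q) = b"
  shows "ext_deriv A \<alpha> p (X p) (Y p) = - \<alpha> p (lie_bracket A X Y p)"
proof -
  define d where "d = chart_at A p"
  have d: "d \<in> A" "p \<in> fst d" using chart_at_mem[OF A(2)] by (simp_all add: d_def)
  have dp: "coord_at A p = snd d p" by (simp add: d_def coord_at_def)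
  have "dform (form_rep A d \<alpha>) (snd d p) (vf_rep A d X (snd d p)) (vf_rep A d Y (snd d p)) =
    - form_rep A d \<alpha> (snd d p)
       (frechet_derivative (vf_rep A d Y) (at (snd d p)) (vf_rep A d X (snd d p)) -
        frechet_derivative (vf_rep A d X) (at (snd d p)) (vf_rep A d Y (snd d p)))"
  proof (rule dform_frame_fields)
    show "open (snd d ` (U \<inter> fst d))" using open_chart_image[OF A(1) d(1) U(1)] .
    show "snd d p \<in> snd d ` (U \<inter> fst d)" using U d by blast
    show "linear (form_rep A d \<alpha> z)" if "z \<in> snd d ` (U \<inter> fst d)" for z
      using that linear_form_rep[OF A(1) d(1)] lin by auto
    show "(\<lambda>z. form_rep A d \<alpha> z v) differentiable at (snd d p)" for v
      using d\<alpha>[of v] by (simp add: d_def coord_at_def)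
    show "form_rep A d \<alpha> z (vf_rep A d X z) = a" if "z \<in> snd d ` (U \<inter> fst d)" for z
      using that form_rep_vf_rep[OF A(1) d(1)] X(2) by auto
    show "form_rep A d \<alpha> z (vf_rep A d Y z) = b" if "z \<in> snd d ` (U \<inter> fst d)" for z
      using that form_rep_vf_rep[OF A(1) d(1)] Y(2) by auto
    show "vf_rep A d X differentiable at (snd d p)" "vf_rep A d Y differentiable at (snd d p)"
      by (rule vf_rep_differentiable[OF X(1) d(1) U(2) d(2)] vf_rep_differentiable[OF Y(1) d(1) U(2) d(2)])+
  qed
  then show ?thesis
    using vf_rep_chart_at[OF A] form_rep_chart_at[OF A]
    by (simp add: ext_deriv_chart_at lie_bracket_def dp d_def[symmetric])
qed

corollary smooth_ext_deriv_eq_bracket: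
  assumes "oriented_atlas A" "p \<in> mfd A" "open U" "p \<in> U" "smooth_form A U \<alpha>"
    and "smooth_vf A U X" "\<And>q. q \<in> U \<Longrightarrow> \<alpha> q (X q) = a"
    and "smooth_vf A U Y" "\<And>q. q \<in> U \<Longrightarrow> \<alpha> q (Y q) = b"
  shows "ext_deriv A \<alpha> p (X p) (Y p) = - \<alpha> p (lie_bracket A X Y p)"
proof (rule ext_deriv_eq_bracket[OF assms(1-4) _ _ assms(6-9)])
  show "linear (\<alpha> q)" if "q \<in> U" for q using assms(5) that by (simp add: smooth_form_def)
  show "(\<lambda>x. form_rep A (chart_at A p) \<alpha> x v) differentiable at (coord_at A p)" for v
    using form_rep_differentiable[OF assms(5) chart_at_mem(1)[OF assms(2)] assms(4) chart_at_mem(2)[OF assms(2)]]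
    by (simp add: coord_at_def)
qed

lemma ext_deriv_skew: "ext_deriv A \<alpha> p u v = - ext_deriv A \<alpha> p v u"
  by (simp add: ext_deriv_def)

lemma ext_deriv_self [simp]: "ext_deriv A \<alpha> p u u = 0"
  by (simp add: ext_deriv_def)

lemma linear_ext_deriv_right:
  assumes A: "oriented_atlas A" "p \<in> mfd A" and U: "open U" "p \<in> U" and \<alpha>: "smooth_form A U \<alpha>"
  shows "linear (ext_deriv A \<alpha> p u)"
proof -
  define d where "d = chart_at A p"
  have d: "d \<in> A" "p \<in> fst d" using chart_at_mem[OF A(2)] by (simp_all add: d_def)
  have "linear (dform (form_rep A d \<alpha>) (snd d p) u)"
  proof (rule linear_dform_right)
    show "open (snd d ` (U \<inter> fst d))" using open_chart_image[OF A(1) d(1) U(1)] .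
    show "snd d p \<in> snd d ` (U \<inter> fst d)" using U d by blast
    show "linear (form_rep A d \<alpha> z)" if "z \<in> snd d ` (U \<inter> fst d)" for z
      using that linear_form_rep[OF A(1) d(1)] \<alpha> by (auto simp: smooth_form_def)
    show "(\<lambda>z. form_rep A d \<alpha> z v) differentiable at (snd d p)" for v
      using form_rep_differentiable[OF \<alpha> d(1) U(2) d(2)] .
  qed
  then show ?thesis by (simp add: ext_deriv_chart_at d_def coord_at_def)
qed

text \<open>
  The value of an alternating form on a pair is multiplied by the determinant of the change of
  basis, which is \<open>a\<^sup>2 + b\<^sup>2\<close> for a rotation.
\<close>

lemma ext_deriv_rotate:
  assumes "oriented_atlas A" "p \<in> mfd A" "open U" "p \<in> U" "smooth_form A U \<alpha>"
    and ab: "a\<^sup>2 + b\<^sup>2 = 1"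
  shows "ext_deriv A \<alpha> p (a *\<^sub>R u + b *\<^sub>R v) (- b *\<^sub>R u + a *\<^sub>R v) = ext_deriv A \<alpha> p u v"
proof -
  note r = linear_ext_deriv_right[OF assms(1-5)]
  have l: "ext_deriv A \<alpha> p (a *\<^sub>R u + b *\<^sub>R v) w = a * ext_deriv A \<alpha> p u w + b * ext_deriv A \<alpha> p v w" for w
    using linear_add[OF r] linear_cmul[OF r]
    by (simp add: ext_deriv_skew[of _ _ _ _ w])
  have "ext_deriv A \<alpha> p (a *\<^sub>R u + b *\<^sub>R v) (- b *\<^sub>R u + a *\<^sub>R v) = (a\<^sup>2 + b\<^sup>2) * ext_deriv A \<alpha> p u v"
    unfolding l linear_add[OF r] linear_cmul[OF r]
    by (simp add: ext_deriv_skew[of _ _ _ v u] power2_eq_square algebra_simps)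
  then show ?thesis by (simp add: ab)
qed

text \<open>
  The terms of \<open>L\<^sub>V \<alpha>\<close> and of \<open>i\<^sub>V d\<alpha>\<close>
  differ by the differential of \<open>\<alpha>(V)\<close>, which is constant; this is
  Cartan's formula \<open>L\<^sub>V = i\<^sub>V d + d i\<^sub>V\<close>.
\<close>

lemma ext_deriv_characteristic:
  assumes A: "oriented_atlas A" "p \<in> mfd A" and U: "open U" "p \<in> U" and \<alpha>: "smooth_form A U \<alpha>"
    and V: "characteristic_field A U \<alpha> V"
  shows "ext_deriv A \<alpha> p (V p) u = 0"
proof -
  define d where "d = chart_at A p"
  have d: "d \<in> A" "p \<in> fst d" using chart_at_mem[OF A(2)] by (simp_all add: d_def)
  have dp: "coord_at A p = snd d p" by (simp add: d_def coord_at_def)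
  have V': "smooth_vf A U V" "\<And>q. q \<in> U \<Longrightarrow> \<alpha> q (V q) = 1" "lie_deriv A V \<alpha> p u = 0"
    using V U by (auto simp: characteristic_field_def)
  have S: "open (snd d ` (U \<inter> fst d))" "snd d p \<in> snd d ` (U \<inter> fst d)"
    using open_chart_image[OF A(1) d(1) U(1)] U d by blast+
  have "((\<lambda>z. form_rep A d \<alpha> z (vf_rep A d V z)) has_derivative
     (\<lambda>h. frechet_derivative (\<lambda>z. form_rep A d \<alpha> z (vf_rep A d V (snd d p))) (at (snd d p)) h +
          form_rep A d \<alpha> (snd d p) (frechet_derivative (vf_rep A d V) (at (snd d p)) h))) (at (snd d p))"
  proof (rule has_derivative_pairing[OF S])
    show "linear (form_rep A d \<alpha> z)" if "z \<in> snd d ` (U \<inter> fst d)" for z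
      using that linear_form_rep[OF A(1) d(1)] \<alpha> by (auto simp: smooth_form_def)
    show "(\<lambda>z. form_rep A d \<alpha> z v) differentiable at (snd d p)" for v
      using form_rep_differentiable[OF \<alpha> d(1) U(2) d(2)] .
    show "(vf_rep A d V has_derivative frechet_derivative (vf_rep A d V) (at (snd d p))) (at (snd d p))"
      using vf_rep_differentiable[OF V'(1) d(1) U(2) d(2)] by (simp add: frechet_derivative_works)
  qed
  moreover have "((\<lambda>z. form_rep A d \<alpha> z (vf_rep A d V z)) has_derivative (\<lambda>h. 0)) (at (snd d p))"
    by (rule has_derivative_transform_within_open[OF has_derivative_const[of 1] S])
       (auto simp: form_rep_vf_rep[OF A(1) d(1)] V'(2))
  ultimately have "(\<lambda>h. frechet_derivative (\<lambda>z. form_rep A d \<alpha> z (vf_rep A d V (snd d p))) (at (snd d p)) h +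
          form_rep A d \<alpha> (snd d p) (frechet_derivative (vf_rep A d V) (at (snd d p)) h)) = (\<lambda>h. 0)"
    by (rule has_derivative_unique)
  from fun_cong[OF this, of u] V'(3) show ?thesis
    using vf_rep_chart_at[OF A] form_rep_chart_at[OF A]
    by (simp add: ext_deriv_def lie_deriv_def dp d_def[symmetric])
qed

text \<open>
  By dimension: a vector of the kernel outside \<open>\<Delta>\<close> would make the form
  vanish on the whole tangent space.
\<close>

lemma ann_section_kernel:
  assumes "ann_section A \<Delta> U \<omega>" "p \<in> U" "subspace (\<Delta> p)" "dim (\<Delta> p) = 2"
  shows "\<omega> p v = 0 \<longleftrightarrow> v \<in> \<Delta> p"
proof
  assume 0: "\<omega> p v = 0"
  have lin: "linear (\<omega> p)" using assms by (simp add: ann_section_def smooth_form_def)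
  show "v \<in> \<Delta> p"
  proof (rule ccontr)
    assume "v \<notin> \<Delta> p"
    then have "dim (insert v (\<Delta> p)) = DIM(real^3)"
      using assms(3,4) by (simp add: dim_insert span_eq_iff[THEN iffD2])
    then have "span (insert v (\<Delta> p)) = UNIV" using dim_eq_full by blast
    moreover have "\<omega> p x = 0" if "x \<in> insert v (\<Delta> p)" for x
      using that 0 assms(1,2) by (auto simp: ann_section_def)
    ultimately have "\<omega> p x = 0" for x
      using linear_eq_0_on_span[OF lin, of "insert v (\<Delta> p)" x] by blast
    then show False using assms(1,2) by (auto simp: ann_section_def)
  qed
qed (use assms in \<open>auto simp: ann_section_def\<close>)

lemma positive_basis_expansion:
  assumes "plane_orientation W P" "P X Y" "Z \<in> W"
  obtains a b where "Z = a *\<^sub>R X + b *\<^sub>R Y"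
proof -
  obtain u v where W: "W = span {u, v}"
    and P: "\<And>x y. P x y \<longleftrightarrow> (\<exists>a b c d. x = a *\<^sub>R u + b *\<^sub>R v \<and> y = c *\<^sub>R u + d *\<^sub>R v \<and> a * d - b * c > 0)"
    using assms(1) unfolding plane_orientation_def by blast
  obtain a b c d where X: "X = a *\<^sub>R u + b *\<^sub>R v" and Y: "Y = c *\<^sub>R u + d *\<^sub>R v" and D: "a * d - b * c > 0"
    using assms(2) P by blast
  obtain m n where Z: "Z = m *\<^sub>R u + n *\<^sub>R v"
    using assms(3) W by (auto simp: span_insert span_singleton algebra_simps)
  define D' where "D' = a * d - b * c"
  have "D' *\<^sub>R Z = (m * d - n * c) *\<^sub>R X + (n * a - m * b) *\<^sub>R Y"
    unfolding X Y Z D'_def by (simp add: algebra_simps)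
  then have "Z = inverse D' *\<^sub>R ((m * d - n * c) *\<^sub>R X + (n * a - m * b) *\<^sub>R Y)"
    using D by (metis D'_def less_irrefl real_vector.scale_left_imp_eq scaleR_scaleR right_inverse scaleR_one mult.commute)
  then show ?thesis using that by (simp add: scaleR_add_right)
qed

text \<open>
  The determinant of the coordinates with respect to the reference basis \<open>u, v\<close>
  is multiplicative.
\<close>

lemma positive_bases_determinant:
  assumes "plane_orientation W P" "dim W = 2" "P X Y" "P (a *\<^sub>R X + b *\<^sub>R Y) (c *\<^sub>R X + d *\<^sub>R Y)"
  shows "a * d - b * c > 0"
proof -
  obtain u v where W: "W = span {u, v}"
    and P: "\<And>x y. P x y \<longleftrightarrow> (\<exists>a b c d. x = a *\<^sub>R u + b *\<^sub>R v \<and> y = c *\<^sub>R u + d *\<^sub>R v \<and> a * d - b * c > 0)"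
    using assms(1) unfolding plane_orientation_def by blast
  have ind: "m = m' \<and> n = n'" if eq: "m *\<^sub>R u + n *\<^sub>R v = m' *\<^sub>R u + n' *\<^sub>R v" for m n m' n'
  proof -
    have d2: "dim {u, v} = 2" using assms(2) W by simp
    have uv: "independent {u, v}" "u \<noteq> v"
    proof -
      have c: "card {u, v} \<le> 2" by (simp add: card_insert_if)
      show "independent {u, v}" using card_le_dim_spanning[of "{u,v}" "span {u,v}"] c d2
        by (simp add: span_superset)
      show "u \<noteq> v" using d2 dim_le_card[of "{u,v}" "{u,v}"] by (auto simp: span_superset)
    qed
    have 0: "(m - m') *\<^sub>R u = (n' - n) *\<^sub>R v" using eq by (simp add: algebra_simps)
    have "m = m'"
    proof (rule ccontr)
      assume ne: "m \<noteq> m'"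
      then have "u = ((n' - n) / (m - m')) *\<^sub>R v"
      proof -
        have "inverse (m - m') *\<^sub>R ((m - m') *\<^sub>R u) = inverse (m - m') *\<^sub>R ((n' - n) *\<^sub>R v)"
          by (simp only: 0)
        then show ?thesis using ne by (simp add: divide_inverse mult.commute del: scaleR_left_diff_distrib)
      qed
      then have "u \<in> span {v}" by (simp add: span_base span_scale)
      then show False using uv by (simp add: independent_insert)
    qed
    moreover have "v \<noteq> 0" using uv(1) dependent_zero[of "{u, v}"] by auto
    ultimately show ?thesis using 0 by simp
  qed
  obtain x y z w where X: "X = x *\<^sub>R u + y *\<^sub>R v" and Y: "Y = z *\<^sub>R u + w *\<^sub>R v" and D: "x * w - y * z > 0"
    using assms(3) P by blast
  obtain x' y' z' w' where X': "a *\<^sub>R X + b *\<^sub>R Y = x' *\<^sub>R u + y' *\<^sub>R v"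
    and Y': "c *\<^sub>R X + d *\<^sub>R Y = z' *\<^sub>R u + w' *\<^sub>R v" and D': "x' * w' - y' * z' > 0"
    using assms(4) P by blast
  have "(a*x + b*z) *\<^sub>R u + (a*y + b*w) *\<^sub>R v = x' *\<^sub>R u + y' *\<^sub>R v"
       "(c*x + d*z) *\<^sub>R u + (c*y + d*w) *\<^sub>R v = z' *\<^sub>R u + w' *\<^sub>R v"
    using X' Y' by (simp_all add: X Y algebra_simps)
  from this[THEN ind] have "(a * d - b * c) * (x * w - y * z) > 0"
    using D' by (auto simp: algebra_simps)
  then show ?thesis using D by (simp add: zero_less_mult_iff)
qed

text \<open>
  The change of basis is orthogonal, and its determinant is \<open>1\<close> because both
  bases are positive.
\<close>

lemma orthonormal_pairs_rotation:
  assumes M: "sub_riemannian_surface A \<Delta> ori g" "p \<in> mfd A"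
    and X: "X \<in> \<Delta> p" "Y \<in> \<Delta> p" "ori p X Y" "g p X X = 1" "g p Y Y = 1" "g p X Y = 0"
    and X': "X' \<in> \<Delta> p" "Y' \<in> \<Delta> p" "ori p X' Y'" "g p X' X' = 1" "g p Y' Y' = 1" "g p X' Y' = 0"
  obtains a b where "a\<^sup>2 + b\<^sup>2 = 1" "X' = a *\<^sub>R X + b *\<^sub>R Y" "Y' = - b *\<^sub>R X + a *\<^sub>R Y"
proof -
  have D: "subspace (\<Delta> p)" "dim (\<Delta> p) = 2" "plane_orientation (\<Delta> p) (ori p)"
    using M by (auto simp: sub_riemannian_surface_def oriented_distribution_def)
  have g: "g p u v = g p v u" "g p (r *\<^sub>R u + s *\<^sub>R v) w = r * g p u w + s * g p v w"
    if "u \<in> \<Delta> p" "v \<in> \<Delta> p" "w \<in> \<Delta> p" for u v w r s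
    using M that unfolding sub_riemannian_surface_def metric_on_def by blast+
  have gg: "g p (r *\<^sub>R X + s *\<^sub>R Y) (m *\<^sub>R X + n *\<^sub>R Y) = r * m + s * n" for r s m n
  proof -
    have m: "m *\<^sub>R X + n *\<^sub>R Y \<in> \<Delta> p" using D X by (simp add: subspace_add subspace_scale)
    have "g p X (m *\<^sub>R X + n *\<^sub>R Y) = m" "g p Y (m *\<^sub>R X + n *\<^sub>R Y) = n"
      using g(1)[OF X(1) m m] g(1)[OF X(2) m m] g(2)[OF X(1,2,1)] g(2)[OF X(1,2,2)] X g(1)[OF X(1,2,1)]
      by auto
    then show ?thesis using g(2)[OF X(1,2) m] by simp
  qed
  obtain a b where ab: "X' = a *\<^sub>R X + b *\<^sub>R Y" using positive_basis_expansion[OF D(3) X(3) X'(1)] .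
  obtain c d where cd: "Y' = c *\<^sub>R X + d *\<^sub>R Y" using positive_basis_expansion[OF D(3) X(3) X'(2)] .
  have e: "a * a + b * b = 1" "c * c + d * d = 1" "a * c + b * d = 0"
    using X'(4,5,6) unfolding ab cd gg by auto
  have pos: "a * d - b * c > 0"
    using positive_bases_determinant[OF D(3,2) X(3)] X'(3) unfolding ab cd by blast
  have "(a * d - b * c)\<^sup>2 = 1"
  proof -
    have "(a * d - b * c)\<^sup>2 = (a * a + b * b) * (c * c + d * d) - (a * c + b * d)\<^sup>2"
      by (simp add: power2_eq_square algebra_simps)
    then show ?thesis by (simp add: e)
  qed
  then have det1: "a * d - b * c = 1" using pos by (simp add: power2_eq_1_iff)
  have "d = a"
  proof -
    have "d = d * (a * a + b * b)" by (simp add: e)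
    also have "\<dots> = a * (a * d - b * c) + b * (a * c + b * d)" by (simp add: algebra_simps)
    finally show ?thesis by (simp add: det1 e)
  qed
  moreover have "c = - b"
  proof -
    have "c = c * (a * a + b * b)" by (simp add: e)
    also have "\<dots> = a * (a * c + b * d) - b * (a * d - b * c)" by (simp add: algebra_simps)
    finally show ?thesis by (simp add: det1 e)
  qed
  ultimately show ?thesis using that[of a b] ab cd e by (simp add: power2_eq_square)
qed

lemma frames_rotation:
  assumes M: "sub_riemannian_surface A \<Delta> ori g" "p \<in> mfd A"
    and F: "oriented_orthonormal_frame A \<Delta> ori g U X Y" "p \<in> U"
    and F': "oriented_orthonormal_frame A \<Delta> ori g U' X' Y'" "p \<in> U'"
  obtains a b where "a\<^sup>2 + b\<^sup>2 = 1" "X' p = a *\<^sub>R X p + b *\<^sub>R Y p" "Y' p = - b *\<^sub>R X p + a *\<^sub>R Y p"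
proof -
  have 1: "X p \<in> \<Delta> p" "Y p \<in> \<Delta> p" "ori p (X p) (Y p)" "g p (X p) (X p) = 1" "g p (Y p) (Y p) = 1" "g p (X p) (Y p) = 0"
    using F unfolding oriented_orthonormal_frame_def by auto
  have 2: "X' p \<in> \<Delta> p" "Y' p \<in> \<Delta> p" "ori p (X' p) (Y' p)" "g p (X' p) (X' p) = 1" "g p (Y' p) (Y' p) = 1" "g p (X' p) (Y' p) = 0"
    using F' unfolding oriented_orthonormal_frame_def by auto
  show ?thesis using orthonormal_pairs_rotation[OF M 1 2] that by blast
qed

text \<open>
  The value \<open>\<omega>([X, Y]) = - d\<omega>(X, Y)\<close> depends on the values of
  \<open>X\<close> and \<open>Y\<close> at \<open>p\<close> alone, and these are unique up to
  a rotation. Hence the description defining \<open>nonholonomity\<close> has a unique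
  solution.
\<close>

lemma nonholonomity_eq:
  assumes M: "sub_riemannian_surface A \<Delta> ori g" and U: "open U" "p \<in> U" "U \<subseteq> mfd A"
    and \<omega>: "ann_section A \<Delta> U \<omega>"
    and V: "open V" "p \<in> V" "V \<subseteq> mfd A" and F: "oriented_orthonormal_frame A \<Delta> ori g V X Y"
  shows "nonholonomity A \<Delta> ori g \<omega> p = \<omega> p (lie_bracket A X Y p)"
    and "nonholonomity A \<Delta> ori g \<omega> p = - ext_deriv A \<omega> p (X p) (Y p)"
proof -
  have A: "oriented_atlas A" using M by (simp add: sub_riemannian_surface_def)
  have p: "p \<in> mfd A" using U by blast
  have sf: "smooth_form A U \<omega>" using \<omega> by (simp add: ann_section_def)
  have *: "ext_deriv A \<omega> p (X p) (Y p) = - \<omega> p (lie_bracket A X Y p)"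
    if V: "open V" "p \<in> V" "V \<subseteq> mfd A" and F: "oriented_orthonormal_frame A \<Delta> ori g V X Y" for V X Y
  proof (rule smooth_ext_deriv_eq_bracket[OF A p, of "U \<inter> V"])
    show "smooth_vf A (U \<inter> V) X" "smooth_vf A (U \<inter> V) Y"
      using F by (auto simp: oriented_orthonormal_frame_def intro: smooth_vf_subset)
    show "\<omega> q (X q) = 0" "\<omega> q (Y q) = 0" if "q \<in> U \<inter> V" for q
      using F \<omega> that by (auto simp: oriented_orthonormal_frame_def ann_section_def)
  qed (use U V sf in \<open>auto intro: smooth_form_subset\<close>)
  have "nonholonomity A \<Delta> ori g \<omega> p = \<omega> p (lie_bracket A X Y p)"
    unfolding nonholonomity_def
  proof (rule the_equality)
    fix l assume "\<exists>U X Y. open U \<and> p \<in> U \<and> U \<subseteq> mfd A \<and> oriented_orthonormal_frame A \<Delta> ori g U X Y \<and>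
      l = \<omega> p (lie_bracket A X Y p)"
    then obtain W X' Y' where W: "open W" "p \<in> W" "W \<subseteq> mfd A"
      and F': "oriented_orthonormal_frame A \<Delta> ori g W X' Y'" and l: "l = \<omega> p (lie_bracket A X' Y' p)" by blast
    obtain a b where "a\<^sup>2 + b\<^sup>2 = 1" "X' p = a *\<^sub>R X p + b *\<^sub>R Y p" "Y' p = - b *\<^sub>R X p + a *\<^sub>R Y p"
      using frames_rotation[OF M p F V(2) F' W(2)] .
    then have "ext_deriv A \<omega> p (X' p) (Y' p) = ext_deriv A \<omega> p (X p) (Y p)"
      using ext_deriv_rotate[OF A p U(1,2) sf] by metis
    then show "l = \<omega> p (lie_bracket A X Y p)"
      using *[OF W F'] *[OF V F] l by simp
  qed (use V F in blast)
  then show "nonholonomity A \<Delta> ori g \<omega> p = \<omega> p (lie_bracket A X Y p)"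
    and "nonholonomity A \<Delta> ori g \<omega> p = - ext_deriv A \<omega> p (X p) (Y p)"
    using *[OF V F] by simp_all
qed

text \<open>
  The form \<open>\<alpha>\<close> that witnesses the singularity of \<open>p\<close> need not
  be \<open>\<omega>\<close>, but both have the kernel \<open>\<Delta>\<close>: the condition
  says that \<open>d\<alpha>\<close> vanishes on \<open>\<Delta>\<close>, that is, that the
  bracket of \<open>X\<close> and \<open>Y\<close> lies in \<open>\<Delta>\<close>, and this
  is independent of the form.
\<close>

lemma nonholonomity_singular:
  assumes M: "sub_riemannian_surface A \<Delta> ori g" and p: "p \<in> singular_set A \<Delta>"
    and U: "open U" "p \<in> U" "U \<subseteq> mfd A" and \<omega>: "ann_section A \<Delta> U \<omega>"
    and F: "oriented_orthonormal_frame A \<Delta> ori g U X Y" and Z: "\<omega> p Z = 1"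
  shows "nonholonomity A \<Delta> ori g \<omega> p = 0"
proof -
  obtain V \<alpha> where V: "open V" "p \<in> V" "V \<subseteq> mfd A" and \<alpha>: "ann_section A \<Delta> V \<alpha>"
    and w: "\<And>u v w. wedge12 (\<alpha> p) (ext_deriv A \<alpha> p) u v w = 0"
    using p unfolding singular_set_def by blast
  have D: "subspace (\<Delta> p)" "dim (\<Delta> p) = 2"
    using M U by (auto simp: sub_riemannian_surface_def oriented_distribution_def)
  have XY: "X p \<in> \<Delta> p" "Y p \<in> \<Delta> p" using F U by (auto simp: oriented_orthonormal_frame_def)
  note k\<omega> = ann_section_kernel[OF \<omega> U(2) D] and k\<alpha> = ann_section_kernel[OF \<alpha> V(2) D]
  have "Z \<notin> \<Delta> p" using k\<omega>[of Z] Z by simp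
  then have "\<alpha> p Z \<noteq> 0" using k\<alpha> by blast
  moreover have "\<alpha> p (X p) = 0" "\<alpha> p (Y p) = 0" using k\<alpha> XY by blast+
  ultimately have "ext_deriv A \<alpha> p (X p) (Y p) = 0"
    using w[of "X p" "Y p" Z] by (simp add: wedge12_def)
  then have "\<alpha> p (lie_bracket A X Y p) = 0"
    using nonholonomity_eq[OF M V \<alpha> U F] by simp
  then have "\<omega> p (lie_bracket A X Y p) = 0" using k\<alpha> k\<omega> by blast
  then show ?thesis using nonholonomity_eq(1)[OF M U \<omega> U F] by simp
qed

lemma form_pairing_differentiable:
  assumes A: "oriented_atlas A" "c \<in> A" "p \<in> fst c" and U: "open U" "p \<in> U"
    and lin: "\<And>q. q \<in> U \<Longrightarrow> linear (\<alpha> q)"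
    and d\<alpha>: "\<And>v. (\<lambda>x. form_rep A c \<alpha> x v) differentiable (at (snd c p))"
    and X: "smooth_vf A U X"
  shows "((\<lambda>q. \<alpha> q (X q)) \<circ> chart_inv c) differentiable (at (snd c p))"
proof -
  have S: "open (snd c ` (U \<inter> fst c))" "snd c p \<in> snd c ` (U \<inter> fst c)"
    using open_chart_image[OF A(1,2) U(1)] U A by blast+
  have "(\<lambda>z. form_rep A c \<alpha> z (vf_rep A c X z)) differentiable (at (snd c p))"
  proof (rule differentiable_pairing[OF S _ d\<alpha> vf_rep_differentiable[OF X A(2) U(2) A(3)]])
    show "linear (form_rep A c \<alpha> z)" if "z \<in> snd c ` (U \<inter> fst c)" for z
      using that linear_form_rep[OF A(1,2)] lin by auto
  qed
  then show ?thesis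
    by (rule differentiable_transform_open[OF _ S]) (auto simp: form_rep_vf_rep[OF A(1,2)] chart_inv_chart[OF A(1,2)])
qed

lemma ext_deriv_vf_rep:
  assumes A: "oriented_atlas A" "c \<in> A" "p \<in> fst c"
    and U: "open U" "p \<in> U" and \<alpha>: "smooth_form A U \<alpha>"
  shows "ext_deriv A \<alpha> p (X p) (Y p) =
    dform (form_rep A c \<alpha>) (snd c p) (vf_rep A c X (snd c p)) (vf_rep A c Y (snd c p))"
  by (simp add: ext_deriv_to_chart[OF A U \<alpha>] vf_rep_chart[OF A])

lemma ext_deriv_differentiable:
  assumes A: "oriented_atlas A" "c \<in> A" "p \<in> fst c"
    and U: "open U" "p \<in> U" and \<alpha>: "smooth_form A U \<alpha>"
    and X: "smooth_vf A U X" and Y: "smooth_vf A U Y"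
  shows "((\<lambda>q. ext_deriv A \<alpha> q (X q) (Y q)) \<circ> chart_inv c) differentiable (at (snd c p))"
proof -
  define S where "S = snd c ` (U \<inter> fst c)"
  define w where "w = form_rep A c \<alpha>"
  have S: "open S" "snd c p \<in> S"
    unfolding S_def using open_chart_image[OF A(1,2) U(1)] U A by blast+
  have linw: "linear (w z)" if "z \<in> S" for z
    using that linear_form_rep[OF A(1,2)] \<alpha> by (auto simp: w_def S_def smooth_form_def)
  have dw: "(\<lambda>x. w x v) differentiable (at z)" if "z \<in> S" for v z
    using that smooth_on_differentiable[OF smooth_form_rep[OF \<alpha> A(2)]] by (simp add: w_def S_def)
  have dd: "(\<lambda>z. frechet_derivative (\<lambda>x. w x v) (at z) u) differentiable (at (snd c p))" for u v
    using S(2) smooth_on_differentiable[OF smooth_on_frechet_derivative[OF smooth_form_rep[OF \<alpha> A(2)]]]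
    by (simp add: w_def S_def)
  have d1: "(\<lambda>z. dform w z u v) differentiable (at (snd c p))" for u v
    unfolding dform_def by (intro differentiable_diff dd)
  have d2: "(\<lambda>z. dform w z u (vf_rep A c Y z)) differentiable (at (snd c p))" for u
    by (rule differentiable_pairing[OF S linear_dform_right[OF S(1) _ linw dw] d1 vf_rep_differentiable[OF Y A(2) U(2) A(3)]])
  have "(\<lambda>z. dform w z (vf_rep A c X z) (vf_rep A c Y z)) differentiable (at (snd c p))"
    by (rule differentiable_pairing[OF S linear_dform_left[OF S(1) _ linw dw] d2 vf_rep_differentiable[OF X A(2) U(2) A(3)]])
  then show ?thesis
  proof (rule differentiable_transform_open[OF _ S])
    fix z assume "z \<in> S"
    then obtain q where q: "z = snd c q" "q \<in> U" "q \<in> fst c" by (auto simp: S_def)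
    show "dform w z (vf_rep A c X z) (vf_rep A c Y z) = ((\<lambda>q. ext_deriv A \<alpha> q (X q) (Y q)) \<circ> chart_inv c) z"
      using q by (simp add: w_def ext_deriv_vf_rep[OF A(1,2) q(3) U(1) q(2) \<alpha>] chart_inv_chart[OF A(1,2)])
  qed
qed

lemma dual_coframe_differentiable:
  assumes A: "oriented_atlas A" "c \<in> A" "p \<in> fst c" and U: "open U" "p \<in> U"
    and \<eta>: "dual_coframe U E \<eta>" and E: "\<And>a. smooth_vf A U (E a)"
  shows "(\<lambda>x. form_rep A c (\<eta> a) x v) differentiable (at (snd c p))"
proof -
  define S where "S = snd c ` (U \<inter> fst c)"
  have S: "open S" "snd c p \<in> S"
    unfolding S_def using open_chart_image[OF A(1,2) U(1)] U A by blast+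
  have lin: "linear (form_rep A c (\<eta> a) z)" if "z \<in> S" for a z
    using that linear_form_rep[OF A(1,2)] \<eta> by (auto simp: S_def dual_coframe_def)
  have dual: "form_rep A c (\<eta> a) z (vf_rep A c (E b) z) = (if a = b then 1 else 0)" if "z \<in> S" for a b z
    using that \<eta> by (auto simp: S_def dual_coframe_def form_rep_vf_rep[OF A(1,2)])
  note dE = vf_rep_differentiable[OF E A(2) U(2) A(3)]
  have *: "(\<lambda>x. form_rep A c (\<eta> i) x v) differentiable (at (snd c p))"
    if "i \<noteq> j" "i \<noteq> k" "j \<noteq> k" for i j k
    by (rule differentiable_dual_coframe[OF S dE[of i] dE[of j] dE[of k], where \<beta> = "form_rep A c (\<eta> j)"
        and \<gamma> = "form_rep A c (\<eta> k)"])
       (use that in \<open>simp_all add: lin dual\<close>)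
  show ?thesis using exhaust_3[of a] *[of 1 2 3] *[of 2 3 1] *[of 3 1 2] by auto
qed

section \<open>Adapted frames\<close>

lemma adapted_frameD:
  assumes "adapted_frame A \<Delta> ori g U \<omega> E"
  shows "open U" "U \<subseteq> mfd A" "ann_section A \<Delta> U \<omega>" "smooth_form A U \<omega>" "characteristic_field A U \<omega> (E 3)"
    "oriented_orthonormal_frame A \<Delta> ori g U (E 1) (E 2)" "\<And>a. smooth_vf A U (E a)"
    "foliated_by_levels A U (nonholonomity A \<Delta> ori g \<omega>)"
    "\<And>r. transversal A \<Delta> {q \<in> U. nonholonomity A \<Delta> ori g \<omega> q = r}"
    "\<And>q. q \<in> U \<Longrightarrow> E 1 q \<in> tangent_space A {q' \<in> U. nonholonomity A \<Delta> ori g \<omega> q' = nonholonomity A \<Delta> ori g \<omega> q} q"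
    "\<And>q. q \<in> U \<Longrightarrow> \<omega> q (E 1 q) = 0 \<and> \<omega> q (E 2 q) = 0 \<and> \<omega> q (E 3 q) = 1"
proof -
  have 1: "open U" "U \<subseteq> mfd A" "ann_section A \<Delta> U \<omega>" "characteristic_field A U \<omega> (E 3)"
    "oriented_orthonormal_frame A \<Delta> ori g U (E 1) (E 2)"
    "foliated_by_levels A U (nonholonomity A \<Delta> ori g \<omega>)"
    using assms unfolding adapted_frame_def Let_def by auto
  show "open U" "U \<subseteq> mfd A" "ann_section A \<Delta> U \<omega>" "characteristic_field A U \<omega> (E 3)"
    "oriented_orthonormal_frame A \<Delta> ori g U (E 1) (E 2)"
    "foliated_by_levels A U (nonholonomity A \<Delta> ori g \<omega>)" by fact+
  show "smooth_form A U \<omega>" using 1(3) by (simp add: ann_section_def)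
  show "smooth_vf A U (E a)" for a
    using 1(4,5) exhaust_3[of a] by (auto simp: characteristic_field_def oriented_orthonormal_frame_def)
  show "transversal A \<Delta> {q \<in> U. nonholonomity A \<Delta> ori g \<omega> q = r}" for r
    using assms unfolding adapted_frame_def Let_def by auto
  show "E 1 q \<in> tangent_space A {q' \<in> U. nonholonomity A \<Delta> ori g \<omega> q' = nonholonomity A \<Delta> ori g \<omega> q} q"
    if "q \<in> U" for q
    using assms that unfolding adapted_frame_def Let_def by auto
  show "\<omega> q (E 1 q) = 0 \<and> \<omega> q (E 2 q) = 0 \<and> \<omega> q (E 3 q) = 1" if "q \<in> U" for q
    using 1(3-5) that by (auto simp: characteristic_field_def oriented_orthonormal_frame_def ann_section_def)
qed

lemma nonholonomity_differentiable:
  assumes M: "sub_riemannian_surface A \<Delta> ori g" and F: "adapted_frame A \<Delta> ori g U \<omega> E"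
    and p: "p \<in> U" and c: "c \<in> A" "p \<in> fst c"
  shows "(nonholonomity A \<Delta> ori g \<omega> \<circ> chart_inv c) differentiable (at (snd c p))"
proof -
  note F' = adapted_frameD[OF F]
  have A: "oriented_atlas A" using M by (simp add: sub_riemannian_surface_def)
  have S: "open (snd c ` (U \<inter> fst c))" "snd c p \<in> snd c ` (U \<inter> fst c)"
    using open_chart_image[OF A c(1) F'(1)] p c by blast+
  have "(\<lambda>z. - ((\<lambda>q. ext_deriv A \<omega> q (E 1 q) (E 2 q)) \<circ> chart_inv c) z) differentiable (at (snd c p))"
    by (intro differentiable_minus ext_deriv_differentiable[OF A c F'(1) p F'(4) F'(7) F'(7)])
  then show ?thesis
    by (rule differentiable_transform_open[OF _ S])
       (auto simp: chart_inv_chart[OF A c(1)] nonholonomity_eq(2)[OF M F'(1) _ F'(2,3,1) _ F'(2,6)])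
qed

text \<open>
  The field \<open>E\<^sub>1\<close> is tangent to the level sets of \<open>\<lambda>\<close>.
\<close>

lemma nonholonomity_derivative_E1:
  assumes M: "sub_riemannian_surface A \<Delta> ori g" and F: "adapted_frame A \<Delta> ori g U \<omega> E"
    and p: "p \<in> U" and c: "c \<in> A" "p \<in> fst c"
  shows "frechet_derivative (nonholonomity A \<Delta> ori g \<omega> \<circ> chart_inv c) (at (snd c p)) (to_chart A c p (E 1 p)) = 0"
proof -
  note F' = adapted_frameD[OF F]
  have A: "oriented_atlas A" using M by (simp add: sub_riemannian_surface_def)
  show ?thesis
    by (rule tangent_space_derivative_zero[OF A c F'(10)[OF p] open_UNIV UNIV_I _
          nonholonomity_differentiable[OF M F p c, unfolded frechet_derivative_works]]) simp
qed

text \<open>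
  The forms have the same kernel, and the frame \<open>E\<^sub>1, E\<^sub>2\<close> computes
  the nonholonomity function of both.
\<close>

lemma nonholonomity_proportional:
  assumes M: "sub_riemannian_surface A \<Delta> ori g"
    and F: "adapted_frame A \<Delta> ori g U \<omega> E" and F': "adapted_frame A \<Delta> ori g U' \<omega>' E'"
    and p: "p \<in> U" "p \<in> U'"
  shows "\<omega>' p v = \<omega>' p (E 3 p) * \<omega> p v" "\<omega>' p (E 3 p) \<noteq> 0"
    "nonholonomity A \<Delta> ori g \<omega>' p = \<omega>' p (E 3 p) * nonholonomity A \<Delta> ori g \<omega> p"
proof -
  note D = adapted_frameD[OF F] and D' = adapted_frameD[OF F']
  have \<Delta>: "subspace (\<Delta> p)" "dim (\<Delta> p) = 2"
    using M p D(2) by (auto simp: sub_riemannian_surface_def oriented_distribution_def)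
  note k = ann_section_kernel[OF D(3) p(1) \<Delta>] and k' = ann_section_kernel[OF D'(3) p(2) \<Delta>]
  have lin: "linear (\<omega> p)" "linear (\<omega>' p)" using D(4) D'(4) p by (auto simp: smooth_form_def)
  show *: "\<omega>' p v = \<omega>' p (E 3 p) * \<omega> p v" for v
  proof -
    have "\<omega> p (v - \<omega> p v *\<^sub>R E 3 p) = 0"
      using D(11)[OF p(1)] by (simp add: linear_diff[OF lin(1)] linear_cmul[OF lin(1)])
    then have "\<omega>' p (v - \<omega> p v *\<^sub>R E 3 p) = 0" using k k' by blast
    then show ?thesis by (simp add: linear_diff[OF lin(2)] linear_cmul[OF lin(2)])
  qed
  show "\<omega>' p (E 3 p) \<noteq> 0" using *[of "E' 3 p"] D'(11)[OF p(2)] by auto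
  show "nonholonomity A \<Delta> ori g \<omega>' p = \<omega>' p (E 3 p) * nonholonomity A \<Delta> ori g \<omega> p"
    unfolding nonholonomity_eq(1)[OF M D(1) p(1) D(2) D(3) D(1) p(1) D(2) D(6)]
      nonholonomity_eq(1)[OF M D'(1) p(2) D'(2) D'(3) D(1) p(1) D(2) D(6)]
    by (rule *)
qed

lemma frame_rotation_coefficients:
  assumes M: "sub_riemannian_surface A \<Delta> ori g"
    and F: "adapted_frame A \<Delta> ori g U \<omega> E" and F': "adapted_frame A \<Delta> ori g U' \<omega>' E'"
    and \<eta>: "dual_coframe U E \<eta>" and p: "p \<in> U" "p \<in> U'"
  shows "E' 1 p = \<eta> 1 p (E' 1 p) *\<^sub>R E 1 p + \<eta> 2 p (E' 1 p) *\<^sub>R E 2 p"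
    "E' 2 p = - \<eta> 2 p (E' 1 p) *\<^sub>R E 1 p + \<eta> 1 p (E' 1 p) *\<^sub>R E 2 p"
    "(\<eta> 1 p (E' 1 p))\<^sup>2 + (\<eta> 2 p (E' 1 p))\<^sup>2 = 1"
proof -
  note D = adapted_frameD[OF F] and D' = adapted_frameD[OF F']
  have pA: "p \<in> mfd A" using D(2) p by blast
  obtain a b where ab: "a\<^sup>2 + b\<^sup>2 = 1" "E' 1 p = a *\<^sub>R E 1 p + b *\<^sub>R E 2 p" "E' 2 p = - b *\<^sub>R E 1 p + a *\<^sub>R E 2 p"
    using frames_rotation[OF M pA D(6) p(1) D'(6) p(2)] .
  have "linear (\<eta> i p)" "\<eta> i p (E j p) = (if i = j then 1 else 0)" for i j
    using \<eta> p by (auto simp: dual_coframe_def)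
  then have "\<eta> 1 p (E' 1 p) = a" "\<eta> 2 p (E' 1 p) = b"
    by (simp_all add: ab linear_add linear_cmul)
  with ab show "E' 1 p = \<eta> 1 p (E' 1 p) *\<^sub>R E 1 p + \<eta> 2 p (E' 1 p) *\<^sub>R E 2 p"
    "E' 2 p = - \<eta> 2 p (E' 1 p) *\<^sub>R E 1 p + \<eta> 1 p (E' 1 p) *\<^sub>R E 2 p"
    "(\<eta> 1 p (E' 1 p))\<^sup>2 + (\<eta> 2 p (E' 1 p))\<^sup>2 = 1" by simp_all
qed

section \<open>Slices of the level foliation\<close>

lemma compatible_atlas:
  assumes "compatible_chart A c"
  shows "oriented_atlas (insert c A)"
  using assms by (simp add: compatible_chart_def)

lemma tangent_slice_zero:
  assumes A: "oriented_atlas A" "p \<in> mfd A" and d: "compatible_chart A d" "p \<in> fst d"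
    and v: "v \<in> tangent_space A S p" and N: "open N" "p \<in> N" and 0: "\<And>q. q \<in> S \<inter> N \<Longrightarrow> snd d q $ 3 = 0"
  shows "to_chart A d p v $ 3 = 0"
proof -
  define c0 where "c0 = chart_at A p"
  have c0: "c0 \<in> A" "p \<in> fst c0" using chart_at_mem[OF A(2)] by (simp_all add: c0_def)
  have "(transition c0 d has_derivative frechet_derivative (transition c0 d) (at (snd c0 p))) (at (snd c0 p))"
    by (rule transition_has_derivative[OF compatible_atlas[OF d(1)]]) (use c0 d in auto)
  then have "((\<lambda>x. transition c0 d x $ 3) has_derivative (\<lambda>v. frechet_derivative (transition c0 d) (at (snd c0 p)) v $ 3)) (at (snd c0 p))"
    by (rule bounded_linear.has_derivative[OF bounded_linear_vec_nth])
  then have "(((\<lambda>q. snd d q $ 3) \<circ> chart_inv c0) has_derivative (\<lambda>v. frechet_derivative (transition c0 d) (at (snd c0 p)) v $ 3)) (at (snd c0 p))"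
    by (simp add: transition_def o_def)
  from tangent_space_derivative_zero[OF A(1) c0 v N 0 this]
  show ?thesis using to_chart_chart_at[OF A] by (simp add: to_chart_def coord_at_def c0_def)
qed

lemma to_chart_compatible_surj:
  assumes A: "oriented_atlas A" "p \<in> mfd A" and d: "compatible_chart A d" "p \<in> fst d"
  obtains u where "to_chart A d p u = v"
  using transition_derivative_inverse[OF compatible_atlas[OF d(1)], of d "chart_at A p" p v] chart_at_mem[OF A(2)] d that
  by (simp add: to_chart_def coord_at_def)

lemma linear_to_chart_compatible:
  assumes A: "oriented_atlas A" "p \<in> mfd A" and d: "compatible_chart A d" "p \<in> fst d"
  shows "linear (to_chart A d p)"
  using linear_transition[OF compatible_atlas[OF d(1)], of "chart_at A p" d p] chart_at_mem[OF A(2)] d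
  by (simp add: to_chart_def coord_at_def)

text \<open>
  The differential of the slice coordinate vanishes on the tangent space of the level set,
  hence on \<open>E\<^sub>1\<close>. If it vanished on \<open>E\<^sub>2\<close> too, then by
  transversality it would be zero, but a coordinate has a nonzero differential.
\<close>

lemma adapted_frame_slice:
  assumes M: "sub_riemannian_surface A \<Delta> ori g" and F: "adapted_frame A \<Delta> ori g U \<omega> E"
    and p: "p \<in> U" and d: "compatible_chart A d" "p \<in> fst d"
    and 0: "\<And>q. q \<in> fst d \<Longrightarrow> q \<in> U \<Longrightarrow> nonholonomity A \<Delta> ori g \<omega> q = nonholonomity A \<Delta> ori g \<omega> p \<Longrightarrow> snd d q $ 3 = 0"
  shows "to_chart A d p (E 1 p) $ 3 = 0" "to_chart A d p (E 2 p) $ 3 \<noteq> 0"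
proof -
  note D = adapted_frameD[OF F]
  have A: "oriented_atlas A" using M by (simp add: sub_riemannian_surface_def)
  have pA: "p \<in> mfd A" using D(2) p by blast
  have od: "open (fst d)" using chart_atlas(1)[OF compatible_atlas[OF d(1)]] by blast
  define S where "S = {q' \<in> U. nonholonomity A \<Delta> ori g \<omega> q' = nonholonomity A \<Delta> ori g \<omega> p}"
  have t0: "to_chart A d p v $ 3 = 0" if "v \<in> tangent_space A S p" for v
    by (rule tangent_slice_zero[OF A pA d that od d(2)]) (use 0 in \<open>auto simp: S_def\<close>)
  show E1: "to_chart A d p (E 1 p) $ 3 = 0" using t0 D(10)[OF p] by (simp add: S_def)
  have lin: "linear (to_chart A d p)" by (rule linear_to_chart_compatible[OF A pA d])
  show "to_chart A d p (E 2 p) $ 3 \<noteq> 0"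
  proof
    assume E2: "to_chart A d p (E 2 p) $ 3 = 0"
    obtain w where w: "to_chart A d p w = axis 3 1" by (rule to_chart_compatible_surj[OF A pA d])
    have "transversal A \<Delta> S" unfolding S_def by (rule D(9))
    moreover have "p \<in> S" using p by (simp add: S_def)
    ultimately have "w \<in> {u + v |u v. u \<in> \<Delta> p \<and> v \<in> tangent_space A S p}"
      unfolding transversal_def by blast
    then obtain u v where uv: "w = u + v" "u \<in> \<Delta> p" "v \<in> tangent_space A S p" by blast
    have "plane_orientation (\<Delta> p) (ori p)"
      using M pA by (auto simp: sub_riemannian_surface_def oriented_distribution_def)
    moreover have "ori p (E 1 p) (E 2 p)" using D(6) p by (auto simp: oriented_orthonormal_frame_def)
    ultimately obtain a b where "u = a *\<^sub>R E 1 p + b *\<^sub>R E 2 p"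
      using positive_basis_expansion[OF _ _ uv(2)] by blast
    then have "to_chart A d p w $ 3 = 0"
      using E1 E2 t0[OF uv(3)] by (simp add: uv(1) linear_add[OF lin] linear_cmul[OF lin])
    then show False by (simp add: w)
  qed
qed

lemma level_slice_chart:
  assumes F: "adapted_frame A \<Delta> ori g U \<omega> E" and p: "p \<in> U"
  obtains d where "compatible_chart A d" "p \<in> fst d"
    "\<And>q. q \<in> fst d \<Longrightarrow> q \<in> U \<Longrightarrow> nonholonomity A \<Delta> ori g \<omega> q = nonholonomity A \<Delta> ori g \<omega> p \<Longrightarrow> snd d q $ 3 = 0"
proof -
  have "surface A {q \<in> U. nonholonomity A \<Delta> ori g \<omega> q = nonholonomity A \<Delta> ori g \<omega> p}"
    using adapted_frameD(8)[OF F] by (simp add: foliated_by_levels_def)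
  then obtain d where d: "compatible_chart A d" "p \<in> fst d"
    and im: "snd d ` ({q \<in> U. nonholonomity A \<Delta> ori g \<omega> q = nonholonomity A \<Delta> ori g \<omega> p} \<inter> fst d) = {x \<in> snd d ` fst d. x $ 3 = 0}"
    unfolding surface_def using p by blast
  show ?thesis
  proof (rule that[OF d])
    fix q assume "q \<in> fst d" "q \<in> U" "nonholonomity A \<Delta> ori g \<omega> q = nonholonomity A \<Delta> ori g \<omega> p"
    then have "snd d q \<in> {x \<in> snd d ` fst d. x $ 3 = 0}" unfolding im[symmetric] by blast
    then show "snd d q $ 3 = 0" by simp
  qed
qed

text \<open>
  Since \<open>\<lambda>' = f \<lambda>\<close> with \<open>f \<noteq> 0\<close>, the zero
  sets of \<open>\<lambda>\<close> and \<open>\<lambda>'\<close> agree near \<open>p\<close>.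
  Thus \<open>E\<^sub>1\<close> and \<open>E\<^sub>1'\<close> are both in the kernel of the
  differential of the slice coordinate, which meets \<open>\<Delta>\<close> in a line.
\<close>

lemma rotation_zero_on_singular_level:
  assumes M: "sub_riemannian_surface A \<Delta> ori g"
    and F: "adapted_frame A \<Delta> ori g U \<omega> E" and F': "adapted_frame A \<Delta> ori g U' \<omega>' E'"
    and \<eta>: "dual_coframe U E \<eta>" and p: "p \<in> U" "p \<in> U'" and 0: "nonholonomity A \<Delta> ori g \<omega> p = 0"
  shows "\<eta> 2 p (E' 1 p) = 0"
proof -
  note D = adapted_frameD[OF F] and D' = adapted_frameD[OF F']
  have A: "oriented_atlas A" using M by (simp add: sub_riemannian_surface_def)
  have pA: "p \<in> mfd A" using D(2) p by blast
  obtain d where d: "compatible_chart A d" "p \<in> fst d"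
    and sl: "\<And>q. q \<in> fst d \<Longrightarrow> q \<in> U \<Longrightarrow> nonholonomity A \<Delta> ori g \<omega> q = nonholonomity A \<Delta> ori g \<omega> p \<Longrightarrow> snd d q $ 3 = 0"
    by (rule level_slice_chart[OF F p(1)]) (rule that)
  have sl1: "to_chart A d p (E 1 p) $ 3 = 0"
    by (rule adapted_frame_slice(1)[OF M F p(1) d]) (rule sl)
  have sl2: "to_chart A d p (E 2 p) $ 3 \<noteq> 0"
    by (rule adapted_frame_slice(2)[OF M F p(1) d]) (rule sl)
  have od: "open (fst d)" using chart_atlas(1)[OF compatible_atlas[OF d(1)]] by blast
  have z': "nonholonomity A \<Delta> ori g \<omega>' p = 0" using nonholonomity_proportional(3)[OF M F F' p] 0 by simp
  have E1': "to_chart A d p (E' 1 p) $ 3 = 0"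
  proof (rule tangent_slice_zero[OF A pA d D'(10)[OF p(2)]])
    show "open (U \<inter> fst d)" "p \<in> U \<inter> fst d" using od D(1) p d by auto
    fix q assume "q \<in> {q' \<in> U'. nonholonomity A \<Delta> ori g \<omega>' q' = nonholonomity A \<Delta> ori g \<omega>' p} \<inter> (U \<inter> fst d)"
    then have q: "q \<in> U" "q \<in> U'" "q \<in> fst d" "nonholonomity A \<Delta> ori g \<omega>' q = 0" using z' by auto
    then have "nonholonomity A \<Delta> ori g \<omega> q = 0"
      using nonholonomity_proportional(2,3)[OF M F F' q(1,2)] by simp
    then show "snd d q $ 3 = 0" using sl q 0 by simp
  qed
  have lin: "linear (to_chart A d p)" by (rule linear_to_chart_compatible[OF A pA d])
  have "to_chart A d p (\<eta> 1 p (E' 1 p) *\<^sub>R E 1 p + \<eta> 2 p (E' 1 p) *\<^sub>R E 2 p) $ 3 = 0"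
    by (simp only: frame_rotation_coefficients(1)[OF M F F' \<eta> p, symmetric] E1')
  then have "\<eta> 2 p (E' 1 p) * to_chart A d p (E 2 p) $ 3 = 0"
    by (simp add: linear_add[OF lin] linear_cmul[OF lin] sl1)
  with sl2 show ?thesis by simp
qed

lemma conformal_factor_differentiable:
  assumes M: "sub_riemannian_surface A \<Delta> ori g"
    and F: "adapted_frame A \<Delta> ori g U \<omega> E" and F': "adapted_frame A \<Delta> ori g U' \<omega>' E'"
    and p: "p \<in> U" "p \<in> U'" and c: "c \<in> A" "p \<in> fst c"
  shows "((\<lambda>q. \<omega>' q (E 3 q)) \<circ> chart_inv c) differentiable (at (snd c p))"
proof -
  note D = adapted_frameD[OF F] and D' = adapted_frameD[OF F']
  have A: "oriented_atlas A" using M by (simp add: sub_riemannian_surface_def)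
  show ?thesis
  proof (rule form_pairing_differentiable[OF A c, of "U \<inter> U'"])
    show "linear (\<omega>' q)" if "q \<in> U \<inter> U'" for q using D'(4) that by (auto simp: smooth_form_def)
    show "(\<lambda>x. form_rep A c \<omega>' x v) differentiable at (snd c p)" for v
      by (rule form_rep_differentiable[OF D'(4) c(1) p(2) c(2)])
    show "smooth_vf A (U \<inter> U') (E 3)" by (rule smooth_vf_subset[OF D(7)]) simp
  qed (use D(1) D'(1) p in auto)
qed

text \<open>
  From \<open>d\<omega>' = df \<and> \<omega> + f d\<omega>\<close>, evaluated on
  \<open>X\<close> and \<open>E\<^sub>3\<close>, with \<open>\<omega>(X) = 0\<close>,
  \<open>\<omega>(E\<^sub>3) = 1\<close> and \<open>d\<omega>(X, E\<^sub>3) = 0\<close>. It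
  shows that the derivatives of \<open>f = \<omega>'(E\<^sub>3)\<close> along
  \<open>\<Delta>\<close> are again differentiable functions.
\<close>

lemma conformal_factor_derivative:
  assumes M: "sub_riemannian_surface A \<Delta> ori g"
    and F: "adapted_frame A \<Delta> ori g U \<omega> E" and F': "adapted_frame A \<Delta> ori g U' \<omega>' E'"
    and p: "p \<in> U" "p \<in> U'" and c: "c \<in> A" "p \<in> fst c" and X: "\<omega> p X = 0"
  shows "frechet_derivative ((\<lambda>q. \<omega>' q (E 3 q)) \<circ> chart_inv c) (at (snd c p)) (to_chart A c p X) =
    ext_deriv A \<omega>' p X (E 3 p)"
proof -
  note D = adapted_frameD[OF F] and D' = adapted_frameD[OF F']
  have A: "oriented_atlas A" using M by (simp add: sub_riemannian_surface_def)
  have pA: "p \<in> mfd A" using D(2) p by blast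
  define S where "S = snd c ` (U \<inter> U' \<inter> fst c)"
  have S: "open S" "snd c p \<in> S"
    unfolding S_def using open_chart_image[OF A c(1)] D(1) D'(1) p c by auto
  define f where "f = (\<lambda>q. \<omega>' q (E 3 q)) \<circ> chart_inv c"
  have f: "(f has_derivative frechet_derivative f (at (snd c p))) (at (snd c p))"
    using conformal_factor_differentiable[OF M F F' p c] unfolding f_def frechet_derivative_works .
  have multiple: "form_rep A c \<omega>' z v = f z * form_rep A c \<omega> z v" if z: "z \<in> S" for z v
  proof -
    obtain q where q: "z = snd c q" "q \<in> U" "q \<in> U'" "q \<in> fst c" using z by (auto simp: S_def)
    show ?thesis
      unfolding q(1) form_rep_chart[OF A c(1) q(4)] f_def o_apply chart_inv_chart[OF A c(1) q(4)]
      by (rule nonholonomity_proportional(1)[OF M F F' q(2,3)])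
  qed
  have "dform (form_rep A c \<omega>') (snd c p) (to_chart A c p X) (to_chart A c p (E 3 p)) =
     frechet_derivative f (at (snd c p)) (to_chart A c p X) * form_rep A c \<omega> (snd c p) (to_chart A c p (E 3 p))
     - frechet_derivative f (at (snd c p)) (to_chart A c p (E 3 p)) * form_rep A c \<omega> (snd c p) (to_chart A c p X)
     + f (snd c p) * dform (form_rep A c \<omega>) (snd c p) (to_chart A c p X) (to_chart A c p (E 3 p))"
    by (rule dform_scale[OF S form_rep_differentiable[OF D(4) c(1) p(1) c(2)] f multiple])
  moreover have "ext_deriv A \<omega> p X (E 3 p) = 0"
    using ext_deriv_characteristic[OF A pA D(1) p(1) D(4,5)] ext_deriv_skew[of A \<omega> p X] by simp
  ultimately show ?thesis
    using D(11)[OF p(1)] X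
    by (simp add: form_rep_to_chart[OF A c] f_def ext_deriv_to_chart[OF A c D(1) p(1) D(4)]
        ext_deriv_to_chart[OF A c D'(1) p(2) D'(4)])
qed

text \<open>
  The identity \<open>E\<^sub>1' (f \<lambda>) = 0\<close>, expanded with \<open>E\<^sub>1' =
  c E\<^sub>1 + s E\<^sub>2\<close> and \<open>E\<^sub>1 \<lambda> = 0\<close>, where the
  derivatives of \<open>f = \<omega>'(E\<^sub>3)\<close> are written as values of
  \<open>d\<omega>'\<close>.
\<close>

lemma frame_change_identity:
  assumes M: "sub_riemannian_surface A \<Delta> ori g"
    and F: "adapted_frame A \<Delta> ori g U \<omega> E" and F': "adapted_frame A \<Delta> ori g U' \<omega>' E'"
    and \<eta>: "dual_coframe U E \<eta>" and p: "p \<in> U" "p \<in> U'" and c: "c \<in> A" "p \<in> fst c"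
  shows "\<eta> 2 p (E' 1 p) * (\<omega>' p (E 3 p) *
      frechet_derivative (nonholonomity A \<Delta> ori g \<omega> \<circ> chart_inv c) (at (snd c p)) (to_chart A c p (E 2 p))
      + nonholonomity A \<Delta> ori g \<omega> p * ext_deriv A \<omega>' p (E 2 p) (E 3 p)) =
    - (\<eta> 1 p (E' 1 p) * nonholonomity A \<Delta> ori g \<omega> p * ext_deriv A \<omega>' p (E 1 p) (E 3 p))"
proof -
  note D = adapted_frameD[OF F] and D' = adapted_frameD[OF F']
  have A: "oriented_atlas A" using M by (simp add: sub_riemannian_surface_def)
  have pA: "p \<in> mfd A" using D(2) p by blast
  define S where "S = snd c ` (U \<inter> U' \<inter> fst c)"
  have S: "open S" "snd c p \<in> S"
    unfolding S_def using open_chart_image[OF A c(1)] D(1) D'(1) p c by auto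
  define f where "f = (\<lambda>q. \<omega>' q (E 3 q)) \<circ> chart_inv c"
  define L where "L = nonholonomity A \<Delta> ori g \<omega> \<circ> chart_inv c"
  define L' where "L' = nonholonomity A \<Delta> ori g \<omega>' \<circ> chart_inv c"
  define f1 where "f1 = frechet_derivative f (at (snd c p))"
  define L1 where "L1 = frechet_derivative L (at (snd c p))"
  have f: "(f has_derivative f1) (at (snd c p))"
    using conformal_factor_differentiable[OF M F F' p c] unfolding f1_def f_def frechet_derivative_works .
  have L: "(L has_derivative L1) (at (snd c p))"
    using nonholonomity_differentiable[OF M F p(1) c] unfolding L1_def L_def frechet_derivative_works .
  have "(L' has_derivative (\<lambda>h. f (snd c p) * L1 h + f1 h * L (snd c p))) (at (snd c p))"
    by (rule has_derivative_transform_within_open[OF has_derivative_mult[OF f L] S])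
       (auto simp: S_def L'_def L_def f_def chart_inv_chart[OF A c(1)] nonholonomity_proportional(3)[OF M F F'])
  from fun_cong[OF frechet_derivative_at[OF this], of "to_chart A c p (E' 1 p)"]
  have "f (snd c p) * L1 (to_chart A c p (E' 1 p)) + f1 (to_chart A c p (E' 1 p)) * L (snd c p) = 0"
    using nonholonomity_derivative_E1[OF M F' p(2) c] by (simp add: L'_def)
  moreover have "to_chart A c p (E' 1 p) =
      \<eta> 1 p (E' 1 p) *\<^sub>R to_chart A c p (E 1 p) + \<eta> 2 p (E' 1 p) *\<^sub>R to_chart A c p (E 2 p)"
  proof -
    note l = linear_to_chart[OF A c pA]
    have "to_chart A c p (E' 1 p) = to_chart A c p (\<eta> 1 p (E' 1 p) *\<^sub>R E 1 p + \<eta> 2 p (E' 1 p) *\<^sub>R E 2 p)"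
      by (simp only: frame_rotation_coefficients(1)[OF M F F' \<eta> p, symmetric])
    then show ?thesis by (simp add: linear_add[OF l] linear_cmul[OF l])
  qed
  moreover have "L1 (to_chart A c p (E 1 p)) = 0"
    using nonholonomity_derivative_E1[OF M F p(1) c] by (simp add: L1_def L_def)
  moreover have "f1 (to_chart A c p (E 1 p)) = ext_deriv A \<omega>' p (E 1 p) (E 3 p)"
    "f1 (to_chart A c p (E 2 p)) = ext_deriv A \<omega>' p (E 2 p) (E 3 p)"
    using conformal_factor_derivative[OF M F F' p c] D(11)[OF p(1)] by (simp_all add: f1_def f_def)
  moreover have "f (snd c p) = \<omega>' p (E 3 p)" "L (snd c p) = nonholonomity A \<Delta> ori g \<omega> p"
    by (simp_all add: f_def L_def chart_inv_chart[OF A c])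
  moreover note linear_add[OF has_derivative_linear[OF f]] linear_cmul[OF has_derivative_linear[OF f]]
    linear_add[OF has_derivative_linear[OF L]] linear_cmul[OF has_derivative_linear[OF L]]
  ultimately show ?thesis by (simp add: algebra_simps flip: L_def L1_def)
qed

text \<open>
  Because \<open>d\<omega>(E\<^sub>3, \<cdot>) = 0\<close>, the form \<open>d\<omega>\<close>
  is determined by \<open>d\<omega>(E\<^sub>1, E\<^sub>2) = - \<lambda>\<close>.
\<close>

lemma ext_deriv_zero_singular:
  assumes M: "sub_riemannian_surface A \<Delta> ori g" and F: "adapted_frame A \<Delta> ori g U \<omega> E"
    and p: "p \<in> U" and 0: "nonholonomity A \<Delta> ori g \<omega> p = 0"
  shows "ext_deriv A \<omega> p u v = 0"
proof -
  note D = adapted_frameD[OF F]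
  have A: "oriented_atlas A" using M by (simp add: sub_riemannian_surface_def)
  have pA: "p \<in> mfd A" using D(2) p by blast
  have \<Delta>: "subspace (\<Delta> p)" "dim (\<Delta> p) = 2" "plane_orientation (\<Delta> p) (ori p)"
    using M pA by (auto simp: sub_riemannian_surface_def oriented_distribution_def)
  have pos: "ori p (E 1 p) (E 2 p)" using D(6) p by (auto simp: oriented_orthonormal_frame_def)
  note r = linear_ext_deriv_right[OF A pA D(1) p D(4)]
  have E3: "ext_deriv A \<omega> p (E 3 p) w = 0" "ext_deriv A \<omega> p w (E 3 p) = 0" for w
    using ext_deriv_characteristic[OF A pA D(1) p D(4,5)] ext_deriv_skew[of A \<omega> p w] by simp_all
  have E12: "ext_deriv A \<omega> p (E 1 p) (E 2 p) = 0" "ext_deriv A \<omega> p (E 2 p) (E 1 p) = 0"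
    using nonholonomity_eq(2)[OF M D(1) p D(2,3,1) p D(2,6)] 0 ext_deriv_skew[of A \<omega> p "E 2 p"] by simp_all
  have exp: "\<exists>a b c. w = a *\<^sub>R E 1 p + b *\<^sub>R E 2 p + c *\<^sub>R E 3 p" for w
  proof -
    have lin: "linear (\<omega> p)" using D(4) p by (auto simp: smooth_form_def)
    have "\<omega> p (w - \<omega> p w *\<^sub>R E 3 p) = 0"
      using D(11)[OF p] by (simp add: linear_diff[OF lin] linear_cmul[OF lin])
    then have "w - \<omega> p w *\<^sub>R E 3 p \<in> \<Delta> p" using ann_section_kernel[OF D(3) p \<Delta>(1,2)] by blast
    from positive_basis_expansion[OF \<Delta>(3) pos this] obtain a b where
      "w - \<omega> p w *\<^sub>R E 3 p = a *\<^sub>R E 1 p + b *\<^sub>R E 2 p" .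
    then have "w = a *\<^sub>R E 1 p + b *\<^sub>R E 2 p + \<omega> p w *\<^sub>R E 3 p" by (simp add: algebra_simps)
    then show ?thesis by blast
  qed
  have 1: "ext_deriv A \<omega> p (E 1 p) w = 0" "ext_deriv A \<omega> p (E 2 p) w = 0" for w
    using exp[of w] E3 E12 by (auto simp: linear_add[OF r] linear_cmul[OF r])
  obtain a b c where v: "v = a *\<^sub>R E 1 p + b *\<^sub>R E 2 p + c *\<^sub>R E 3 p" using exp[of v] by blast
  have "ext_deriv A \<omega> p u (E 1 p) = 0" "ext_deriv A \<omega> p u (E 2 p) = 0"
    using 1 ext_deriv_skew[of A \<omega> p u] by simp_all
  then show ?thesis using E3 unfolding v by (simp add: linear_add[OF r] linear_cmul[OF r])
qed

section \<open>Rotation of the frame at singular points\<close>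

text \<open>
  The derivative of \<open>s\<close> is computed in a chart \<open>c\<close> whose slices lie
  in the level sets of \<open>\<lambda>\<close>. Along the slice through \<open>q\<close> the
  function \<open>s\<close> vanishes identically. Along the coordinate line transversal to the
  slices the identity for \<open>s\<close> meets the hypotheses of
  \<open>quotient_derivative_zero\<close>; there \<open>E\<^sub>2 \<lambda>\<close> is the
  derivative of \<open>\<lambda>\<close> on the line times the slice component
  \<open>b\<close> of \<open>E\<^sub>2\<close>. A second chart \<open>d\<close>, in which the
  level set of \<open>q\<close> is a single slice, shows that \<open>b q \<noteq> 0\<close>
  and that the line leaves the level set.
\<close>

lemma rotation_derivative_zero:
  assumes M: "sub_riemannian_surface A \<Delta> ori g"
    and F: "adapted_frame A \<Delta> ori g U \<omega> E" and F': "adapted_frame A \<Delta> ori g U' \<omega>' E'"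
    and \<eta>: "dual_coframe U E \<eta>" and q: "q \<in> U" "q \<in> U'" and 0: "nonholonomity A \<Delta> ori g \<omega> q = 0"
    and c0: "c0 = chart_at A q"
  shows "(((\<lambda>p. \<eta> 2 p (E' 1 p)) \<circ> chart_inv c0) has_derivative (\<lambda>v. 0)) (at (snd c0 q))"
proof -
  note D = adapted_frameD[OF F] and D' = adapted_frameD[OF F']
  have A: "oriented_atlas A" using M by (simp add: sub_riemannian_surface_def)
  have qA: "q \<in> mfd A" using D(2) q by blast
  have c0A: "c0 \<in> A" "q \<in> fst c0" using chart_at_mem[OF qA] by (simp_all add: c0)
  define lam where "lam = nonholonomity A \<Delta> ori g \<omega>"
  define f where "f p = \<omega>' p (E 3 p)" for p
  define s where "s p = \<eta> 2 p (E' 1 p)" for p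
  define cc where "cc p = \<eta> 1 p (E' 1 p)" for p
  define k where "k p = ext_deriv A \<omega>' p (E 2 p) (E 3 p)" for p
  define r where "r p = ext_deriv A \<omega>' p (E 1 p) (E 3 p)" for p
  have lamq: "lam q = 0" using 0 by (simp add: lam_def)
  define N where "N = U \<inter> U'"
  have N: "open N" "q \<in> N" "N \<subseteq> U" "N \<subseteq> U'" using D(1) D'(1) q by (auto simp: N_def)
  obtain c where c: "compatible_chart A c" "q \<in> fst c" "fst c \<subseteq> U"
    and slice: "\<And>x y. x \<in> fst c \<Longrightarrow> y \<in> fst c \<Longrightarrow> snd c x $ 3 = snd c y $ 3 \<Longrightarrow> lam x = lam y"
    using D(8) q(1) unfolding foliated_by_levels_def lam_def by blast
  obtain d where d: "compatible_chart A d" "q \<in> fst d"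
    and dlev: "\<And>p. p \<in> fst d \<Longrightarrow> p \<in> U \<Longrightarrow> lam p = lam q \<Longrightarrow> snd d p $ 3 = 0"
    by (rule level_slice_chart[OF F q(1), folded lam_def]) (rule that)
  have oB: "oriented_atlas (insert c A)" "c \<in> insert c A" "c0 \<in> insert c A"
    using compatible_atlas[OF c(1)] c0A by auto
  have oD: "oriented_atlas (insert d A)" "d \<in> insert d A" "c0 \<in> insert d A"
    using compatible_atlas[OF d(1)] c0A by auto
  define x0 where "x0 = snd c q"
  define e3 :: "real^3" where "e3 = axis 3 1"
  have e3: "norm e3 = 1" "e3 $ 3 = 1" by (simp_all add: e3_def norm_axis_1)
  have "open (N \<inter> fst c0 \<inter> fst d)" "q \<in> N \<inter> fst c0 \<inter> fst d"
    using N chart_atlas(1)[OF A c0A(1)] chart_atlas(1)[OF oD(1,2)] c0A d by auto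
  from chart_image_ball[OF oB(1,2) this c(2)] obtain R where R: "R > 0"
    and Rx: "\<And>x. norm (x - x0) < R \<Longrightarrow> \<exists>p\<in>(N \<inter> fst c0 \<inter> fst d) \<inter> fst c. x = snd c p"
    unfolding x0_def by blast
  have pt: "chart_inv c x \<in> N" "chart_inv c x \<in> fst c0" "chart_inv c x \<in> fst d" "chart_inv c x \<in> fst c"
    "snd c (chart_inv c x) = x" if "norm (x - x0) < R" for x
    using Rx[OF that] chart_inv_chart[OF oB(1,2)] by auto
  have inv0: "chart_inv c x0 = q" using chart_inv_chart[OF oB(1,2) c(2)] by (simp add: x0_def)
  define J where "J x = frechet_derivative (transition c c0) (at x)" for x
  define I where "I p = frechet_derivative (transition c0 c) (at (snd c0 p))" for p
  have JI: "J (snd c p) (I p v) = v" if "p \<in> fst c" "p \<in> fst c0" for p v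
    unfolding J_def I_def by (rule transition_derivative_inverse[OF oB(1,3,2) that(2,1)])
  have to_c: "((G \<circ> chart_inv c) has_derivative (\<lambda>v. frechet_derivative (G \<circ> chart_inv c0) (at (snd c0 p)) (J (snd c p) v))) (at (snd c p))"
    if "p \<in> fst c" "p \<in> fst c0" "(G \<circ> chart_inv c0) differentiable (at (snd c0 p))" for G :: "'a \<Rightarrow> real" and p
    unfolding J_def
    by (rule has_derivative_change_chart[OF oB(1,2,3) that(1,2) that(3)[unfolded frechet_derivative_works]])

  have lam_d: "(lam \<circ> chart_inv c0) differentiable (at (snd c0 p))" if "p \<in> N" "p \<in> fst c0" for p
    unfolding lam_def by (rule nonholonomity_differentiable[OF M F _ c0A(1) that(2)]) (use that N in auto)
  have f_d: "(f \<circ> chart_inv c0) differentiable (at (snd c0 q))"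
    using conformal_factor_differentiable[OF M F F' q c0A] by (simp add: f_def[abs_def])
  have EN: "smooth_vf A N (E a)" "smooth_vf A N (E' a)" for a
    using smooth_vf_subset[OF D(7) N(3)] smooth_vf_subset[OF D'(7) N(4)] by blast+
  have wN: "smooth_form A N \<omega>'" by (rule smooth_form_subset[OF D'(4) N(4)])
  have k_d: "(k \<circ> chart_inv c0) differentiable (at (snd c0 q))"
    using ext_deriv_differentiable[OF A c0A N(1,2) wN EN(1) EN(1), of 2 3] by (simp add: k_def[abs_def])
  have r_d: "(r \<circ> chart_inv c0) differentiable (at (snd c0 q))"
    using ext_deriv_differentiable[OF A c0A N(1,2) wN EN(1) EN(1), of 1 3] by (simp add: r_def[abs_def])
  have s_d: "(s \<circ> chart_inv c0) differentiable (at (snd c0 q))"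
    unfolding s_def[abs_def]
  proof (rule form_pairing_differentiable[OF A c0A N(1,2)])
    show "linear (\<eta> 2 p)" if "p \<in> N" for p using \<eta> that N by (auto simp: dual_coframe_def)
    show "(\<lambda>x. form_rep A c0 (\<eta> 2) x v) differentiable at (snd c0 q)" for v
      by (rule dual_coframe_differentiable[OF A c0A D(1) q(1) \<eta> D(7)])
  qed (rule EN(2))

  \<comment> \<open>The component of \<open>E\<^sub>2\<close> transversal to the slices of \<open>c\<close>.\<close>
  define b where "b p = I p (to_chart A c0 p (E 2 p)) $ 3" for p
  have b_d: "(b \<circ> chart_inv c0) differentiable (at (snd c0 q))"
  proof -
    define S where "S = snd c0 ` (N \<inter> fst c \<inter> fst c0)"
    have "open (N \<inter> fst c)" using N chart_atlas(1)[OF oB(1,2)] by auto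
    then have S: "open S" "snd c0 q \<in> S"
      unfolding S_def using open_chart_image[OF A c0A(1)] N c c0A by auto
    have "(\<lambda>z. frechet_derivative (transition c0 c) (at z) (vf_rep A c0 (E 2) z)) differentiable (at (snd c0 q))"
    proof (rule differentiable_pairing[OF S, where w = "\<lambda>z. frechet_derivative (transition c0 c) (at z)"])
      show "linear (frechet_derivative (transition c0 c) (at z))" if "z \<in> S" for z
        using that linear_transition[OF oB(1,3,2)] by (auto simp: S_def)
      show "(\<lambda>z. frechet_derivative (transition c0 c) (at z) v) differentiable (at (snd c0 q))" for v
        by (rule smooth_on_differentiable[OF smooth_on_frechet_derivative[OF transition_smooth[OF oB(1,3,2)]]])
          (use c0A c in auto)
      show "vf_rep A c0 (E 2) differentiable at (snd c0 q)"
        by (rule vf_rep_differentiable[OF D(7) c0A(1) q(1) c0A(2)])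
    qed
    then have "(\<lambda>z. frechet_derivative (transition c0 c) (at z) (vf_rep A c0 (E 2) z) $ 3) differentiable (at (snd c0 q))"
      unfolding differentiable_def by (auto intro: bounded_linear.has_derivative[OF bounded_linear_vec_nth])
    then show ?thesis
      by (rule differentiable_transform_open[OF _ S])
        (auto simp: S_def b_def I_def vf_rep_chart[OF A c0A(1)] chart_inv_chart[OF A c0A(1)])
  qed

  \<comment> \<open>The slice of \<open>c\<close> through \<open>q\<close> lies in the level set, where \<open>H\<close> vanishes; so the differential of
    \<open>H\<close> at \<open>q\<close> is a multiple of the differential of the slice coordinate of \<open>c\<close>.\<close>
  define H where "H p = snd d p $ 3" for p
  define H' where "H' v = frechet_derivative (transition c0 d) (at (snd c0 q)) v $ 3" for v
  have H: "((H \<circ> chart_inv c0) has_derivative H') (at (snd c0 q))"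
  proof -
    have "((\<lambda>x. transition c0 d x $ 3) has_derivative H') (at (snd c0 q))"
      unfolding H'_def
      by (rule bounded_linear.has_derivative[OF bounded_linear_vec_nth transition_has_derivative[OF oD(1,3,2) c0A(2) d(2)]])
    then show ?thesis by (simp add: H_def[abs_def] transition_def o_def)
  qed
  have Hc: "((H \<circ> chart_inv c) has_derivative (\<lambda>v. H' (J x0 v))) (at x0)"
    unfolding J_def x0_def by (rule has_derivative_change_chart[OF oB(1,2,3) c(2) c0A(2) H])
  have linH: "linear (\<lambda>v. H' (J x0 v))" using has_derivative_linear[OF Hc] .
  have flat: "lam (chart_inv c (x + t *\<^sub>R v)) = lam (chart_inv c x)"
    if "v $ 3 = 0" "norm (x - x0) < R" "norm (x + t *\<^sub>R v - x0) < R" for x t v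
    by (rule slice) (use that pt in auto)
  have near: "norm (x + t *\<^sub>R v - x0) < R" if "\<bar>t\<bar> < (R - norm (x - x0)) / (norm v + 1)" for x t v
  proof -
    have "x + t *\<^sub>R v - x0 = (x - x0) + t *\<^sub>R v" by simp
    then have "norm (x + t *\<^sub>R v - x0) \<le> norm (x - x0) + \<bar>t\<bar> * norm v"
      by (metis norm_scaleR norm_triangle_ineq)
    also have "\<bar>t\<bar> * norm v \<le> \<bar>t\<bar> * (norm v + 1)" by (intro mult_left_mono) auto
    also have "\<bar>t\<bar> * (norm v + 1) < R - norm (x - x0)"
      using that by (simp add: pos_less_divide_eq add_nonneg_pos)
    finally show ?thesis by simp
  qed
  have nearp: "(R - norm (x - x0)) / (norm v + 1) > 0" if "norm (x - x0) < R" for x and v :: "real^3"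
    using that by (intro divide_pos_pos) (auto simp: add_nonneg_pos)
  have H0: "H' (J x0 v) = 0" if v: "v $ 3 = 0" for v
  proof (rule derivative_zero_along_constant_line[OF Hc nearp[of x0 v]])
    fix t assume t: "\<bar>t\<bar> < (R - norm (x0 - x0)) / (norm v + 1)"
    have 1: "norm (x0 + t *\<^sub>R v - x0) < R" by (rule near[OF t])
    have "lam (chart_inv c (x0 + t *\<^sub>R v)) = lam q" using flat[OF v _ 1] R inv0 by simp
    then have "H (chart_inv c (x0 + t *\<^sub>R v)) = 0"
      unfolding H_def using pt[OF 1] N by (intro dlev) auto
    moreover have "H q = 0" unfolding H_def using d q by (intro dlev) auto
    ultimately show "(H \<circ> chart_inv c) (x0 + t *\<^sub>R v) = (H \<circ> chart_inv c) x0" by (simp add: inv0)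
  qed (use R in simp)
  have H3: "H' (J x0 v) = v $ 3 * H' (J x0 e3)" for v
  proof -
    have "H' (J x0 (v - (v $ 3) *\<^sub>R e3)) = 0" by (rule H0) (simp add: e3)
    then show ?thesis using linear_diff[OF linH] linear_cmul[OF linH] by simp
  qed
  have "H' (E 2 q) \<noteq> 0"
  proof -
    have "to_chart A d q (E 2 q) $ 3 \<noteq> 0"
      by (rule adapted_frame_slice(2)[OF M F q(1) d]) (use dlev in \<open>simp add: lam_def\<close>)
    then show ?thesis by (simp add: H'_def to_chart_def coord_at_def c0)
  qed
  moreover have "H' (E 2 q) = b q * H' (J x0 e3)"
    using H3[of "I q (E 2 q)"] JI[OF c(2) c0A(2), of "E 2 q"] to_chart_chart_at[OF A qA]
    by (simp add: b_def x0_def c0)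
  ultimately have bq: "b q \<noteq> 0" and He3: "H' (J x0 e3) \<noteq> 0" by auto

  \<comment> \<open>The curve \<open>\<zeta>\<close> is the coordinate line of \<open>c\<close> transversal to the slices.\<close>
  define \<zeta> where "\<zeta> t = chart_inv c (x0 + t *\<^sub>R e3)" for t
  have \<zeta>0: "\<zeta> 0 = q" by (simp add: \<zeta>_def inv0)
  have line: "norm (x0 + t *\<^sub>R e3 - x0) < R" if "\<bar>t\<bar> < R" for t using that e3 by simp
  have \<zeta>: "\<zeta> t \<in> N" "\<zeta> t \<in> fst c0" "\<zeta> t \<in> fst c" "snd c (\<zeta> t) = x0 + t *\<^sub>R e3" if "\<bar>t\<bar> < R" for t
    unfolding \<zeta>_def using pt[OF line[OF that]] by auto
  have line_d: "((\<lambda>t. G (\<zeta> t)) has_real_derivative frechet_derivative (G \<circ> chart_inv c0) (at (snd c0 (\<zeta> t))) (J (x0 + t *\<^sub>R e3) e3)) (at t)"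
    if "\<bar>t\<bar> < R" "(G \<circ> chart_inv c0) differentiable (at (snd c0 (\<zeta> t)))" for G :: "'a \<Rightarrow> real" and t
    using derivative_along_line[OF to_c[OF \<zeta>(3,2)[OF that(1)] that(2), unfolded \<zeta>(4)[OF that(1)]]]
    by (simp add: \<zeta>_def)
  define h' where "h' t = frechet_derivative (lam \<circ> chart_inv c0) (at (snd c0 (\<zeta> t))) (J (x0 + t *\<^sub>R e3) e3)" for t
  have h': "((\<lambda>t. lam (\<zeta> t)) has_real_derivative h' t) (at t)" if "\<bar>t\<bar> < R" for t
    unfolding h'_def by (rule line_d[OF that lam_d[OF \<zeta>(1,2)[OF that]]])
  have lamE2: "frechet_derivative (lam \<circ> chart_inv c0) (at (snd c0 (\<zeta> t))) (to_chart A c0 (\<zeta> t) (E 2 (\<zeta> t))) = b (\<zeta> t) * h' t"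
    if t: "\<bar>t\<bar> < R" for t
  proof -
    define x where "x = x0 + t *\<^sub>R e3"
    define l where "l v = frechet_derivative (lam \<circ> chart_inv c0) (at (snd c0 (\<zeta> t))) (J x v)" for v
    have l: "((lam \<circ> chart_inv c) has_derivative l) (at x)"
      using to_c[OF \<zeta>(3,2)[OF t] lam_d[OF \<zeta>(1,2)[OF t]]] by (simp add: \<zeta>(4)[OF t] l_def[abs_def] x_def)
    have xR: "norm (x - x0) < R" unfolding x_def by (rule line[OF t])
    have l0: "l v = 0" if v: "v $ 3 = 0" for v
    proof (rule derivative_zero_along_constant_line[OF l nearp[OF xR, of v]])
      fix t assume t: "\<bar>t\<bar> < (R - norm (x - x0)) / (norm v + 1)"
      show "(lam \<circ> chart_inv c) (x + t *\<^sub>R v) = (lam \<circ> chart_inv c) x"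
        using flat[OF v xR near[OF t]] by simp
    qed
    define v where "v = I (\<zeta> t) (to_chart A c0 (\<zeta> t) (E 2 (\<zeta> t)))"
    have ll: "linear l" using has_derivative_linear[OF l] .
    have "l (v - (v $ 3) *\<^sub>R e3) = 0" by (rule l0) (simp add: e3)
    then have "l v = v $ 3 * l e3" using linear_diff[OF ll] linear_cmul[OF ll] by simp
    moreover have "J x v = to_chart A c0 (\<zeta> t) (E 2 (\<zeta> t))"
      using JI[OF \<zeta>(3,2)[OF t]] by (simp add: v_def x_def \<zeta>(4)[OF t])
    ultimately show ?thesis by (simp add: l_def b_def v_def h'_def x_def)
  qed
  obtain \<epsilon> where \<epsilon>: "\<epsilon> > 0" and lam_nz: "\<And>t. 0 < t \<Longrightarrow> t < \<epsilon> \<Longrightarrow> \<bar>t\<bar> < R \<Longrightarrow> lam (\<zeta> t) \<noteq> 0"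
  proof -
    have "((\<lambda>t. (H \<circ> chart_inv c) (x0 + t *\<^sub>R e3)) has_real_derivative H' (J x0 e3)) (at 0)"
      using derivative_along_line[of "H \<circ> chart_inv c" _ x0 0 e3] Hc by simp
    then have "((\<lambda>t. (H (\<zeta> t) - H q) / t) \<longlongrightarrow> H' (J x0 e3)) (at 0)"
      unfolding has_field_derivative_iff by (simp add: \<zeta>_def inv0)
    moreover have "H q = 0" unfolding H_def using d q by (intro dlev) auto
    ultimately have "((\<lambda>t. H (\<zeta> t) / t) \<longlongrightarrow> H' (J x0 e3)) (at_right 0)"
      by (auto intro: tendsto_mono[OF at_le])
    then have "\<forall>\<^sub>F t in at_right 0. H (\<zeta> t) / t \<noteq> 0" using He3 by (rule tendsto_imp_eventually_ne)
    then obtain \<epsilon> where \<epsilon>: "\<epsilon> > 0" and ne: "\<And>t. 0 < t \<Longrightarrow> t < \<epsilon> \<Longrightarrow> H (\<zeta> t) / t \<noteq> 0"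
      unfolding eventually_at_right_field by auto
    show ?thesis
    proof (rule that[OF \<epsilon>])
      fix t assume t: "0 < t" "t < \<epsilon>" "\<bar>t\<bar> < R"
      show "lam (\<zeta> t) \<noteq> 0"
      proof
        assume "lam (\<zeta> t) = 0"
        then have "H (\<zeta> t) = 0" unfolding H_def
          using pt[OF line[OF t(3)]] N lamq by (intro dlev) (auto simp: \<zeta>_def)
        then show False using ne[OF t(1,2)] by simp
      qed
    qed
  qed
  have cont: "((\<lambda>t. G (\<zeta> t)) \<longlongrightarrow> G q) (at_right 0)"
    if "(G \<circ> chart_inv c0) differentiable (at (snd c0 q))" for G :: "'a \<Rightarrow> real"
  proof -
    have "isCont (\<lambda>t. G (\<zeta> t)) 0"
      by (rule DERIV_isCont[OF line_d]) (use R that in \<open>simp_all add: \<zeta>0\<close>)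
    then have "((\<lambda>t. G (\<zeta> t)) \<longlongrightarrow> G q) (at 0)" by (simp add: isCont_def \<zeta>0)
    then show ?thesis by (rule tendsto_mono[OF at_le, rotated]) simp
  qed
  have sq: "s q = 0" unfolding s_def by (rule rotation_zero_on_singular_level[OF M F F' \<eta> q 0])
  have rq: "r q = 0" unfolding r_def
    by (rule ext_deriv_zero_singular[OF M F' q(2)]) (simp add: nonholonomity_proportional(3)[OF M F F' q] 0)
  define G' where "G' v = frechet_derivative (s \<circ> chart_inv c0) (at (snd c0 q)) (J x0 v)" for v
  have sG: "((s \<circ> chart_inv c) has_derivative G') (at x0)"
    using to_c[OF c(2) c0A(2) s_d] by (simp add: G'_def[abs_def] x0_def)
  have Ge3: "G' e3 = 0"
  proof (rule quotient_derivative_zero[where s = "\<lambda>t. s (\<zeta> t)" and r = "\<lambda>t. r (\<zeta> t)" and h = "\<lambda>t. lam (\<zeta> t)"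
        and F = "\<lambda>t. f (\<zeta> t) * b (\<zeta> t)" and k = "\<lambda>t. k (\<zeta> t)" and a = "\<lambda>t. cc (\<zeta> t)" and e = "min \<epsilon> R" and h' = h'])
    show "((\<lambda>t. s (\<zeta> t)) has_real_derivative G' e3) (at 0)"
      using line_d[of 0 s] R s_d by (simp add: \<zeta>0 G'_def)
    show "((\<lambda>t. r (\<zeta> t)) has_real_derivative frechet_derivative (r \<circ> chart_inv c0) (at (snd c0 q)) (J x0 e3)) (at 0)"
      using line_d[of 0 r] R r_d by (simp add: \<zeta>0)
    show "((\<lambda>t. lam (\<zeta> t)) \<longlongrightarrow> 0) (at_right 0)"
      using cont[OF lam_d[OF N(2) c0A(2)]] by (simp add: lamq)
    show "((\<lambda>t. f (\<zeta> t) * b (\<zeta> t)) \<longlongrightarrow> f q * b q) (at_right 0)"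
      by (intro tendsto_mult cont f_d b_d)
    show "f q * b q \<noteq> 0" using bq nonholonomity_proportional(2)[OF M F F' q] by (simp add: f_def)
    show "((\<lambda>t. k (\<zeta> t)) \<longlongrightarrow> k q) (at_right 0)" by (rule cont[OF k_d])
    show "0 < min \<epsilon> R" using \<epsilon> R by simp
    fix t assume t: "0 < t" "t < min \<epsilon> R"
    then have tR: "\<bar>t\<bar> < R" by simp
    show "lam (\<zeta> t) \<noteq> 0" using lam_nz t by simp
    show "((\<lambda>t. lam (\<zeta> t)) has_real_derivative h' t) (at t)" by (rule h'[OF tR])
    have \<zeta>U: "\<zeta> t \<in> U" "\<zeta> t \<in> U'" using \<zeta>(1)[OF tR] by (auto simp: N_def)
    show "\<bar>cc (\<zeta> t)\<bar> \<le> 1"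
    proof -
      have "(cc (\<zeta> t))\<^sup>2 + (s (\<zeta> t))\<^sup>2 = 1"
        using frame_rotation_coefficients(3)[OF M F F' \<eta> \<zeta>U] by (simp add: cc_def s_def)
      then have "(cc (\<zeta> t))\<^sup>2 \<le> 1" by (metis le_add_same_cancel1 zero_le_power2)
      then show ?thesis by (simp add: abs_square_le_1)
    qed
    show "s (\<zeta> t) * (f (\<zeta> t) * b (\<zeta> t) * h' t + lam (\<zeta> t) * k (\<zeta> t)) = - (cc (\<zeta> t) * lam (\<zeta> t) * r (\<zeta> t))"
      using frame_change_identity[OF M F F' \<eta> \<zeta>U c0A(1) \<zeta>(2)[OF tR]]
      by (simp add: lamE2[OF tR] mult.assoc flip: lam_def s_def f_def k_def r_def cc_def)
  qed (simp_all add: \<zeta>0 sq rq)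
  have G0: "G' v = 0" if v: "v $ 3 = 0" for v
  proof (rule derivative_zero_along_constant_line[OF sG nearp[of x0 v]])
    fix t assume t: "\<bar>t\<bar> < (R - norm (x0 - x0)) / (norm v + 1)"
    have 1: "norm (x0 + t *\<^sub>R v - x0) < R" by (rule near[OF t])
    have "lam (chart_inv c (x0 + t *\<^sub>R v)) = 0" using flat[OF v _ 1] R inv0 lamq by simp
    then have "s (chart_inv c (x0 + t *\<^sub>R v)) = 0"
      unfolding s_def lam_def using pt[OF 1] by (intro rotation_zero_on_singular_level[OF M F F' \<eta>]) (auto simp: N_def)
    then show "(s \<circ> chart_inv c) (x0 + t *\<^sub>R v) = (s \<circ> chart_inv c) x0" by (simp add: inv0 sq)
  qed (use R in simp)
  have lG: "linear G'" using has_derivative_linear[OF sG] .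
  have G'0: "G' = (\<lambda>v. 0)"
  proof
    fix v
    have "G' (v - (v $ 3) *\<^sub>R e3) = 0" by (rule G0) (simp add: e3)
    then show "G' v = 0" using linear_diff[OF lG] linear_cmul[OF lG] Ge3 by simp
  qed
  have "((s \<circ> chart_inv c) has_derivative (\<lambda>v. 0)) (at (snd c q))"
    using sG unfolding G'0 x0_def .
  from has_derivative_change_chart[OF oB(1,3,2) c0A(2) c(2) this]
  show ?thesis by (simp add: s_def[abs_def])
qed

section \<open>Structure functions on the singular set\<close>

text \<open>
  The coframe is not given as smooth, but its components are differentiable by Cramer's rule,
  so that Cartan's formula applies to it.
\<close>

lemma structure_coefficient_eq_bracket:
  assumes A: "oriented_atlas A" and F: "adapted_frame A \<Delta> ori g U \<omega> E" and \<eta>: "dual_coframe U E \<eta>"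
    and C: "structure_equations A U \<eta> C" and q: "q \<in> U"
  shows "C a 1 2 q = - \<eta> a q (lie_bracket A (E 1) (E 2) q)"
proof -
  note D = adapted_frameD[OF F]
  have qA: "q \<in> mfd A" using D(2) q by blast
  note c0 = chart_at_mem[OF qA]
  have dual: "\<eta> b p (E e p) = (if b = e then 1 else 0)" "linear (\<eta> b p)" if "p \<in> U" for b e p
    using \<eta> that by (auto simp: dual_coframe_def)
  have "ext_deriv A (\<eta> a) q (E 1 q) (E 2 q) = C a 1 2 q"
    using C q unfolding structure_equations_def by (simp add: wedge11_def dual(1))
  moreover have "ext_deriv A (\<eta> a) q (E 1 q) (E 2 q) = - \<eta> a q (lie_bracket A (E 1) (E 2) q)"
  proof (rule ext_deriv_eq_bracket[OF A qA D(1) q dual(2) _ D(7) _ D(7)])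
    show "(\<lambda>x. form_rep A (chart_at A q) (\<eta> a) x v) differentiable at (coord_at A q)" for v
      unfolding coord_at_def by (rule dual_coframe_differentiable[OF A c0 D(1) q \<eta> D(7)])
  qed (auto simp: dual(1))
  ultimately show ?thesis by simp
qed

lemma adapted_frames_same_bracket:
  assumes M: "sub_riemannian_surface A \<Delta> ori g"
    and F: "adapted_frame A \<Delta> ori g U \<omega> E" and F': "adapted_frame A \<Delta> ori g U' \<omega>' E'"
    and \<eta>: "dual_coframe U E \<eta>" and q: "q \<in> U" "q \<in> U'" and 0: "nonholonomity A \<Delta> ori g \<omega> q = 0"
  shows "lie_bracket A (E' 1) (E' 2) q = lie_bracket A (E 1) (E 2) q"
proof -
  note D = adapted_frameD[OF F] and D' = adapted_frameD[OF F']
  have A: "oriented_atlas A" using M by (simp add: sub_riemannian_surface_def)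
  have qA: "q \<in> mfd A" using D(2) q by blast
  define c where "c = chart_at A q"
  have c: "c \<in> A" "q \<in> fst c" using chart_at_mem[OF qA] by (simp_all add: c_def)
  define S where "S = snd c ` (U \<inter> U' \<inter> fst c)"
  have S: "open S" "snd c q \<in> S"
    unfolding S_def using open_chart_image[OF A c(1)] D(1) D'(1) q c by auto
  define a where "a = (\<lambda>p. \<eta> 1 p (E' 1 p)) \<circ> chart_inv c"
  define b where "b = (\<lambda>p. \<eta> 2 p (E' 1 p)) \<circ> chart_inv c"
  have ab: "a (snd c p) = \<eta> 1 p (E' 1 p)" "b (snd c p) = \<eta> 2 p (E' 1 p)" if "p \<in> fst c" for p
    using that by (simp_all add: a_def b_def chart_inv_chart[OF A c(1)])
  have b': "(b has_derivative (\<lambda>v. 0)) (at (snd c q))"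
    unfolding b_def by (rule rotation_derivative_zero[OF M F F' \<eta> q 0 c_def])
  have b0: "b (snd c q) = 0" using rotation_zero_on_singular_level[OF M F F' \<eta> q 0] by (simp add: ab c)
  have ab1: "(a z)\<^sup>2 + (b z)\<^sup>2 = 1" if "z \<in> S" for z
    using that frame_rotation_coefficients(3)[OF M F F' \<eta>] by (auto simp: S_def ab)
  then have a1: "(a (snd c q))\<^sup>2 = 1" using b0 S by fastforce
  have "a differentiable (at (snd c q))"
    unfolding a_def
  proof (rule form_pairing_differentiable[OF A c, of "U \<inter> U'"])
    show "linear (\<eta> 1 p)" if "p \<in> U \<inter> U'" for p using \<eta> that by (auto simp: dual_coframe_def)
    show "(\<lambda>x. form_rep A c (\<eta> 1) x v) differentiable at (snd c q)" for v
      by (rule dual_coframe_differentiable[OF A c D(1) q(1) \<eta> D(7)])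
    show "smooth_vf A (U \<inter> U') (E' 1)" by (rule smooth_vf_subset[OF D'(7)]) simp
  qed (use D(1) D'(1) q in auto)
  then obtain a' where a': "(a has_derivative a') (at (snd c q))" unfolding differentiable_def by blast
  have "((\<lambda>z. (a z)\<^sup>2 + (b z)\<^sup>2) has_derivative (\<lambda>v. 2 * a (snd c q) * a' v)) (at (snd c q))"
    using a' b' by (auto intro!: derivative_eq_intros simp: b0)
  moreover have "((\<lambda>z. (a z)\<^sup>2 + (b z)\<^sup>2) has_derivative (\<lambda>v. 0)) (at (snd c q))"
    by (rule has_derivative_transform_within_open[OF has_derivative_const[of 1] S]) (simp add: ab1)
  ultimately have "(\<lambda>v. 2 * a (snd c q) * a' v) = (\<lambda>v. 0)" by (rule has_derivative_unique)
  moreover have "a (snd c q) \<noteq> 0" using a1 by auto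
  ultimately have "a' = (\<lambda>v. 0)" by (simp add: fun_eq_iff)
  with a' have a'0: "(a has_derivative (\<lambda>v. 0)) (at (snd c q))" by simp
  let ?X = "\<lambda>i. vf_rep A c (E i)" and ?X' = "\<lambda>i. vf_rep A c (E' i)"
  have rot: "?X' 1 z = a z *\<^sub>R ?X 1 z + b z *\<^sub>R ?X 2 z \<and> ?X' 2 z = - b z *\<^sub>R ?X 1 z + a z *\<^sub>R ?X 2 z"
    if z: "z \<in> S" for z
  proof -
    obtain p where p: "z = snd c p" "p \<in> U" "p \<in> U'" "p \<in> fst c" using z by (auto simp: S_def)
    have lin: "linear (to_chart A c p)" by (rule linear_to_chart[OF A c(1) p(4)]) (use D(2) p in auto)
    have e: "E' 1 p = a z *\<^sub>R E 1 p + b z *\<^sub>R E 2 p" "E' 2 p = - b z *\<^sub>R E 1 p + a z *\<^sub>R E 2 p"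
      using frame_rotation_coefficients(1,2)[OF M F F' \<eta> p(2,3)] unfolding p(1) ab[OF p(4)] .
    show ?thesis
      unfolding p(1) vf_rep_chart[OF A c(1) p(4)]
      unfolding e p(1)[symmetric] linear_add[OF lin] linear_cmul[OF lin] by simp
  qed
  have "frechet_derivative (?X' 2) (at (snd c q)) (?X' 1 (snd c q)) - frechet_derivative (?X' 1) (at (snd c q)) (?X' 2 (snd c q))
    = frechet_derivative (?X 2) (at (snd c q)) (?X 1 (snd c q)) - frechet_derivative (?X 1) (at (snd c q)) (?X 2 (snd c q))"
    by (rule rotated_frame_bracket[OF S vf_rep_differentiable[OF D(7) c(1) q(1) c(2)] vf_rep_differentiable[OF D(7) c(1) q(1) c(2)]
          a'0 b' _ _ b0 a1])
       (use rot in blast)+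
  then show ?thesis
    using vf_rep_chart_at[OF A qA] by (simp add: lie_bracket_def coord_at_def c_def)
qed

theorem proposition7:
  fixes A :: "'a::{t2_space,second_countable_topology} chart set"
    and \<Delta> :: "'a \<Rightarrow> (real^3) set"
    and ori :: "'a \<Rightarrow> real^3 \<Rightarrow> real^3 \<Rightarrow> bool"
    and g :: "'a \<Rightarrow> real^3 \<Rightarrow> real^3 \<Rightarrow> real"
    and U U' :: "'a set"
    and \<omega> \<omega>' :: "'a \<Rightarrow> real^3 \<Rightarrow> real"
    and E E' :: "3 \<Rightarrow> 'a \<Rightarrow> real^3"
    and \<eta> \<eta>' :: "3 \<Rightarrow> 'a \<Rightarrow> real^3 \<Rightarrow> real"
    and C C' :: "3 \<Rightarrow> 3 \<Rightarrow> 3 \<Rightarrow> 'a \<Rightarrow> real"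
  assumes "sub_riemannian_surface A \<Delta> ori g"
    and "surface A (singular_set A \<Delta>)"
    and "transversal A \<Delta> (singular_set A \<Delta>)"
    and "adapted_frame A \<Delta> ori g U \<omega> E" "dual_coframe U E \<eta>" "structure_equations A U \<eta> C"
    and "adapted_frame A \<Delta> ori g U' \<omega>' E'" "dual_coframe U' E' \<eta>'" "structure_equations A U' \<eta>' C'"
  shows "\<forall>q \<in> singular_set A \<Delta> \<inter> U \<inter> U'.
     (E' 1 q = E 1 q \<and> C' 1 1 2 q = C 1 1 2 q \<and> C' 2 1 2 q = C 2 1 2 q) \<or>
     (E' 1 q = - E 1 q \<and> C' 1 1 2 q = - C 1 1 2 q \<and> C' 2 1 2 q = - C 2 1 2 q)"
proof
  fix q assume "q \<in> singular_set A \<Delta> \<inter> U \<inter> U'"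
  then have sing: "q \<in> singular_set A \<Delta>" and q: "q \<in> U" "q \<in> U'" by auto
  note M = assms(1) and F = assms(4) and \<eta> = assms(5) and C = assms(6) and F' = assms(7) and \<eta>' = assms(8) and C' = assms(9)
  note D = adapted_frameD[OF F] and D' = adapted_frameD[OF F']
  have A: "oriented_atlas A" using M by (simp add: sub_riemannian_surface_def)
  have qA: "q \<in> mfd A" using D(2) q by blast
  have \<Delta>: "subspace (\<Delta> q)" "dim (\<Delta> q) = 2" "plane_orientation (\<Delta> q) (ori q)"
    using M qA by (auto simp: sub_riemannian_surface_def oriented_distribution_def)
  have 0: "nonholonomity A \<Delta> ori g \<omega> q = 0"
    by (rule nonholonomity_singular[OF M sing D(1) q(1) D(2,3,6)]) (use D(11)[OF q(1)] in blast)
  define B where "B = lie_bracket A (E 1) (E 2) q"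
  have B': "lie_bracket A (E' 1) (E' 2) q = B"
    unfolding B_def by (rule adapted_frames_same_bracket[OF M F F' \<eta> q 0])
  have "\<omega> q B = 0" using nonholonomity_eq(1)[OF M D(1) q(1) D(2,3,1) q(1) D(2,6)] 0 by (simp add: B_def)
  then have "B \<in> \<Delta> q" using ann_section_kernel[OF D(3) q(1) \<Delta>(1,2)] by blast
  moreover have "ori q (E 1 q) (E 2 q)" using D(6) q by (auto simp: oriented_orthonormal_frame_def)
  ultimately obtain x y where B: "B = x *\<^sub>R E 1 q + y *\<^sub>R E 2 q"
    using positive_basis_expansion[OF \<Delta>(3)] by blast
  define e where "e = \<eta> 1 q (E' 1 q)"
  have s0: "\<eta> 2 q (E' 1 q) = 0" by (rule rotation_zero_on_singular_level[OF M F F' \<eta> q 0])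
  have E': "E' 1 q = e *\<^sub>R E 1 q" "E' 2 q = e *\<^sub>R E 2 q" "e\<^sup>2 = 1"
    using frame_rotation_coefficients[OF M F F' \<eta> q] unfolding s0 e_def[symmetric] by simp_all
  have e: "e = 1 \<or> e = - 1" using E'(3) by (simp add: power2_eq_1_iff)
  have B2: "B = (e * x) *\<^sub>R E' 1 q + (e * y) *\<^sub>R E' 2 q"
    using e by (auto simp: B E')
  have dual: "\<eta> a q (E b q) = (if a = b then 1 else 0)" "linear (\<eta> a q)"
    "\<eta>' a q (E' b q) = (if a = b then 1 else 0)" "linear (\<eta>' a q)" for a b
    using \<eta> \<eta>' q by (auto simp: dual_coframe_def)
  have "\<eta> 1 q B = x" "\<eta> 2 q B = y" by (simp_all add: B linear_add[OF dual(2)] linear_cmul[OF dual(2)] dual(1))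
  then have Cx: "C 1 1 2 q = - x" "C 2 1 2 q = - y"
    using structure_coefficient_eq_bracket[OF A F \<eta> C q(1)] by (simp_all flip: B_def)
  have "\<eta>' 1 q B = e * x" "\<eta>' 2 q B = e * y"
    by (simp_all add: B2 linear_add[OF dual(4)] linear_cmul[OF dual(4)] dual(3))
  then have Cx': "C' 1 1 2 q = - (e * x)" "C' 2 1 2 q = - (e * y)"
    using structure_coefficient_eq_bracket[OF A F' \<eta>' C' q(2)] by (simp_all add: B')
  show "(E' 1 q = E 1 q \<and> C' 1 1 2 q = C 1 1 2 q \<and> C' 2 1 2 q = C 2 1 2 q) \<or>
     (E' 1 q = - E 1 q \<and> C' 1 1 2 q = - C 1 1 2 q \<and> C' 2 1 2 q = - C 2 1 2 q)"
    using e unfolding Cx Cx' E'(1) by auto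
qed

end
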